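(* Let $\tilde{X}$ be a smooth cubic surface (in $\mathbb{P}_3$) defined over a number field $k$. Let $L_1,\ldots,L_5$ be five lines on $\tilde X$ lying on two hyperplane sections of $\tilde{X}$, and put $X=\tilde{X}\setminus(L_1\cup\ldots\cup L_5)$. Then there exist a finite extension $k'$ of $k$ and a finite set $S$ of places of $k'$ (containing the archimedean ones) such that the set $X(\mathcal{O}_S)$ of $S$-integral points is Zariski-dense. Also, there exist a configuration of nine lines $L_1',\ldots,L_9'$ on $\tilde X$ and a Zariski-dense set of $S$-integral points on $\tilde{X}\setminus(L_1'\cup\ldots\cup L_9')$.
   Context: The lines are understood to be distinct and defined over $k'$, and $\mathcal{O}_S$ is the ring of $S$-integers of $k'$. For a non-archimedean place $\nu$ of $k'$ with residue field $k'_\nu$ there is a reduction map $\mathbb{P}_N(k')\to\mathbb{P}_N(k'_\nu)$. For a projective variety $\tilde X\subset\mathbb{P}_N$ and a hypersurface (closed subvariety of codimension one) $D\subset\tilde X$, both defined over $k'$, the reduction $D_\nu$ of $D$ modulo $\nu$ is the variety over $k'_\nu$ whose $\overline{k'_\nu}$-points are the reductions of the points of $D(\overline{k'})$ with respect to an extension of $\nu$ to $\overline{k'}$ (for all but finitely many $\nu$ it is obtained by reducing equations of $D$ modulo $\nu$). A point $P\in(\tilde X\setminus D)(k')$ is called $S$-integral if for every place $\nu$ of $k'$ outside $S$ the reduction of $P$ modulo $\nu$ does not lie in $D_\nu$; $X(\mathcal{O}_S)$ denotes the set of $S$-integral points of $X=\tilde X\setminus D$. *)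

theory Defs
  imports
    "HOL-Analysis.Cartesian_Space"
    "HOL-Library.Numeral_Type"
    "HOL-Algebra.Algebraic_Closure_Type"
    "HOL-Algebra.Embedded_Algebras"
begin

section \<open>Number fields\<close>

text \<open>
  Number fields are the subfields of a fixed algebraic closure of the rationals that have finite
  degree over the rationals; every number field is isomorphic to one of these, and the algebraic
  closure of each of them is the whole type.
\<close>

type_synonym qbar = "rat alg_closure"

abbreviation qbar_ring :: "qbar ring" where
  "qbar_ring \<equiv> ring_of_type_algebra"

definition finite_extension :: "qbar set \<Rightarrow> qbar set \<Rightarrow> bool" where
  "finite_extension k k' \<longleftrightarrow> subfield k qbar_ring \<and> subfield k' qbar_ring \<and> k \<subseteq> k'
     \<and> ring.finite_dimension qbar_ring k k'"

definition number_field :: "qbar set \<Rightarrow> bool" where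
  "number_field k \<longleftrightarrow> finite_extension \<rat> k"


section \<open>Places\<close>

text \<open>
  An absolute value on \<open>k\<close> is a total function of which only the values on \<open>k\<close> matter, so a
  place (a class of equivalent nontrivial absolute values) also contains every function on the
  type that agrees on \<open>k\<close> with one of these.
\<close>

definition absolute_value :: "qbar set \<Rightarrow> (qbar \<Rightarrow> real) \<Rightarrow> bool" where
  "absolute_value k v \<longleftrightarrow>
     (\<forall>x\<in>k. 0 \<le> v x \<and> (v x = 0 \<longleftrightarrow> x = 0)) \<and>
     (\<forall>x\<in>k. \<forall>y\<in>k. v (x * y) = v x * v y \<and> v (x + y) \<le> v x + v y)"

definition nontrivial_absolute_value :: "qbar set \<Rightarrow> (qbar \<Rightarrow> real) \<Rightarrow> bool" where
  "nontrivial_absolute_value k v \<longleftrightarrow> absolute_value k v \<and> (\<exists>x\<in>k. x \<noteq> 0 \<and> v x \<noteq> 1)"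

definition absolute_value_equiv :: "qbar set \<Rightarrow> ((qbar \<Rightarrow> real) \<times> (qbar \<Rightarrow> real)) set" where
  "absolute_value_equiv k =
     {(v, v'). nontrivial_absolute_value k v \<and> nontrivial_absolute_value k v' \<and>
               (\<exists>s>0. \<forall>x\<in>k. v' x = v x powr s)}"

definition places :: "qbar set \<Rightarrow> (qbar \<Rightarrow> real) set set" where
  "places k = {v. nontrivial_absolute_value k v} // absolute_value_equiv k"

definition archimedean_places :: "qbar set \<Rightarrow> (qbar \<Rightarrow> real) set set" where
  "archimedean_places k =
     {\<nu> \<in> places k. \<exists>v\<in>\<nu>. \<exists>x\<in>k. \<exists>y\<in>k. v (x + y) > max (v x) (v y)}"

text \<open>
  Since \<open>\<nu>\<close> contains every function representing it on its number field, membership of \<open>w\<close> says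
  that the restriction of \<open>w\<close> to that field represents \<open>\<nu>\<close>.
\<close>

definition extends_place :: "(qbar \<Rightarrow> real) set \<Rightarrow> (qbar \<Rightarrow> real) \<Rightarrow> bool" where
  "extends_place \<nu> w \<longleftrightarrow> absolute_value UNIV w \<and> w \<in> \<nu>"


section \<open>Projective space over the algebraic closure\<close>

text \<open>A projective point is the set of all its homogeneous coordinate vectors.\<close>

type_synonym point = "(qbar ^ 4) set"

definition proj_point :: "qbar ^ 4 \<Rightarrow> point" where
  "proj_point x = {c *s x | c. c \<noteq> 0}"

definition rational_points :: "qbar set \<Rightarrow> point set" where
  "rational_points k = {proj_point x | x. x \<noteq> 0 \<and> (\<forall>i. x $ i \<in> k)}"

abbreviation proj_space :: "point set" where
  "proj_space \<equiv> rational_points UNIV"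

definition linear_subspace :: "qbar set \<Rightarrow> nat \<Rightarrow> point set \<Rightarrow> bool" where
  "linear_subspace k r \<Lambda> \<longleftrightarrow>
     (\<exists>B. (\<forall>x\<in>B. \<forall>i. x $ i \<in> k) \<and> vec.dim (vec.span B) = r + 1 \<and>
          \<Lambda> = proj_point ` (vec.span B - {0}))"

definition line_over :: "qbar set \<Rightarrow> point set \<Rightarrow> bool" where
  "line_over k \<Lambda> \<longleftrightarrow> linear_subspace k 1 \<Lambda>"

definition plane_over :: "qbar set \<Rightarrow> point set \<Rightarrow> bool" where
  "plane_over k \<Lambda> \<longleftrightarrow> linear_subspace k 2 \<Lambda>"


section \<open>Forms and Zariski density\<close>

text \<open>
  A form of degree \<open>d\<close> in four variables is given by its coefficients \<open>c e\<close>, where \<open>e\<close> is an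
  exponent vector of total degree \<open>d\<close>; the values of \<open>c\<close> at other exponent vectors are ignored.
\<close>

definition exponents :: "nat \<Rightarrow> (4 \<Rightarrow> nat) set" where
  "exponents d = {e. (\<Sum>i\<in>UNIV. e i) = d}"

lemma finite_exponents: "finite (exponents d)"
proof (rule finite_subset)
  show "exponents d \<subseteq> UNIV \<rightarrow>\<^sub>E {..d}"
    by (auto simp: exponents_def PiE_def intro: member_le_sum)
  show "finite ((UNIV :: 4 set) \<rightarrow>\<^sub>E {..d})"
    by (intro finite_PiE) auto
qed

definition form :: "nat \<Rightarrow> ((4 \<Rightarrow> nat) \<Rightarrow> qbar) \<Rightarrow> qbar ^ 4 \<Rightarrow> qbar" where
  "form d c x = (\<Sum>e\<in>exponents d. c e * (\<Prod>i\<in>UNIV. x $ i ^ e i))"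

definition form_partial :: "nat \<Rightarrow> ((4 \<Rightarrow> nat) \<Rightarrow> qbar) \<Rightarrow> 4 \<Rightarrow> qbar ^ 4 \<Rightarrow> qbar" where
  "form_partial d c j x =
     (\<Sum>e\<in>exponents d. c e * of_nat (e j) * (\<Prod>i\<in>UNIV. x $ i ^ (if i = j then e i - 1 else e i)))"

definition zero_locus :: "nat \<Rightarrow> ((4 \<Rightarrow> nat) \<Rightarrow> qbar) \<Rightarrow> point set" where
  "zero_locus d c = {P \<in> proj_space. \<forall>x\<in>P. form d c x = 0}"

text \<open>Jacobian criterion for the surface cut out by the form; it excludes the zero form.\<close>

definition smooth_form :: "nat \<Rightarrow> ((4 \<Rightarrow> nat) \<Rightarrow> qbar) \<Rightarrow> bool" where
  "smooth_form d c \<longleftrightarrow> (\<forall>x. x \<noteq> 0 \<and> form d c x = 0 \<longrightarrow> (\<exists>j. form_partial d c j x \<noteq> 0))"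

definition zariski_closure :: "point set \<Rightarrow> point set" where
  "zariski_closure A = \<Inter> {zero_locus d c | d c. A \<subseteq> zero_locus d c}"

definition zariski_dense :: "point set \<Rightarrow> point set \<Rightarrow> bool" where
  "zariski_dense A Y \<longleftrightarrow> A \<subseteq> Y \<and> Y \<subseteq> zariski_closure A"


section \<open>Reduction and integral points\<close>

text \<open>
  For a nonarchimedean \<open>w\<close> and \<open>w x \<le> 1\<close>, \<open>residue w x\<close> is the residue class of \<open>x\<close> as a coset
  of the maximal ideal. When \<open>w\<close> extends a place \<open>\<nu>\<close>, the residue field of \<open>w\<close> is an algebraic
  closure of that of \<open>\<nu>\<close>.
\<close>

definition residue :: "(qbar \<Rightarrow> real) \<Rightarrow> qbar \<Rightarrow> qbar set" where
  "residue w x = {y. w (y - x) < 1}"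

text \<open>
  Two normalised coordinate vectors of \<open>P\<close> differ by a factor \<open>u\<close> with \<open>w u = 1\<close>, and the residue
  classes of such \<open>u\<close> are all the nonzero ones. So \<open>reduction w P\<close> is a projective point over the
  residue field of \<open>w\<close>, again given as the set of all its homogeneous coordinate vectors.
\<close>

definition reduction :: "(qbar \<Rightarrow> real) \<Rightarrow> point \<Rightarrow> (qbar set ^ 4) set" where
  "reduction w P = {(\<chi> i. residue w (x $ i)) | x. x \<in> P \<and> Max (range (\<lambda>i. w (x $ i))) = 1}"

text \<open>
  \<open>reduction w ` D\<close> is the set of geometric points of the reduction of \<open>D\<close> modulo \<open>\<nu>\<close>. The
  extensions \<open>w\<close> of \<open>\<nu>\<close> are conjugate over \<open>k\<close>, so for \<open>P\<close> and \<open>D\<close> defined over \<open>k\<close> the condition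
  does not depend on the choice of \<open>w\<close>.
\<close>

definition S_integral_points ::
    "qbar set \<Rightarrow> (qbar \<Rightarrow> real) set set \<Rightarrow> point set \<Rightarrow> point set \<Rightarrow> point set" where
  "S_integral_points k S Xt D =
     {P \<in> (Xt - D) \<inter> rational_points k.
        \<forall>\<nu>\<in>places k - S. \<forall>w. extends_place \<nu> w \<longrightarrow> reduction w P \<notin> reduction w ` D}"

end

(*
  After enlarging k and S, every constant in sight is an S-unit, so integrality need only be checked
  for the ultrametric absolute values of the algebraic closure that are 1 on finitely many constants.

  If the common line of the two planes is not among the five lines, unique factorisation on that line
  puts the cubic into the form l1 l2 l3 = m1 m2 m3. The planes m3 = u l2 cut out a pencil of conics,
  and explicit points on them, built from unit parameters u and a second family of units, avoid nine
  of the lines modulo every place outside S.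

  If the common line is one of the five, the cubic becomes x n1 n2 + y m1 m2. A plane y = u x cuts out
  a further conic, and a point of it avoids the five lines when a binary quadratic form takes a unit
  value in its direction. For unit u this is a Pell equation, which has infinitely many solutions.
  The equation is again of the form l1 l2 l3 = m1 m2 m3, which gives the nine lines.

  Only finitely many places are bad: by Ostrowski they induce finitely many places on the rationals,
  and by weak approximation at most [k' : Q] of them induce the same one.
*)
theory Submission
  imports Defs
begin

no_notation fps_nth (infixl "$" 75)

section \<open>Linear forms and linear subspaces\<close>

text \<open>One finite set of constants has to serve infinitely many points, so no point may bring a
  denominator of its own. The parameters are therefore built from powers of 2 and the fixed
  constants, and each denominator is a unit by design. Avoiding a line modulo a place then comes
  down to writing a known unit in terms of quantities that would all be small. Smoothness supplies
  these units: a nonzero vector at which two factors of each product vanish would be singular, so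
  certain minors of the coefficients are nonzero, hence units outside S. The trivial absolute value
  is ultrametric as well, and at it the unit statements become the nonvanishing statements that the
  construction needs. For density, a form that vanishes at all constructed points is a polynomial
  function of parameters that run through infinite sets. Hence it vanishes on the whole parametrised
  part of the surface, which omits only finitely many plane sections. These are recovered because no
  plane lies on a smooth cubic surface.\<close>

definition lf :: "'a::field ^ 'n \<Rightarrow> 'a ^ 'n \<Rightarrow> 'a" where
  "lf a x = (\<Sum>i\<in>UNIV. a $ i * x $ i)"

lemma lf_add [simp]: "lf a (x + y) = lf a x + lf a y"
  by (simp add: lf_def algebra_simps sum.distrib)

lemma lf_scale [simp]: "lf a (c *s x) = c * lf a x"
  by (simp add: lf_def sum_distrib_left algebra_simps)

lemma lf_add_left [simp]: "lf (a + b) x = lf a x + lf b x"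
  by (simp add: lf_def algebra_simps sum.distrib)

lemma lf_scale_left [simp]: "lf (c *s a) x = c * lf a x"
  by (simp add: lf_def sum_distrib_left algebra_simps)

lemma lf_zero [simp]: "lf a 0 = 0"
  by (simp add: lf_def)

lemma lf_zero_left [simp]: "lf 0 x = 0"
  by (simp add: lf_def)

lemma lf_diff [simp]: "lf a (x - y) = lf a x - lf a y"
  by (simp add: lf_def algebra_simps sum_subtractf)

lemma lf_minus_left [simp]: "lf (- a) x = - lf a x"
  by (simp add: lf_def sum_negf)

lemma lf_diff_left [simp]: "lf (a - b) x = lf a x - lf b x"
  by (simp add: lf_def algebra_simps sum_subtractf)

lemma lf_axis [simp]: "lf a (axis i 1) = a $ i"
proof -
  have "lf a (axis i 1) = (\<Sum>j\<in>UNIV. if j = i then a $ j else 0)"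
    unfolding lf_def by (intro sum.cong) (auto simp: axis_def)
  then show ?thesis by simp
qed

lemma lf_axis_left [simp]: "lf (axis i 1) x = x $ i"
proof -
  have "lf (axis i 1) x = (\<Sum>j\<in>UNIV. if j = i then x $ j else 0)"
    unfolding lf_def by (intro sum.cong) (auto simp: axis_def)
  then show ?thesis by simp
qed

lemma lf_eqI: "(\<And>x. lf a x = lf b x) \<Longrightarrow> a = b"
  by (metis lf_axis vec_eq_iff)

lemma lf_nonzero: "a \<noteq> 0 \<Longrightarrow> \<exists>v. lf a v = 1"
proof -
  assume "a \<noteq> 0"
  then obtain i where "a $ i \<noteq> 0" by (auto simp: vec_eq_iff)
  then have "lf a ((1 / a $ i) *s axis i 1) = 1" by (simp only: lf_scale lf_axis) simp
  then show ?thesis by blast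
qed

text \<open>The forms are the rows of an injective, hence invertible, square matrix; the columns of
  its inverse are the dual vectors.\<close>

lemma dual_basis:
  fixes A :: "'n \<Rightarrow> 'a::field ^ 'n"
  assumes "\<And>x. (\<And>i. lf (A i) x = 0) \<Longrightarrow> x = 0"
  obtains e where "\<And>i j. lf (A i) (e j) = (if i = j then 1 else 0)"
    and "\<And>x. x = (\<Sum>i\<in>UNIV. lf (A i) x *s e i)"
proof -
  define M where "M = (\<chi> i. A i)"
  have Mv: "M *v x = (\<chi> i. lf (A i) x)" for x
    by (simp add: M_def matrix_vector_mult_def lf_def vec_eq_iff)
  have "\<exists>B. B ** M = mat 1"
    unfolding matrix_left_invertible_ker using assms by (auto simp: Mv vec_eq_iff)
  then obtain B where B: "B ** M = mat 1" by blast
  then have B': "M ** B = mat 1" by (simp add: matrix_left_right_inverse)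
  define e where "e = (\<lambda>j. column j B)"
  have 1: "lf (A i) (e j) = (if i = j then 1 else 0)" for i j
  proof -
    have "lf (A i) (e j) = (M ** B) $ i $ j"
      by (simp add: M_def e_def lf_def column_def matrix_matrix_mult_def)
    then show ?thesis by (simp add: B' mat_def)
  qed
  have 2: "x = (\<Sum>i\<in>UNIV. lf (A i) x *s e i)" for x
  proof -
    have "x = B *v (M *v x)" by (simp add: matrix_vector_mul_assoc B)
    also have "\<dots> = (\<Sum>i\<in>UNIV. lf (A i) x *s e i)"
      unfolding Mv by (simp add: vec_eq_iff matrix_vector_mult_def e_def column_def mult.commute)
    finally show ?thesis .
  qed
  show ?thesis using 1 2 by (rule that)
qed

lemma dual_basis4:
  fixes a b c d :: "'a::field ^ 4"
  assumes "\<And>x. lf a x = 0 \<Longrightarrow> lf b x = 0 \<Longrightarrow> lf c x = 0 \<Longrightarrow> lf d x = 0 \<Longrightarrow> x = 0"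
  obtains e1 e2 e3 e4 where
    "lf a e1 = 1" "lf a e2 = 0" "lf a e3 = 0" "lf a e4 = 0"
    "lf b e1 = 0" "lf b e2 = 1" "lf b e3 = 0" "lf b e4 = 0"
    "lf c e1 = 0" "lf c e2 = 0" "lf c e3 = 1" "lf c e4 = 0"
    "lf d e1 = 0" "lf d e2 = 0" "lf d e3 = 0" "lf d e4 = 1"
    and "\<And>x. x = lf a x *s e1 + lf b x *s e2 + lf c x *s e3 + lf d x *s e4"
proof -
  define A where "A = (\<lambda>i::4. if i = 1 then a else if i = 2 then b else if i = 3 then c else d)"
  have A: "A 1 = a" "A 2 = b" "A 3 = c" "A 4 = d" by (simp_all add: A_def)
  have "x = 0" if "\<And>i. lf (A i) x = 0" for x
    using that[of 1] that[of 2] that[of 3] that[of 4] assms unfolding A by blast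
  from dual_basis[of A, OF this] obtain e where
    e: "\<And>i j. lf (A i) (e j) = (if i = j then 1 else 0)"
    and r: "\<And>x. x = (\<Sum>i\<in>UNIV. lf (A i) x *s e i)" by blast
  show ?thesis
  proof (rule that[of "e 1" "e 2" "e 3" "e 4"])
    show "x = lf a x *s e 1 + lf b x *s e 2 + lf c x *s e 3 + lf d x *s e 4" for x
      using r[of x] unfolding sum_4 A .
  qed (use e[of 1] e[of 2] e[of 3] e[of 4] in \<open>simp_all add: A\<close>)
qed

text \<open>Turns a span into equations: a basis of \<open>U\<close> is extended to a basis of the
  whole space, and \<open>U\<close> is the set where the coordinates along the added vectors
  vanish.\<close>

lemma subspace_dual_basis:
  fixes U :: "('a::field ^ 'n) set"
  assumes "vec.subspace U"
  obtains \<phi> :: "'n \<Rightarrow> 'a ^ 'n" and e I where "\<And>i j. lf (\<phi> i) (e j) = (if i = j then 1 else 0)"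
    and "U = {x. \<forall>i. i \<notin> I \<longrightarrow> lf (\<phi> i) x = 0}" and "card I = vec.dim U"
proof -
  obtain C where C: "C \<subseteq> U" "vec.independent C" "U \<subseteq> vec.span C" "card C = vec.dim U"
    by (rule vec.basis_exists)
  have UC: "U = vec.span C" using C assms vec.span_subspace by blast
  define D where "D = vec.extend_basis C"
  have D: "C \<subseteq> D" "vec.independent D" "vec.span D = UNIV"
    unfolding D_def using C(2) vec.extend_basis_superset vec.independent_extend_basis
      vec.span_extend_basis by auto
  have fin: "finite D" using D(2) by (rule vec.finiteI_independent)
  have "card D = CARD('n)"
    using vec.dim_eq_card_independent[OF D(2)] vec.dim_span[of D] D(3) by (simp add: card_cart_basis vec.dimension_def)
  then obtain f where f: "bij_betw f (UNIV :: 'n set) D"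
    using finite_same_card_bij[OF _ fin, of "UNIV :: 'n set"] by auto
  define M where "M = (\<chi> k i. f i $ k)"
  have col: "column i M = f i" for i by (simp add: M_def column_def vec_eq_iff)
  have "\<exists>B. B ** M = mat 1"
    unfolding matrix_left_invertible_independent_columns
  proof (intro allI impI)
    fix c i assume s: "(\<Sum>i\<in>UNIV. c i *s column i M) = 0"
    define g where "g = (\<lambda>v. c (the_inv_into UNIV f v))"
    have "(\<Sum>v\<in>D. g v *s v) = (\<Sum>i\<in>UNIV. g (f i) *s f i)"
      by (rule sum.reindex_bij_betw[OF f, symmetric])
    also have "\<dots> = 0" using s f by (simp add: col g_def bij_betw_def the_inv_into_f_f)
    finally have "g (f i) = 0"
      using vec.independentD[OF D(2) fin subset_refl] f by (metis bij_betwE UNIV_I)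
    then show "c i = 0" using f by (simp add: g_def bij_betw_def the_inv_into_f_f)
  qed
  then obtain B where B: "B ** M = mat 1" by blast
  then have B': "M ** B = mat 1" by (simp add: matrix_left_right_inverse)
  define \<phi> where "\<phi> = (\<lambda>i. B $ i)"
  have 1: "lf (\<phi> i) (f j) = (if i = j then 1 else 0)" for i j
  proof -
    have "lf (\<phi> i) (f j) = (B ** M) $ i $ j"
      by (simp add: M_def \<phi>_def lf_def matrix_matrix_mult_def)
    then show ?thesis by (simp add: B mat_def)
  qed
  have 2: "x = (\<Sum>i\<in>UNIV. lf (\<phi> i) x *s f i)" for x
  proof -
    have "x = M *v (B *v x)" by (simp add: matrix_vector_mul_assoc B')
    also have "\<dots> = (\<Sum>i\<in>UNIV. lf (\<phi> i) x *s f i)"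
      by (simp add: vec_eq_iff matrix_vector_mult_def \<phi>_def lf_def M_def mult.commute)
    finally show ?thesis .
  qed
  define I where "I = f -` C"
  have "vec.span C \<subseteq> {x. \<forall>i. i \<notin> I \<longrightarrow> lf (\<phi> i) x = 0}"
  proof (rule vec.span_minimal)
    show "C \<subseteq> {x. \<forall>i. i \<notin> I \<longrightarrow> lf (\<phi> i) x = 0}"
    proof (safe)
      fix x i assume "x \<in> C" "i \<notin> I"
      then obtain j where "x = f j" using D(1) f by (metis bij_betw_def imageE subsetD)
      with \<open>x \<in> C\<close> \<open>i \<notin> I\<close> show "lf (\<phi> i) x = 0" using 1 by (auto simp: I_def)
    qed
    show "vec.subspace {x. \<forall>i. i \<notin> I \<longrightarrow> lf (\<phi> i) x = 0}"
      by (rule vec.subspaceI) auto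
  qed
  moreover have "x \<in> vec.span C" if "\<forall>i. i \<notin> I \<longrightarrow> lf (\<phi> i) x = 0" for x
  proof -
    have "(\<Sum>i\<in>UNIV. lf (\<phi> i) x *s f i) \<in> vec.span C"
    proof (rule vec.span_sum)
      fix i show "lf (\<phi> i) x *s f i \<in> vec.span C"
        using that by (cases "i \<in> I") (auto simp: I_def vec.span_base vec.span_scale vec.span_zero)
    qed
    then show ?thesis by (subst 2)
  qed
  ultimately have "U = {x. \<forall>i. i \<notin> I \<longrightarrow> lf (\<phi> i) x = 0}" unfolding UC by blast
  moreover have "card I = vec.dim U"
    unfolding I_def using f C(4) D(1) by (metis bij_betw_def card_vimage_inj)
  ultimately show ?thesis by (rule that[OF 1])
qed

text \<open>Linear independence of two forms, given by dual vectors because the proofs project along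
  \<open>v\<close> and \<open>v'\<close>.\<close>

definition indep :: "'a::field ^ 'n \<Rightarrow> 'a ^ 'n \<Rightarrow> bool" where
  "indep l m \<longleftrightarrow> (\<exists>v v'. lf l v = 1 \<and> lf m v = 0 \<and> lf l v' = 0 \<and> lf m v' = 1)"

definition pplane :: "qbar ^ 4 \<Rightarrow> point set" where
  "pplane l = {proj_point x | x. x \<noteq> 0 \<and> lf l x = 0}"

definition pline :: "qbar ^ 4 \<Rightarrow> qbar ^ 4 \<Rightarrow> point set" where
  "pline l m = {proj_point x | x. x \<noteq> 0 \<and> lf l x = 0 \<and> lf m x = 0}"

lemma mem_proj_point [simp]: "x \<in> proj_point x"
  unfolding proj_point_def by (auto intro: exI[of _ 1])

lemma proj_point_eqD: "proj_point x = proj_point y \<Longrightarrow> \<exists>c. c \<noteq> 0 \<and> x = c *s y"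
  using mem_proj_point[of x] by (auto simp: proj_point_def)

lemma proj_point_scale: "c \<noteq> 0 \<Longrightarrow> proj_point (c *s x) = proj_point x"
proof -
  assume c: "c \<noteq> 0"
  have "d *s x = (d / c) *s (c *s x) \<and> d / c \<noteq> 0" if "d \<noteq> 0" for d using that c by simp
  then show ?thesis unfolding proj_point_def using c
    by (smt (verit, best) Collect_cong mult_eq_0_iff vector_smult_assoc)
qed

lemma proj_point_in_pplane [simp]: "x \<noteq> 0 \<Longrightarrow> proj_point x \<in> pplane l \<longleftrightarrow> lf l x = 0"
  unfolding pplane_def by (auto dest!: proj_point_eqD)

lemma proj_point_in_pline [simp]:
  "x \<noteq> 0 \<Longrightarrow> proj_point x \<in> pline l m \<longleftrightarrow> lf l x = 0 \<and> lf m x = 0"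
  unfolding pline_def by (auto dest!: proj_point_eqD)

lemma indep_commute: "indep l m \<longleftrightarrow> indep m l"
  unfolding indep_def by blast

lemma pline_commute: "pline l m = pline m l"
  unfolding pline_def by blast

text \<open>Moving \<open>x\<close> along the dual vectors into the common kernel shows that
  \<open>h\<close> is determined by its values at these two vectors.\<close>

lemma indep_kernel_span:
  assumes "indep l m" and "\<And>x. lf l x = 0 \<Longrightarrow> lf m x = 0 \<Longrightarrow> lf h x = 0"
  obtains \<alpha> \<beta> where "h = \<alpha> *s l + \<beta> *s m"
proof -
  obtain v v' where v: "lf l v = 1" "lf m v = 0" "lf l v' = 0" "lf m v' = 1"
    using assms(1) by (auto simp: indep_def)
  have "h = lf h v *s l + lf h v' *s m"
  proof (rule lf_eqI)
    fix x
    have "lf h (x - lf l x *s v - lf m x *s v') = 0"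
      by (rule assms(2)) (simp_all add: v)
    then show "lf h x = lf (lf h v *s l + lf h v' *s m) x" by (simp add: algebra_simps)
  qed
  then show ?thesis using that by blast
qed

lemma indepI:
  assumes "l \<noteq> 0" "\<And>c. m \<noteq> c *s l"
  shows "indep l m"
proof -
  obtain v where v: "lf l v = 1" using lf_nonzero assms(1) by blast
  have "m - lf m v *s l \<noteq> 0" using assms(2)[of "lf m v"] by auto
  then obtain u where u: "lf (m - lf m v *s l) u = 1" using lf_nonzero by blast
  define v' where "v' = u - lf l u *s v"
  have v': "lf l v' = 0" "lf m v' = 1" using u by (simp_all add: v'_def v algebra_simps)
  have "lf l (v - lf m v *s v') = 1" "lf m (v - lf m v *s v') = 0" by (simp_all add: v v')
  then show ?thesis using v' unfolding indep_def by blast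
qed

lemma plane_over_pplane:
  assumes "plane_over UNIV H"
  obtains l where "l \<noteq> 0" and "H = pplane l"
proof -
  obtain B :: "(qbar ^ 4) set" where B: "vec.dim (vec.span B) = 3" "H = proj_point ` (vec.span B - {0})"
    using assms by (auto simp: plane_over_def linear_subspace_def)
  show ?thesis
  proof (rule subspace_dual_basis[OF vec.subspace_span[of B]])
    fix \<phi> e :: "4 \<Rightarrow> qbar ^ 4" and I
    assume \<phi>: "\<And>i j. lf (\<phi> i) (e j) = (if i = j then 1 else 0)"
      "vec.span B = {x. \<forall>i. i \<notin> I \<longrightarrow> lf (\<phi> i) x = 0}" "card I = vec.dim (vec.span B)"
    have "card (UNIV - I) = 1" using \<phi>(3) B(1) by (simp add: card_Diff_subset)
    then obtain i where i: "UNIV - I = {i}" using card_1_singletonE by blast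
    then have "j \<notin> I \<longleftrightarrow> j = i" for j by blast
    then have "vec.span B = {x. lf (\<phi> i) x = 0}" unfolding \<phi>(2) by simp
    then have "H = pplane (\<phi> i)" unfolding B(2) pplane_def by auto
    moreover have "\<phi> i \<noteq> 0" using \<phi>(1)[of i i] by auto
    ultimately show ?thesis using that by blast
  qed
qed

lemma line_over_pline:
  assumes "line_over UNIV L"
  obtains l m where "indep l m" and "L = pline l m"
proof -
  obtain B :: "(qbar ^ 4) set" where B: "vec.dim (vec.span B) = 2" "L = proj_point ` (vec.span B - {0})"
    using assms by (auto simp: line_over_def linear_subspace_def numeral_2_eq_2)
  show ?thesis
  proof (rule subspace_dual_basis[OF vec.subspace_span[of B]])
    fix \<phi> e :: "4 \<Rightarrow> qbar ^ 4" and I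
    assume \<phi>: "\<And>i j. lf (\<phi> i) (e j) = (if i = j then 1 else 0)"
      "vec.span B = {x. \<forall>i. i \<notin> I \<longrightarrow> lf (\<phi> i) x = 0}" "card I = vec.dim (vec.span B)"
    have "card (UNIV - I) = 2" using \<phi>(3) B(1) by (simp add: card_Diff_subset)
    then obtain i j where i: "UNIV - I = {i, j}" "i \<noteq> j" by (meson card_2_iff)
    then have "h \<notin> I \<longleftrightarrow> h = i \<or> h = j" for h by blast
    then have "vec.span B = {x. lf (\<phi> i) x = 0 \<and> lf (\<phi> j) x = 0}" unfolding \<phi>(2) by auto
    then have "L = pline (\<phi> i) (\<phi> j)" unfolding B(2) pline_def by auto
    moreover have "indep (\<phi> i) (\<phi> j)"
      unfolding indep_def
      by (rule exI[of _ "e i"], rule exI[of _ "e j"]) (use \<phi>(1) i(2) in auto)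
    ultimately show ?thesis using that by blast
  qed
qed

text \<open>The dual vectors span a complement of the common kernel, so the kernel has dimension 4 -
  2 = 2.\<close>

lemma pline_line_over:
  assumes "indep l m"
  shows "line_over UNIV (pline l m)"
proof -
  obtain v v' where v: "lf l v = 1" "lf m v = 0" "lf l v' = 0" "lf m v' = 1"
    using assms by (auto simp: indep_def)
  define U where "U = {x. lf l x = 0 \<and> lf m x = 0}"
  define V where "V = vec.span {v, v'}"
  have U: "vec.subspace U" unfolding U_def by (rule vec.subspaceI) auto
  have ne: "v \<noteq> v'" using v by auto
  have ind: "vec.independent {v, v'}"
  proof -
    have "v' \<notin> vec.span {}" using v by auto
    moreover have "v \<notin> vec.span {v'}" using v by (auto simp: vec.span_singleton)
    ultimately show ?thesis using ne by (simp add: vec.independent_insert)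
  qed
  have dV: "vec.dim V = 2" unfolding V_def
    using vec.dim_eq_card_independent[OF ind] ne by (simp add: vec.dim_span)
  have int: "U \<inter> V \<subseteq> {0}"
  proof
    fix x assume "x \<in> U \<inter> V"
    then obtain a b where "x = a *s v + b *s v'" and x: "lf l x = 0" "lf m x = 0"
      unfolding U_def V_def by (auto simp: vec.span_insert vec.span_singleton algebra_simps)
    then show "x \<in> {0}" by (simp add: v)
  qed
  have "{x + y |x y. x \<in> U \<and> y \<in> V} = UNIV"
  proof -
    have "x = (x - lf l x *s v - lf m x *s v') + (lf l x *s v + lf m x *s v')" for x
      by (simp add: algebra_simps)
    moreover have "x - lf l x *s v - lf m x *s v' \<in> U" for x by (simp add: U_def v)
    moreover have "lf l x *s v + lf m x *s v' \<in> V" for x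
      unfolding V_def by (intro vec.span_add vec.span_scale vec.span_base) auto
    ultimately show ?thesis by blast
  qed
  then have "vec.dim U + vec.dim V = 4 + vec.dim (U \<inter> V)"
    using vec.dim_sums_Int[OF U, of V] by (simp add: V_def card_cart_basis)
  moreover have "vec.dim (U \<inter> V) = 0" using int by (simp add: vec.dim_eq_0)
  ultimately have "vec.dim U = 2" using dV by simp
  moreover have "pline l m = proj_point ` (vec.span U - {0})"
    unfolding vec.span_eq_iff[THEN iffD2, OF U] by (auto simp: pline_def U_def)
  ultimately show ?thesis
    unfolding line_over_def linear_subspace_def by (intro exI[of _ U]) (simp add: vec.dim_span)
qed

text \<open>A basis of the plane of coordinate vectors has finitely many coordinates. Adjoining them
  turns lines found over the algebraic closure into lines over \<open>k'\<close>.\<close>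

lemma line_over_finite:
  assumes "line_over UNIV L"
  obtains E where "finite E" and "\<And>K. E \<subseteq> K \<Longrightarrow> line_over K L"
proof -
  obtain B :: "(qbar ^ 4) set" where B: "vec.dim (vec.span B) = 2" "L = proj_point ` (vec.span B - {0})"
    using assms by (auto simp: line_over_def linear_subspace_def numeral_2_eq_2)
  obtain C where C: "C \<subseteq> vec.span B" "vec.independent C" "vec.span B \<subseteq> vec.span C"
    by (rule vec.basis_exists)
  have s: "vec.span C = vec.span B" using C by (metis vec.span_subspace vec.subspace_span)
  have "finite C" using C(2) by (rule vec.finiteI_independent)
  define E where "E = (\<Union>x\<in>C. range (\<lambda>i. x $ i))"
  have "finite E" unfolding E_def using \<open>finite C\<close> by auto
  moreover have "line_over K L" if "E \<subseteq> K" for K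
    unfolding line_over_def linear_subspace_def
    by (rule exI[of _ C]) (use that B s in \<open>auto simp: E_def numeral_2_eq_2\<close>)
  ultimately show ?thesis using that by blast
qed

section \<open>Homogeneous polynomial functions\<close>

definition polyfun :: "(qbar \<Rightarrow> qbar) \<Rightarrow> bool" where
  "polyfun f \<longleftrightarrow> (\<exists>p. \<forall>s. f s = poly p s)"

lemma polyfun_const [simp, intro]: "polyfun (\<lambda>s. c)"
  unfolding polyfun_def by (rule exI[of _ "[:c:]"]) simp

lemma polyfun_id [simp, intro]: "polyfun (\<lambda>s. s)"
  unfolding polyfun_def by (rule exI[of _ "[:0, 1:]"]) simp

lemma polyfun_poly [simp, intro]: "polyfun (\<lambda>s. poly p s)"
  unfolding polyfun_def by blast

lemma polyfun_add [simp, intro]: "polyfun f \<Longrightarrow> polyfun g \<Longrightarrow> polyfun (\<lambda>s. f s + g s)"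
  unfolding polyfun_def by (metis poly_add)

lemma polyfun_diff [simp, intro]: "polyfun f \<Longrightarrow> polyfun g \<Longrightarrow> polyfun (\<lambda>s. f s - g s)"
  unfolding polyfun_def by (metis poly_diff)

lemma polyfun_minus [simp, intro]: "polyfun f \<Longrightarrow> polyfun (\<lambda>s. - f s)"
  unfolding polyfun_def by (metis poly_minus)

lemma polyfun_mult [simp, intro]: "polyfun f \<Longrightarrow> polyfun g \<Longrightarrow> polyfun (\<lambda>s. f s * g s)"
  unfolding polyfun_def by (metis poly_mult)

lemma polyfun_power [simp, intro]: "polyfun f \<Longrightarrow> polyfun (\<lambda>s. f s ^ n)"
  by (induction n) auto

lemma polyfun_sum [intro]: "(\<And>i. i \<in> A \<Longrightarrow> polyfun (f i)) \<Longrightarrow> polyfun (\<lambda>s. \<Sum>i\<in>A. f i s)"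
  by (induction A rule: infinite_finite_induct) auto

lemma polyfun_zero:
  assumes "polyfun f" "infinite A" "\<And>s. s \<in> A \<Longrightarrow> f s = 0"
  shows "f s = 0"
proof -
  obtain p where p: "\<And>s. f s = poly p s" using assms(1) by (auto simp: polyfun_def)
  have "p = 0"
  proof (rule ccontr)
    assume "p \<noteq> 0"
    then have "finite {s. poly p s = 0}" by (rule poly_roots_finite)
    moreover have "A \<subseteq> {s. poly p s = 0}" using assms(3) p by auto
    ultimately show False using assms(2) finite_subset by blast
  qed
  then show ?thesis by (simp add: p)
qed

lemma infinite_qbar: "infinite (UNIV :: qbar set)"
  by (rule infinite_UNIV_char_0)

lemma polyfun_zero_except:
  assumes "polyfun f" "finite A" "\<And>s. s \<notin> A \<Longrightarrow> f s = 0"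
  shows "f s = 0"
  by (rule polyfun_zero[of f "- A"]) (use assms infinite_qbar in \<open>auto simp: Compl_eq_Diff_UNIV\<close>)

lemma polyfun_lf [intro]:
  assumes "\<And>i. polyfun (\<lambda>s. v s $ i)"
  shows "polyfun (\<lambda>s. lf a (v s))"
  unfolding lf_def using assms by (intro polyfun_sum polyfun_mult polyfun_const)

text \<open>Homogeneous polynomial functions, presented by the products of linear forms spanning them:
  this makes composition with linear maps and division by a linear form immediate.\<close>

inductive hp :: "nat \<Rightarrow> (qbar ^ 4 \<Rightarrow> qbar) \<Rightarrow> bool" where
  hp_const: "hp 0 (\<lambda>x. c)"
| hp_lf_mult: "hp d f \<Longrightarrow> hp (Suc d) (\<lambda>x. lf a x * f x)"
| hp_add: "hp d f \<Longrightarrow> hp d g \<Longrightarrow> hp d (\<lambda>x. f x + g x)"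

lemma hp_cmult: "hp d f \<Longrightarrow> hp d (\<lambda>x. c * f x)"
proof (induction rule: hp.induct)
  case (hp_const b) show ?case by (rule hp.hp_const)
next
  case (hp_lf_mult d f a)
  have "hp (Suc d) (\<lambda>x. lf a x * (c * f x))" by (rule hp.hp_lf_mult) (rule hp_lf_mult.IH)
  then show ?case by (simp add: mult.left_commute)
next
  case (hp_add d f g)
  have "hp d (\<lambda>x. c * f x + c * g x)" by (rule hp.hp_add[OF hp_add.IH])
  then show ?case by (simp add: distrib_left)
qed

lemma hp_diff: "hp d f \<Longrightarrow> hp d g \<Longrightarrow> hp d (\<lambda>x. f x - g x)"
  using hp_add[of d f "\<lambda>x. -1 * g x"] hp_cmult[of d g "-1"] by simp

lemma hp_zero: "hp d (\<lambda>x. 0)"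
proof (induction d)
  case 0 show ?case by (rule hp_const)
next
  case (Suc d) then show ?case using hp_lf_mult[of d "\<lambda>x. 0" 0] by simp
qed

lemma hp_sum: "(\<And>i. i \<in> A \<Longrightarrow> hp d (f i)) \<Longrightarrow> hp d (\<lambda>x. \<Sum>i\<in>A. f i x)"
  by (induction A rule: infinite_finite_induct) (auto intro: hp_zero hp_add)

lemma hp_lf: "hp 1 (lf a)"
  using hp_lf_mult[OF hp_const[of 1], of a] by simp

lemma hp_mult: "hp d f \<Longrightarrow> hp d' g \<Longrightarrow> hp (d + d') (\<lambda>x. f x * g x)"
proof (induction rule: hp.induct)
  case (hp_const c) then show ?case by (simp add: hp_cmult)
next
  case (hp_lf_mult d f a) then show ?case using hp.hp_lf_mult[of "d + d'" _ a] by (simp add: mult.assoc)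
next
  case (hp_add d f h)
  then show ?case using hp.hp_add[of "d + d'" "\<lambda>x. f x * g x" "\<lambda>x. h x * g x"] by (simp add: distrib_right)
qed

lemma hp_power: "hp d f \<Longrightarrow> hp (n * d) (\<lambda>x. f x ^ n)"
proof (induction n)
  case 0 show ?case using hp_const[of 1] by simp
next
  case (Suc n) then show ?case using hp_mult[of d f "n * d" "\<lambda>x. f x ^ n"] by simp
qed

lemma hp_prod: "finite A \<Longrightarrow> (\<And>i. i \<in> A \<Longrightarrow> hp (d i) (f i)) \<Longrightarrow> hp (\<Sum>i\<in>A. d i) (\<lambda>x. \<Prod>i\<in>A. f i x)"
  by (induction A rule: finite_induct) (auto intro: hp_mult hp_const)

lemma hp_form: "hp d (form d c)"
proof -
  have "hp d (\<lambda>x. c e * (\<Prod>i\<in>UNIV. x $ i ^ e i))" if "e \<in> exponents d" for e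
  proof -
    have "hp (\<Sum>i\<in>UNIV. e i) (\<lambda>x. \<Prod>i\<in>UNIV. x $ i ^ e i)"
    proof (rule hp_prod)
      fix i
      have "hp (e i * 1) (\<lambda>x. lf (axis i 1) x ^ e i)" by (rule hp_power[OF hp_lf])
      then show "hp (e i) (\<lambda>x. x $ i ^ e i)" by simp
    qed simp
    then show ?thesis using that by (auto simp: exponents_def intro: hp_cmult)
  qed
  then have "hp d (\<lambda>x. \<Sum>e\<in>exponents d. c e * (\<Prod>i\<in>UNIV. x $ i ^ e i))" by (rule hp_sum)
  then show ?thesis unfolding form_def .
qed

lemma hp_degree_0: "hp d f \<Longrightarrow> d = 0 \<Longrightarrow> \<exists>c. \<forall>x. f x = c"
  by (induction rule: hp.induct) auto

lemma hp_degree_1: "hp d f \<Longrightarrow> d = 1 \<Longrightarrow> \<exists>a. \<forall>x. f x = lf a x"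
proof (induction rule: hp.induct)
  case (hp_lf_mult d f a)
  then obtain c where "\<And>x. f x = c" using hp_degree_0[OF hp_lf_mult.hyps] by auto
  then show ?case by (intro exI[of _ "c *s a"]) (simp add: mult.commute)
next
  case (hp_add d f g)
  then obtain a b where "\<And>x. f x = lf a x" "\<And>x. g x = lf b x" by auto
  then show ?case by (intro exI[of _ "a + b"]) simp
qed auto

lemma hp_scale: "hp d f \<Longrightarrow> f (c *s x) = c ^ d * f x"
  by (induction rule: hp.induct) (auto simp: algebra_simps)

lemma hp_polyfun: "hp d f \<Longrightarrow> (\<And>i. polyfun (\<lambda>s. v s $ i)) \<Longrightarrow> polyfun (\<lambda>s. f (v s))"
  by (induction rule: hp.induct) (auto intro!: polyfun_mult polyfun_lf)

lemma hp_line_polyfun: "hp d f \<Longrightarrow> polyfun (\<lambda>s. f (x + s *s y))"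
  by (erule hp_polyfun) (simp add: polyfun_add polyfun_mult)

lemma hp_compose_projection:
  "hp d f \<Longrightarrow> hp d (\<lambda>x. f (x - lf l x *s v))"
proof (induction rule: hp.induct)
  case (hp_const c) show ?case by (rule hp.hp_const)
next
  case (hp_lf_mult d f a)
  have "hp (Suc d) (\<lambda>x. lf (a - lf a v *s l) x * f (x - lf l x *s v))"
    by (rule hp.hp_lf_mult[OF hp_lf_mult.IH])
  then show ?case by (simp add: mult.commute)
next
  case (hp_add d f g)
  then show ?case by (intro hp.hp_add)
qed

text \<open>Replacing \<open>x\<close> by \<open>x - lf l x *s v\<close> changes each linear factor
  by a multiple of \<open>lf l x\<close>. When \<open>lf l v = 1\<close> the new point lies in the
  plane \<open>l = 0\<close>, and this is division by \<open>l\<close> with remainder.\<close>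

lemma hp_split_linear:
  "hp n f \<Longrightarrow> n = Suc d \<Longrightarrow> \<exists>g. hp d g \<and> (\<forall>x. f x = f (x - lf l x *s v) + lf l x * g x)"
proof (induction arbitrary: d rule: hp.induct)
  case (hp_lf_mult n f a)
  then have n: "n = d" by simp
  note hf = hp_lf_mult.hyps
  show ?case
  proof (cases d)
    case 0
    with hf n obtain c where c: "\<And>x. f x = c" using hp_degree_0 by blast
    show ?thesis unfolding 0
      by (intro exI[of _ "\<lambda>x. lf a v * c"] conjI hp_const) (simp add: c algebra_simps)
  next
    case (Suc d')
    then have "n = Suc d'" using n by simp
    then obtain g where g: "hp d' g" "\<And>x. f x = f (x - lf l x *s v) + lf l x * g x"
      using hp_lf_mult.IH by blast
    have "hp d (\<lambda>x. lf a x * g x + lf a v * f (x - lf l x *s v))"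
      using hp.hp_add[OF hp.hp_lf_mult[OF g(1), of a]
          hp_cmult[OF hp_compose_projection[OF hf[unfolded n Suc]], of "lf a v" l v]]
      by (simp add: Suc)
    moreover have "lf a x * f x = lf a (x - lf l x *s v) * f (x - lf l x *s v)
        + lf l x * (lf a x * g x + lf a v * f (x - lf l x *s v))" for x
      by (subst g(2)) (simp add: algebra_simps)
    ultimately show ?thesis by (intro exI conjI allI)
  qed
next
  case (hp_add n f g)
  obtain f' where f': "hp d f'" "\<And>x. f x = f (x - lf l x *s v) + lf l x * f' x"
    using hp_add.IH(1)[OF hp_add.prems] by blast
  obtain g' where g': "hp d g'" "\<And>x. g x = g (x - lf l x *s v) + lf l x * g' x"
    using hp_add.IH(2)[OF hp_add.prems] by blast
  have "f x + g x = f (x - lf l x *s v) + g (x - lf l x *s v) + lf l x * (f' x + g' x)" for x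
    by (subst f'(2), subst g'(2)) (simp add: algebra_simps)
  then show ?case using hp.hp_add[OF f'(1) g'(1)] by (intro exI conjI allI)
qed simp

lemma hp_divide_linear:
  assumes "hp (Suc d) f" "l \<noteq> 0" "\<And>x. lf l x = 0 \<Longrightarrow> f x = 0"
  obtains g where "hp d g" "\<And>x. f x = lf l x * g x"
proof -
  obtain v where v: "lf l v = 1" using lf_nonzero assms(2) by blast
  obtain g where g: "hp d g" "\<And>x. f x = f (x - lf l x *s v) + lf l x * g x"
    using hp_split_linear[OF assms(1) refl] by blast
  have "f (x - lf l x *s v) = 0" for x by (rule assms(3)) (simp add: v)
  then have "f x = lf l x * g x" for x using g(2)[of x] by simp
  then show ?thesis by (rule that[OF g(1)])
qed

text \<open>The projections along the two dual vectors are combined; together they land in the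
  common kernel, where \<open>f\<close> vanishes.\<close>

lemma hp_divide_line:
  assumes "hp (Suc d) f" "indep l m" "\<And>x. lf l x = 0 \<Longrightarrow> lf m x = 0 \<Longrightarrow> f x = 0"
  obtains g h where "hp d g" "hp d h" "\<And>x. f x = lf l x * g x + lf m x * h x"
proof -
  obtain v v' where v: "lf l v = 1" "lf m v = 0" "lf l v' = 0" "lf m v' = 1"
    using assms(2) by (auto simp: indep_def)
  obtain g where g: "hp d g" "\<And>x. f x = f (x - lf l x *s v) + lf l x * g x"
    using hp_split_linear[OF assms(1) refl] by blast
  obtain h where h: "hp d h" "\<And>x. f (x - lf l x *s v) = f ((x - lf m x *s v') - lf l (x - lf m x *s v') *s v) + lf m x * h x"
    using hp_split_linear[OF hp_compose_projection[OF assms(1), of l v] refl, of m v'] by blast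
  have "f ((x - lf m x *s v') - lf l (x - lf m x *s v') *s v) = 0" for x
    by (rule assms(3)) (simp_all add: v)
  then have "f x = lf l x * g x + lf m x * h x" for x
    using g(2)[of x] h(2)[of x] by simp
  then show ?thesis by (rule that[OF g(1) h(1)])
qed

lemma hp_root_on_line:
  assumes "hp (Suc d) f" "a \<noteq> 0" "\<And>c. b \<noteq> c *s a"
  obtains s t where "s *s a + t *s b \<noteq> 0" "f (s *s a + t *s b) = 0"
proof -
  have nz: "s *s a + t *s b \<noteq> 0" if "s \<noteq> 0 \<or> t \<noteq> 0" for s t
  proof
    assume 0: "s *s a + t *s b = 0"
    show False
    proof (cases "t = 0")
      case True then show False using 0 that assms(2) by simp
    next
      case False
      have "b $ i = - s / t * a $ i" for i
      proof -
        have "s * a $ i + t * b $ i = 0" using arg_cong[OF 0, of "\<lambda>x. x $ i"] by simp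
        then have "t * b $ i = - (s * a $ i)" by (simp add: add_eq_0_iff)
        then show ?thesis using False by (simp add: field_simps)
      qed
      then have "b = (- s / t) *s a" by (simp add: vec_eq_iff)
      then show False using assms(3) by blast
    qed
  qed
  obtain p where p: "\<And>s. f (b + s *s a) = poly p s"
    using hp_line_polyfun[OF assms(1)] unfolding polyfun_def by blast
  obtain q where q: "\<And>s. f (a + s *s b) = poly q s"
    using hp_line_polyfun[OF assms(1)] unfolding polyfun_def by blast
  show ?thesis
  proof (cases "Polynomial.degree p = 0")
    case False
    then obtain s where "poly p s = 0" using alg_closed_imp_poly_has_root by blast
    then show ?thesis using that[of s 1] nz[of s 1] p[of s] by (simp add: add.commute)
  next
    case True
    then obtain c where c: "p = [:c:]" by (rule degree_eq_zeroE)
    text \<open>If $f$ is constant on $b + s a$ then $f(a + s b)$ is a multiple of $s^{d+1}$.\<close>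
    have "f (a + s *s b) = c * s ^ Suc d" if "s \<noteq> 0" for s
    proof -
      have "a + s *s b = s *s (b + (1/s) *s a)" using that
        by (simp add: vector_smult_assoc vector_add_ldistrib)
      then show ?thesis using hp_scale[OF assms(1)] p[of "1/s"] by (simp add: c)
    qed
    then have "poly q s - c * s ^ Suc d = 0" if "s \<notin> {0}" for s using that by (simp add: q[symmetric])
    then have "poly q 0 - c * 0 ^ Suc d = 0"
      by (intro polyfun_zero_except[of "\<lambda>s. poly q s - c * s ^ Suc d" "{0}" 0]) auto
    then have "f a = 0" using q[of 0] by simp
    then show ?thesis using that[of 1 0] nz[of 1 0] by simp
  qed
qed

section \<open>Smoothness\<close>

text \<open>A point is singular when \<open>F\<close> vanishes there to second order along every
  line. In this form the condition can be tested on any presentation of \<open>F\<close> by linear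
  forms, without its coefficients.\<close>

definition nonsing :: "(qbar ^ 4 \<Rightarrow> qbar) \<Rightarrow> bool" where
  "nonsing F \<longleftrightarrow> (\<forall>x. x \<noteq> 0 \<and> F x = 0 \<longrightarrow> (\<exists>y. \<not> (\<exists>p. \<forall>s. F (x + s *s y) = s ^ 2 * poly p s)))"

lemma nonsingD:
  assumes "nonsing F" "x \<noteq> 0" "F x = 0" "\<And>y. \<exists>p. \<forall>s. F (x + s *s y) = s ^ 2 * poly p s"
  shows False
  using assms unfolding nonsing_def by blast

lemma pderiv_sum: "pderiv (sum f A) = (\<Sum>i\<in>A. pderiv (f i))"
  by (induction A rule: infinite_finite_induct) (auto simp: pderiv_add)

text \<open>The coefficient of \<open>s\<close> in \<open>form d c (x + s *s axis j 1)\<close> is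
  the \<open>j\<close>-th partial derivative at \<open>x\<close>.\<close>

lemma smooth_form_nonsing:
  assumes "smooth_form d c"
  shows "nonsing (form d c)"
  unfolding nonsing_def
proof (intro allI impI)
  fix x assume x: "x \<noteq> 0 \<and> form d c x = 0"
  then obtain j where j: "form_partial d c j x \<noteq> 0"
    using assms unfolding smooth_form_def by blast
  define R where "R = (\<lambda>e. \<Prod>i\<in>UNIV - {j}. x $ i ^ e i)"
  define Q where "Q = (\<Sum>e\<in>exponents d. smult (c e * R e) ([:x $ j, 1:] ^ e j))"
  have Qs: "form d c (x + s *s axis j 1) = poly Q s" for s
  proof -
    have "(\<Prod>i\<in>UNIV. (x + s *s axis j 1) $ i ^ e i) = (x $ j + s) ^ e j * R e" for e
      unfolding R_def by (subst prod.remove[of UNIV j]) (auto simp: axis_def intro!: arg_cong2[of _ _ _ _ "(*)"] prod.cong)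
    then show ?thesis
      by (simp add: form_def Q_def poly_sum add.commute mult_ac)
  qed
  have dQ: "poly (pderiv Q) 0 = form_partial d c j x"
  proof -
    have *: "(\<Prod>i\<in>UNIV. x $ i ^ (if i = j then e i - 1 else e i)) = x $ j ^ (e j - 1) * R e" for e
      unfolding R_def by (subst prod.remove[of UNIV j]) (auto intro!: prod.cong)
    have "pderiv ([:x $ j, 1:] ^ n) = smult (of_nat n) ([:x $ j, 1:] ^ (n - 1))" for n
      by (cases n) (simp_all add: pderiv_power_Suc pderiv_pCons del: power_Suc of_nat_Suc)
    then show ?thesis
      unfolding form_partial_def *
      by (simp add: Q_def pderiv_sum pderiv_smult poly_sum mult_ac)
  qed
  show "\<exists>y. \<not> (\<exists>p. \<forall>s. form d c (x + s *s y) = s ^ 2 * poly p s)"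
  proof (rule exI[of _ "axis j 1"], rule notI)
    assume "\<exists>p. \<forall>s. form d c (x + s *s axis j 1) = s ^ 2 * poly p s"
    then obtain p where "\<forall>s. poly Q s = s ^ 2 * poly p s" using Qs by auto
    then have "poly Q = poly ([:0, 0, 1:] * p)" by (auto simp: power2_eq_square)
    then have "Q = [:0, 0, 1:] * p" by (simp only: poly_eq_poly_eq_iff)
    then have "poly (pderiv Q) 0 = 0" by (simp only: pderiv_mult) (simp add: pderiv_pCons)
    then show False using dQ j by simp
  qed
qed

lemma plane_two_vectors:
  assumes "l \<noteq> (0 :: qbar ^ 4)"
  obtains a b where "lf l a = 0" "lf l b = 0" "a \<noteq> 0" "\<And>c. b \<noteq> c *s a"
proof -
  obtain i where i: "l $ i \<noteq> 0" using assms by (auto simp: vec_eq_iff)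
  \<comment> \<open>Since \<open>l $ i\<close> is nonzero, \<open>l\<close> can replace the
    \<open>i\<close>-th coordinate; the dual vectors of the other coordinates lie in the plane
    \<open>l = 0\<close>.\<close>
  define A where "A = (\<lambda>j. if j = i then l else axis j 1)"
  have "x = 0" if h: "\<And>j. lf (A j) x = 0" for x
  proof -
    have 1: "x $ j = 0" if "j \<noteq> i" for j using h[of j] that by (simp add: A_def)
    have "lf l x = (\<Sum>j\<in>UNIV. if j = i then l $ j * x $ j else 0)"
      unfolding lf_def using 1 by (intro sum.cong) auto
    then have "l $ i * x $ i = 0" using h[of i] by (simp add: A_def)
    then have "x $ i = 0" using i by simp
    then show ?thesis using 1 by (metis vec_eq_iff zero_index)
  qed
  from dual_basis[of A, OF this] obtain e where
    e: "\<And>i j. lf (A i) (e j) = (if i = j then 1 else 0)"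
    and "\<And>x. x = (\<Sum>i\<in>UNIV. lf (A i) x *s e i)" by blast
  have "card (UNIV - {i}) = 3" by (simp add: card_Diff_subset)
  then obtain j k h where jkh: "UNIV - {i} = {j, k, h}" "j \<noteq> k" unfolding card_3_iff by metis
  then have jk: "j \<noteq> i" "k \<noteq> i" "j \<noteq> k" by blast+
  show ?thesis
  proof (rule that[of "e j" "e k"])
    show "lf l (e j) = 0" "lf l (e k) = 0" using e[of i j] e[of i k] jk by (auto simp: A_def)
    show "e j \<noteq> 0" using e[of j j] by auto
    show "e k \<noteq> c *s e j" for c
    proof
      assume "e k = c *s e j"
      then have "lf (A k) (e k) = c * lf (A k) (e j)" by simp
      then show False using e[of k k] e[of k j] jk by auto
    qed
  qed
qed

text \<open>If \<open>F\<close> vanished on the plane it would be \<open>lf l x * g x\<close>, and a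
  common zero of \<open>l\<close> and the quadric \<open>g\<close> would be a singular
  point.\<close>

lemma nonsing_plane:
  assumes "hp 3 F" "nonsing F" "l \<noteq> 0"
  obtains e where "lf l e = 0" "F e \<noteq> 0"
proof (cases "\<exists>e. lf l e = 0 \<and> F e \<noteq> 0")
  case True then show ?thesis using that by blast
next
  case False
  have "hp (Suc 2) F" using assms(1) by (simp add: numeral_3_eq_3 numeral_2_eq_2)
  then obtain g where g: "hp 2 g" "\<And>x. F x = lf l x * g x"
    using hp_divide_linear[of 2 F l] assms(3) False by blast
  obtain a b where ab: "lf l a = 0" "lf l b = 0" "a \<noteq> 0" "\<And>c. b \<noteq> c *s a"
    using plane_two_vectors[OF assms(3)] by blast
  have "hp (Suc 1) g" using g(1) by (simp add: numeral_2_eq_2)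
  then obtain s t where st: "s *s a + t *s b \<noteq> 0" "g (s *s a + t *s b) = 0"
    using hp_root_on_line[OF _ ab(3,4)] by metis
  define x where "x = s *s a + t *s b"
  have x: "x \<noteq> 0" "g x = 0" "lf l x = 0" using st ab by (simp_all add: x_def)
  have "\<exists>p. \<forall>r. F (x + r *s y) = r ^ 2 * poly p r" for y
  proof -
    obtain q where q: "\<And>r. g (x + r *s y) = poly q r"
      using hp_line_polyfun[OF g(1)] unfolding polyfun_def by blast
    have "poly q 0 = 0" using q[of 0] x by simp
    then obtain q' where q': "q = [:0, 1:] * q'" using poly_eq_0_iff_dvd[of q 0] by auto
    show ?thesis
      by (intro exI[of _ "smult (lf l y) q'"] allI) (simp add: g(2) q x q' power2_eq_square)
  qed
  moreover have "F x = 0" using x by (simp add: g(2))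
  ultimately show ?thesis using nonsingD[OF assms(2) x(1)] by blast
qed

section \<open>Removing linear conditions\<close>

text \<open>The Nullstellensatz in one variable: each linear factor of \<open>p\<close> divides
  \<open>q\<close>, and the degree counts the factors with multiplicity.\<close>

lemma dvd_power_of_roots:
  fixes p q :: "qbar poly"
  assumes "p \<noteq> 0" "\<And>x. poly p x = 0 \<Longrightarrow> poly q x = 0"
  shows "p dvd q ^ Polynomial.degree p"
proof -
  obtain A where A: "size A = Polynomial.degree p"
    "p = smult (Polynomial.lead_coeff p) (\<Prod>x\<in>#A. [:- x, 1:])"
    using alg_closed_imp_factorization[OF assms(1)] by blast
  have *: "(\<Prod>x\<in>#B. [:- x, 1:]) dvd q ^ size B" if "\<And>x. x \<in># B \<Longrightarrow> poly q x = 0" for B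
    using that
  proof (induction B)
    case (add x B)
    have "[:- x, 1:] dvd q" using add.prems by (simp add: poly_eq_0_iff_dvd[symmetric])
    moreover have "(\<Prod>x\<in>#B. [:- x, 1:]) dvd q ^ size B" using add by simp
    ultimately show ?case
      by (simp only: image_mset_add_mset prod_mset.add_mset size_add_mset power_Suc mult_dvd_mono)
  qed simp
  have "poly q x = 0" if "x \<in># A" for x
  proof (rule assms(2))
    have "[:- x, 1:] dvd (\<Prod>x\<in>#A. [:- x, 1:])" using that by (intro dvd_prod_mset) auto
    then show "poly p x = 0" by (subst A(2)) (simp add: poly_eq_0_iff_dvd)
  qed
  then have "(\<Prod>x\<in>#A. [:- x, 1:]) dvd q ^ Polynomial.degree p" using * A(1) by metis
  then show ?thesis using A(2) assms(1) by (metis leading_coeff_0_iff smult_dvd)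
qed

text \<open>The restriction of \<open>f\<close> to a plane, as a polynomial in \<open>r\<close> over
  polynomials in \<open>s\<close>. The top coefficient \<open>f e\<close> is free of
  \<open>s\<close>, so when it is nonzero the degree in \<open>r\<close> does not drop for any
  \<open>s\<close>.\<close>

lemma hp_bivariate:
  assumes "hp d f"
  shows "\<exists>p :: qbar poly poly. Polynomial.degree p \<le> d \<and> Polynomial.coeff p d = [:f e:] \<and>
    (\<forall>s r. poly (poly p [:r:]) s = f (x + s *s y + r *s e))"
  using assms
proof (induction rule: hp.induct)
  case (hp_const c)
  show ?case by (rule exI[of _ "[:[:c:]:]"]) simp
next
  case (hp_lf_mult d f a)
  then obtain p where p: "Polynomial.degree p \<le> d" "Polynomial.coeff p d = [:f e:]"
    "\<And>s r. poly (poly p [:r:]) s = f (x + s *s y + r *s e)" by blast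
  have "Polynomial.degree ([:[:lf a x, lf a y:], [:lf a e:]:] * p) \<le> 1 + d"
    by (rule order.trans[OF degree_mult_le]) (use p(1) in \<open>auto intro!: add_mono\<close>)
  moreover have "Polynomial.coeff p (Suc d) = 0" using p(1) by (simp add: coeff_eq_0)
  ultimately show ?case
    by (intro exI[of _ "[:[:lf a x, lf a y:], [:lf a e:]:] * p"])
       (simp add: p(2,3) algebra_simps)
next
  case (hp_add d f g)
  then obtain p q where p: "Polynomial.degree p \<le> d" "Polynomial.coeff p d = [:f e:]"
    "\<And>s r. poly (poly p [:r:]) s = f (x + s *s y + r *s e)"
    "Polynomial.degree q \<le> d" "Polynomial.coeff q d = [:g e:]"
    "\<And>s r. poly (poly q [:r:]) s = g (x + s *s y + r *s e)" by blast
  then show ?case by (intro exI[of _ "p + q"]) (auto intro: degree_add_le)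
qed

text \<open>Cutting with a plane through the point turns the claim into one about a plane curve
  $f(s, r) = 0$ with $f$ monic in $r$: a power of $g$ is divisible by $f$ for almost all $s$, so the
  remainder of the division by $f$ vanishes identically, also at the excluded values of $s$.\<close>

lemma linear_condition_removable:
  assumes "hp D f" "D > 0" "hp d g" "lf l e = 0" "f e \<noteq> 0" "l \<noteq> 0"
    and "\<And>x. f x = 0 \<Longrightarrow> lf l x \<noteq> 0 \<Longrightarrow> g x = 0" and "f x = 0"
  shows "g x = 0"
proof -
  obtain y where y: "lf l y = 1" using lf_nonzero assms(6) by blast
  obtain pf :: "qbar poly poly" where pf: "Polynomial.degree pf \<le> D" "Polynomial.coeff pf D = [:f e:]"
    "\<And>s r. poly (poly pf [:r:]) s = f (x + s *s y + r *s e)"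
    using hp_bivariate[OF assms(1)] by blast
  obtain pg :: "qbar poly poly" where
    pg: "\<And>s r. poly (poly pg [:r:]) s = g (x + s *s y + r *s e)"
    using hp_bivariate[OF assms(3)] by blast
  have deg: "Polynomial.degree pf = D"
    using pf(1,2) assms(5) by (metis le_antisym le_degree pCons_eq_0_iff)
  have nz: "pf \<noteq> 0" using deg assms(2) by auto
  obtain q R where qR: "pseudo_divmod (pg ^ D) pf = (q, R)" by fastforce
  define n where "n = Suc (Polynomial.degree (pg ^ D)) - D"
  have div: "smult ([:f e:] ^ n) (pg ^ D) = pf * q + R"
    using pseudo_divmod(1)[OF nz qR] by (simp add: deg pf(2) n_def)
  have degR: "R = 0 \<or> Polynomial.degree R < D"
    using pseudo_divmod(2)[OF nz qR] deg by simp
  define ev where "ev = (\<lambda>s (p :: qbar poly poly). map_poly (\<lambda>c. poly c s) p)"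
  have ev: "poly (ev s p) r = poly (poly p [:r:]) s" for s p r
    unfolding ev_def by (induction p) (simp_all add: map_poly_pCons)
  have ev_deg: "Polynomial.degree (ev s p) \<le> Polynomial.degree p" for s p
    unfolding ev_def by (rule degree_le) (simp add: coeff_map_poly coeff_eq_0)
  have "R = 0"
  proof (rule poly_eqI)
    fix i
    \<comment> \<open>Since \<open>lf l (x + s *s y + r *s e) = lf l x + s\<close>, this is the only
      value of \<open>s\<close> at which nothing is assumed about \<open>g\<close>.\<close>
    have "poly (Polynomial.coeff R i) s = 0" if "s \<notin> {- lf l x}" for s
    proof -
      have s: "lf l x + s \<noteq> 0" using that by (metis add.commute add_eq_0_iff insertI1)
      have cf: "Polynomial.coeff (ev s pf) D = f e" by (simp add: ev_def coeff_map_poly pf(2))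
      have "Polynomial.degree (ev s pf) \<le> D"
        using ev_deg[of s pf] deg by simp
      then have dfs: "Polynomial.degree (ev s pf) = D" using cf assms(5) by (metis le_antisym le_degree)
      have fnz: "ev s pf \<noteq> 0" using dfs assms(2) by auto
      have "poly (ev s pg) r = 0" if "poly (ev s pf) r = 0" for r
        using that assms(7)[of "x + s *s y + r *s e"] s by (simp add: ev pf(3) pg y assms(4))
      then have 1: "ev s pf dvd ev s pg ^ D" using dvd_power_of_roots[OF fnz] dfs by metis
      have "poly (smult (f e ^ n) (ev s pg ^ D)) = poly (ev s pf * ev s q + ev s R)"
      proof
        fix r
        show "poly (smult (f e ^ n) (ev s pg ^ D)) r = poly (ev s pf * ev s q + ev s R) r"
          using arg_cong[OF div, of "\<lambda>p. poly (poly p [:r:]) s"] by (simp add: ev)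
      qed
      then have "smult (f e ^ n) (ev s pg ^ D) = ev s pf * ev s q + ev s R"
        by (simp only: poly_eq_poly_eq_iff)
      then have "ev s R = smult (f e ^ n) (ev s pg ^ D) - ev s pf * ev s q" by simp
      then have 2: "ev s pf dvd ev s R" using 1 by (simp add: dvd_diff dvd_smult)
      have "ev s R = 0"
      proof (rule ccontr)
        assume n0: "ev s R \<noteq> 0"
        then have "R \<noteq> 0" by (auto simp: ev_def)
        have "D \<le> Polynomial.degree (ev s R)" using dvd_imp_degree_le[OF 2 n0] dfs by simp
        also have "\<dots> \<le> Polynomial.degree R" by (rule ev_deg)
        finally show False using degR \<open>R \<noteq> 0\<close> by simp
      qed
      then have "Polynomial.coeff (ev s R) i = 0" by simp
      then show ?thesis by (simp add: ev_def coeff_map_poly)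
    qed
    then have "poly (Polynomial.coeff R i) s = 0" for s
      using polyfun_zero_except[OF polyfun_poly, of "{- lf l x}" "Polynomial.coeff R i" s] by blast
    then have "Polynomial.coeff R i = 0" using poly_all_0_iff_0 by blast
    then show "Polynomial.coeff R i = Polynomial.coeff 0 i" by simp
  qed
  \<comment> \<open>The parameters \<open>s = r = 0\<close> belong to the point \<open>x\<close>
    itself, where \<open>f\<close> vanishes.\<close>
  have "poly (poly (smult ([:f e:] ^ n) (pg ^ D)) [:0:]) 0 = poly (poly (pf * q) [:0:]) 0"
    using div \<open>R = 0\<close> by simp
  then have "f e ^ n * g x ^ D = 0" using pf(3)[of 0 0] pg[of 0 0] assms(8) by simp
  then show ?thesis using assms(5) by simp
qed

text \<open>Induction on the number of planes: multiplying \<open>g\<close> by \<open>lf l\<close>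
  trades the condition on \<open>l\<close> for a factor, which
  \<open>linear_condition_removable\<close> then cancels.\<close>

lemma nonsing_removable:
  assumes F: "hp 3 F" "nonsing F" and "finite Ls" "0 \<notin> Ls"
  shows "hp d g \<Longrightarrow> (\<And>x. F x = 0 \<Longrightarrow> (\<And>l. l \<in> Ls \<Longrightarrow> lf l x \<noteq> 0) \<Longrightarrow> g x = 0) \<Longrightarrow> F x = 0 \<Longrightarrow> g x = 0"
  using assms(3,4)
proof (induction Ls arbitrary: g d x rule: finite_induct)
  case empty then show ?case by blast
next
  case (insert l Ls)
  have l: "l \<noteq> 0" using insert.prems by auto
  obtain e where e: "lf l e = 0" "F e \<noteq> 0" using nonsing_plane[OF F l] by blast
  have *: "lf l x * g x = 0" if "F x = 0" for x
  proof (rule insert.IH[where g = "\<lambda>x. lf l x * g x"])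
    show "hp (Suc d) (\<lambda>x. lf l x * g x)" by (rule hp_lf_mult) (rule insert.prems)
    fix x assume x: "F x = 0" "\<And>l. l \<in> Ls \<Longrightarrow> lf l x \<noteq> 0"
    show "lf l x * g x = 0"
    proof (cases "lf l x = 0")
      case False
      then have "g x = 0" using x by (intro insert.prems(2)) auto
      then show ?thesis by simp
    qed simp
  qed (use that insert.prems in auto)
  show ?case
    by (rule linear_condition_removable[OF F(1) _ insert.prems(1) e l _ insert.prems(3)])
       (use * in auto)
qed

lemma mem_proj_space: "P \<in> proj_space \<longleftrightarrow> (\<exists>x. x \<noteq> 0 \<and> P = proj_point x)"
  unfolding rational_points_def by auto

lemma form_scale: "form d c (a *s x) = a ^ d * form d c x"
  by (rule hp_scale[OF hp_form])

lemma proj_point_in_zero_locus [simp]: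
  "x \<noteq> 0 \<Longrightarrow> proj_point x \<in> zero_locus d c \<longleftrightarrow> form d c x = 0"
  unfolding zero_locus_def using mem_proj_space by (auto simp: proj_point_def form_scale intro: exI[of _ 1])

section \<open>Integrality at a nonarchimedean absolute value\<close>

definition ultrametric :: "(qbar \<Rightarrow> real) \<Rightarrow> bool" where
  "ultrametric w \<longleftrightarrow> absolute_value UNIV w \<and> (\<forall>x y. w (x + y) \<le> max (w x) (w y))"

context
  fixes w :: "qbar \<Rightarrow> real"
  assumes w: "ultrametric w"
begin

lemma um_mult [simp]: "w (x * y) = w x * w y"
  and um_ge_0 [simp]: "0 \<le> w x"
  and um_eq_0 [simp]: "w x = 0 \<longleftrightarrow> x = 0"
  and um_add: "w (x + y) \<le> max (w x) (w y)"
  using w unfolding ultrametric_def absolute_value_def by auto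

lemma um_1 [simp]: "w 1 = 1"
  using um_mult[of 1 1] um_eq_0[of 1] by (simp del: um_mult um_eq_0)

lemma um_minus [simp]: "w (- x) = w x"
proof -
  have "w (-1) * w (-1) = 1" using um_mult[of "-1" "-1"] by (simp del: um_mult)
  then have "w (-1) = 1"
    using um_ge_0[of "-1"] by (metis abs_of_nonneg abs_square_eq_1 power2_eq_square)
  then show ?thesis using um_mult[of "-1" x] by (simp del: um_mult)
qed

lemma um_power [simp]: "w (x ^ n) = w x ^ n"
  by (induction n) auto

lemma um_inverse: "w (inverse x) = inverse (w x)"
proof (cases "x = 0")
  case False
  then have "w x * w (inverse x) = 1" using um_mult[of x "inverse x"] by (simp del: um_mult)
  then show ?thesis by (metis inverse_unique)
qed (metis um_eq_0 inverse_zero)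

lemma um_divide [simp]: "w (x / y) = w x / w y"
  by (simp add: divide_inverse um_inverse)

lemma um_add_le_1: "w x \<le> 1 \<Longrightarrow> w y \<le> 1 \<Longrightarrow> w (x + y) \<le> 1"
  using um_add[of x y] by simp

lemma um_diff_le_1: "w x \<le> 1 \<Longrightarrow> w y \<le> 1 \<Longrightarrow> w (x - y) \<le> 1"
  using um_add_le_1[of x "- y"] by simp

lemma um_mult_le_1: "w x \<le> 1 \<Longrightarrow> w y \<le> 1 \<Longrightarrow> w (x * y) \<le> 1"
  by (simp add: mult_le_one)

lemma um_add_lt_1: "w x < 1 \<Longrightarrow> w y < 1 \<Longrightarrow> w (x + y) < 1"
  using um_add[of x y] by simp

lemma um_diff_lt_1: "w x < 1 \<Longrightarrow> w y < 1 \<Longrightarrow> w (x - y) < 1"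
  using um_add_lt_1[of x "- y"] by simp

lemma um_mult_lt_1: "w x < 1 \<Longrightarrow> w y \<le> 1 \<Longrightarrow> w (x * y) < 1"
  by (simp add: mult_le_one) (metis mult_left_le um_ge_0 order_le_less_trans)

lemma um_mult_lt_1': "w x \<le> 1 \<Longrightarrow> w y < 1 \<Longrightarrow> w (x * y) < 1"
  using um_mult_lt_1[of y x] by (simp add: mult.commute)

lemma um_sum_le_1: "(\<And>i. i \<in> A \<Longrightarrow> w (f i) \<le> 1) \<Longrightarrow> w (sum f A) \<le> 1"
proof (induction A rule: infinite_finite_induct)
  case (insert x A) then show ?case by (auto intro: um_add_le_1)
qed (use um_eq_0[of 0] in \<open>simp_all del: um_eq_0\<close>)

lemma um_sum_lt_1: "(\<And>i. i \<in> A \<Longrightarrow> w (f i) < 1) \<Longrightarrow> w (sum f A) < 1"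
proof (induction A rule: infinite_finite_induct)
  case (insert x A) then show ?case by (auto intro: um_add_lt_1)
qed (use um_eq_0[of 0] in \<open>simp_all del: um_eq_0\<close>)

lemma um_lf_lt_1: "(\<And>i. w (a $ i) \<le> 1) \<Longrightarrow> (\<And>i. w (x $ i) < 1) \<Longrightarrow> w (lf a x) < 1"
  unfolding lf_def by (rule um_sum_lt_1) (rule um_mult_lt_1')

lemma residue_eqD: "residue w x = residue w y \<Longrightarrow> w (x - y) < 1"
proof -
  assume "residue w x = residue w y"
  moreover have "x \<in> residue w x" using um_eq_0[of 0] by (simp add: residue_def del: um_eq_0)
  ultimately show ?thesis by (simp add: residue_def)
qed

text \<open>If the reductions meet, the point is congruent to a point of \<open>D\<close>. The unit
  value of \<open>l\<close> at \<open>x\<close> certifies that some coordinate of \<open>x\<close>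
  is a unit, so that \<open>x\<close> is normalised.\<close>

lemma reduction_memD:
  assumes x: "\<And>i. w (x $ i) \<le> 1" and l: "\<And>i. w (l $ i) \<le> 1" "w (lf l x) = 1"
    and "reduction w (proj_point x) \<in> reduction w ` D" and D: "D \<subseteq> proj_space"
  obtains y where "y \<noteq> 0" "proj_point y \<in> D" "\<And>i. w (x $ i - y $ i) < 1"
proof -
  obtain Q where Q: "Q \<in> D" "reduction w (proj_point x) = reduction w Q" using assms(4) by blast
  have "\<exists>i. 1 \<le> w (x $ i)"
  proof (rule ccontr)
    assume "\<not> (\<exists>i. 1 \<le> w (x $ i))"
    then have "w (lf l x) < 1" by (intro um_lf_lt_1 l) (simp add: not_le)
    then show False using l by simp
  qed
  then obtain i where "w (x $ i) = 1" using x by (metis antisym)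
  then have "Max (range (\<lambda>i. w (x $ i))) = 1"
    by (intro Max_eqI) (auto intro: x range_eqI[of _ _ i])
  then have "(\<chi> i. residue w (x $ i)) \<in> reduction w (proj_point x)"
    unfolding reduction_def using mem_proj_point by blast
  then have "(\<chi> i. residue w (x $ i)) \<in> reduction w Q" unfolding Q(2) .
  then obtain y where y: "y \<in> Q" "(\<chi> i. residue w (x $ i)) = (\<chi> i. residue w (y $ i))"
    "Max (range (\<lambda>i. w (y $ i))) = 1"
    by (auto simp only: reduction_def mem_Collect_eq)
  have y0: "y \<noteq> 0" using y(3) um_eq_0[of 0] by (auto simp del: um_eq_0)
  obtain z where z: "z \<noteq> 0" "Q = proj_point z" using Q D mem_proj_space by blast
  then obtain c where c: "c \<noteq> 0" "y = c *s z" using y(1) by (auto simp: proj_point_def)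
  have "proj_point y \<in> D" using Q(1) c by (simp add: z proj_point_scale)
  moreover have "w (x $ i - y $ i) < 1" for i
    using y(2) by (intro residue_eqD) (simp add: vec_eq_iff)
  ultimately show ?thesis using that y0 by blast
qed

text \<open>The test by which lines are avoided: each equation of a line through \<open>y\<close>
  has a small value at every \<open>x\<close> congruent to \<open>y\<close>.\<close>

lemma lf_close:
  assumes "\<And>i. w (l $ i) \<le> 1" "\<And>i. w (x $ i - y $ i) < 1" "lf l y = 0"
  shows "w (lf l x) < 1"
proof -
  have "w (lf l (x - y)) < 1" by (rule um_lf_lt_1) (use assms in auto)
  then show ?thesis using assms(3) by simp
qed

end

text \<open>At this absolute value a unit is just a nonzero number and reduction loses nothing, so
  statements about all ultrametric absolute values specialise to nonvanishing and to
  \<open>P \<notin> D\<close>.\<close>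

lemma ultrametric_trivial: "ultrametric (\<lambda>x. if x = 0 then 0 else 1)"
  unfolding ultrametric_def absolute_value_def by auto

text \<open>The set \<open>E\<close> collects the finitely many constants at whose places integrality may fail.\<close>

definition dense_integral :: "point set \<Rightarrow> point set \<Rightarrow> bool" where
  "dense_integral Xt D \<longleftrightarrow> (\<exists>E A. finite E \<and> A \<subseteq> Xt \<and>
     (\<forall>K. subfield K qbar_ring \<longrightarrow> E \<subseteq> K \<longrightarrow> A \<subseteq> rational_points K) \<and>
     (\<forall>w. ultrametric w \<longrightarrow> (\<forall>a\<in>E. a \<noteq> 0 \<longrightarrow> w a = 1) \<longrightarrow> (\<forall>P\<in>A. reduction w P \<notin> reduction w ` D)) \<and>
     Xt \<subseteq> zariski_closure A)"

lemma dense_integral_mono: "dense_integral Xt D \<Longrightarrow> D' \<subseteq> D \<Longrightarrow> dense_integral Xt D'"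
  unfolding dense_integral_def by (elim ex_forward conj_forward all_forward imp_forward) auto

lemma zero_locus_subset_closureI:
  assumes "\<And>d G. (\<And>x. proj_point x \<in> A \<Longrightarrow> x \<noteq> 0 \<Longrightarrow> form d G x = 0) \<Longrightarrow>
      (\<And>x. form n F x = 0 \<Longrightarrow> form d G x = 0)"
  shows "zero_locus n F \<subseteq> zariski_closure A"
proof -
  have "P \<in> zero_locus d G" if "P \<in> zero_locus n F" and A: "A \<subseteq> zero_locus d G" for P d G
  proof -
    obtain x where x: "x \<noteq> 0" "P = proj_point x"
      using \<open>P \<in> zero_locus n F\<close> mem_proj_space by (auto simp: zero_locus_def)
    have "form n F x = 0" using \<open>P \<in> zero_locus n F\<close> x by simp
    moreover have "form d G z = 0" if "proj_point z \<in> A" "z \<noteq> 0" for z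
      using A that proj_point_in_zero_locus[of z d G] by blast
    ultimately have "form d G x = 0" using assms by blast
    then show ?thesis using x by simp
  qed
  then show ?thesis unfolding zariski_closure_def by blast
qed

section \<open>Nine lines\<close>

text \<open>By the product rule the last hypothesis says that the derivative of \<open>F\<close> at
  \<open>x\<close> vanishes in every direction \<open>y\<close>.\<close>

lemma nonsing_critical:
  assumes "nonsing F" "\<And>x. F x = lf l1 x * lf l2 x * lf l3 x - lf m1 x * lf m2 x * lf m3 x"
    and "F x = 0"
    and "\<And>y. lf l1 y * lf l2 x * lf l3 x + lf l1 x * lf l2 y * lf l3 x + lf l1 x * lf l2 x * lf l3 y
      - (lf m1 y * lf m2 x * lf m3 x + lf m1 x * lf m2 y * lf m3 x + lf m1 x * lf m2 x * lf m3 y) = 0"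
  shows "x = 0"
proof (rule ccontr)
  assume "x \<noteq> 0"
  then show False
  proof (rule nonsingD[OF assms(1) _ assms(3)])
    fix y
    \<comment> \<open>The terms of order two and three of the expansion along \<open>y\<close>,
      divided by \<open>s ^ 2\<close>.\<close>
    define P where "P = [:lf l1 y * lf l2 y * lf l3 x + lf l1 y * lf l2 x * lf l3 y + lf l1 x * lf l2 y * lf l3 y
        - (lf m1 y * lf m2 y * lf m3 x + lf m1 y * lf m2 x * lf m3 y + lf m1 x * lf m2 y * lf m3 y),
        lf l1 y * lf l2 y * lf l3 y - lf m1 y * lf m2 y * lf m3 y:]"
    have "F (x + s *s y) = F x + s * (lf l1 y * lf l2 x * lf l3 x + lf l1 x * lf l2 y * lf l3 x
        + lf l1 x * lf l2 x * lf l3 y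
        - (lf m1 y * lf m2 x * lf m3 x + lf m1 x * lf m2 y * lf m3 x + lf m1 x * lf m2 x * lf m3 y))
      + s ^ 2 * poly P s" for s
      unfolding assms(2) P_def by (simp add: algebra_simps power2_eq_square)
    then show "\<exists>p. \<forall>s. F (x + s *s y) = s ^ 2 * poly p s"
      unfolding assms(3,4) by (intro exI[of _ P]) simp
  qed
qed

text \<open>Where two factors of each product vanish, both products vanish to second order.\<close>

lemma nonsing_star:
  assumes "nonsing F" "\<And>x. F x = lf l1 x * lf l2 x * lf l3 x - lf m1 x * lf m2 x * lf m3 x"
    and "lf l1 x = 0" "lf l2 x = 0" "lf m1 x = 0" "lf m2 x = 0"
  shows "x = 0"
  by (rule nonsing_critical[OF assms(1,2)]) (simp_all add: assms(2-))

section \<open>Closure properties of subfields, and a supply of units\<close>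

lemma subfield_closed:
  assumes K: "subfield K (qbar_ring)"
  shows "0 \<in> K" "1 \<in> K" "\<And>x y. x \<in> K \<Longrightarrow> y \<in> K \<Longrightarrow> x + y \<in> K"
    "\<And>x y. x \<in> K \<Longrightarrow> y \<in> K \<Longrightarrow> x * y \<in> K" "\<And>x. x \<in> K \<Longrightarrow> - x \<in> K"
    "\<And>x y. x \<in> K \<Longrightarrow> y \<in> K \<Longrightarrow> x - y \<in> K" "\<And>x. x \<in> K \<Longrightarrow> inverse x \<in> K"
    "\<And>x y. x \<in> K \<Longrightarrow> y \<in> K \<Longrightarrow> x / y \<in> K" "\<And>n. of_nat n \<in> K" "\<And>n. numeral n \<in> K"
    "\<And>x n. x \<in> K \<Longrightarrow> x ^ n \<in> K"
proof -
  interpret field qbar_ring by (rule field_from_type_algebra)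
  have sr: "subring K qbar_ring" using K by (rule subfieldE)
  note c = subringE[OF sr]
  show 0: "0 \<in> K" using c(2) by (simp add: ring_of_type_algebra_def)
  show 1: "1 \<in> K" using c(3) by (simp add: ring_of_type_algebra_def)
  show a: "\<And>x y. x \<in> K \<Longrightarrow> y \<in> K \<Longrightarrow> x + y \<in> K" using c(7) by (simp add: ring_of_type_algebra_def)
  show m: "\<And>x y. x \<in> K \<Longrightarrow> y \<in> K \<Longrightarrow> x * y \<in> K" using c(6) by (simp add: ring_of_type_algebra_def)
  show u: "- x \<in> K" if "x \<in> K" for x
  proof -
    have "x + (\<ominus>\<^bsub>qbar_ring\<^esub> x) = 0" using r_neg[of x] by (simp add: ring_of_type_algebra_def)
    then have "\<ominus>\<^bsub>qbar_ring\<^esub> x = - x" by (simp add: add_eq_0_iff)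
    then show ?thesis using c(5)[OF that] by simp
  qed
  show d: "x - y \<in> K" if "x \<in> K" "y \<in> K" for x y
    using a[OF that(1) u[OF that(2)]] by simp
  show i: "inverse x \<in> K" if "x \<in> K" for x
  proof (cases "x = 0")
    case False
    then have "x \<in> K - {\<zero>\<^bsub>qbar_ring\<^esub>}" using that by (simp add: ring_of_type_algebra_def)
    note h = subfield_m_inv[OF K this]
    have "x * (inv\<^bsub>qbar_ring\<^esub> x) = 1" using h(2) by (simp add: ring_of_type_algebra_def)
    then have "inv\<^bsub>qbar_ring\<^esub> x = inverse x" using inverse_unique by metis
    then show ?thesis using h(1) by simp
  qed (use 0 in simp)
  show "x / y \<in> K" if "x \<in> K" "y \<in> K" for x y
    using m[OF that(1) i[OF that(2)]] by (simp add: divide_inverse)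
  show n: "of_nat n \<in> K" for n by (induction n) (auto intro: 0 1 a)
  show "numeral n \<in> K" for n using n[of "numeral n"] by simp
  show "x ^ n \<in> K" if "x \<in> K" for x n by (induction n) (auto intro: 1 m that)
qed

lemma power_of_2_inj: "inj (\<lambda>i. (2 :: qbar) ^ i)"
  by (rule injI) (metis of_nat_eq_iff of_nat_numeral of_nat_power power_inject_exp one_less_numeral_iff semiring_norm(76))

text \<open>A supply of pairs of units \<open>(u, 1 + (u - s) h)\<close> with \<open>h\<close> integral, based on the divisibility
  of \<open>v ^ j - 1\<close> by \<open>v - 1\<close>.\<close>

lemma unit_pairs:
  fixes s :: qbar
  obtains T where
    "\<And>u h K. (u, h) \<in> T \<Longrightarrow> subfield K qbar_ring \<Longrightarrow> s \<in> K \<Longrightarrow> u \<in> K \<and> h \<in> K"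
    "\<And>u h w. (u, h) \<in> T \<Longrightarrow> ultrametric w \<Longrightarrow> w 2 = 1 \<Longrightarrow> (s \<noteq> 0 \<Longrightarrow> w s = 1) \<Longrightarrow>
       w u = 1 \<and> w h \<le> 1 \<and> w (1 + (u - s) * h) = 1"
    "\<And>u h. (u, h) \<in> T \<Longrightarrow> u \<noteq> 0 \<and> u \<noteq> s"
    "\<And>B u t. (\<And>u. polyfun (B u)) \<Longrightarrow> (\<And>t. polyfun (\<lambda>u. B u t)) \<Longrightarrow>
       (\<And>u h. (u, h) \<in> T \<Longrightarrow> B u (1 + (u - s) * h) = 0) \<Longrightarrow> B u t = 0"
proof (cases "s = 0")
  case True
  \<comment> \<open>For \<open>s = 0\<close> the factor \<open>u - s\<close> is itself a unit, and
    \<open>h\<close> is solved from \<open>1 + u * h = 2 ^ j\<close>.\<close>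
  define T :: "(qbar \<times> qbar) set" where "T = {(2 ^ i, (2 ^ j - 1) / 2 ^ i) | i j :: nat. True}"
  show ?thesis
  proof (rule that[of T])
    show "u \<in> K \<and> h \<in> K" if "(u, h) \<in> T" "subfield K qbar_ring" for u h K
      using that(1) by (auto simp: T_def intro!: subfield_closed[OF that(2)])
    show "w u = 1 \<and> w h \<le> 1 \<and> w (1 + (u - s) * h) = 1"
      if h: "(u, h) \<in> T" "ultrametric w" "w 2 = 1" for u h w
    proof -
      obtain i j where ij: "u = 2 ^ i" "h = (2 ^ j - 1) / 2 ^ i" using h(1) by (auto simp: T_def)
      have p: "w (2 ^ n) = 1" for n by (simp add: um_power[OF h(2)] h(3))
      have "w (2 ^ j - 1) \<le> 1"
        by (rule um_diff_le_1[OF h(2)]) (simp_all add: p um_1[OF h(2)])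
      moreover have "1 + (u - s) * h = 2 ^ j" by (simp add: ij True)
      ultimately show ?thesis by (simp add: ij p um_divide[OF h(2)])
    qed
    show "u \<noteq> 0 \<and> u \<noteq> s" if "(u, h) \<in> T" for u h using that True by (auto simp: T_def)
    fix B and u t :: qbar
    assume B: "\<And>u. polyfun (B u)" "\<And>t. polyfun (\<lambda>u. B u t)"
      "\<And>u h. (u, h) \<in> T \<Longrightarrow> B u (1 + (u - s) * h) = 0"
    have inf: "infinite (range (\<lambda>i. (2 :: qbar) ^ i))"
      using power_of_2_inj by (simp add: finite_image_iff)
    have "B (2 ^ i) (2 ^ j) = 0" for i j
      using B(3)[of "2 ^ i" "(2 ^ j - 1) / 2 ^ i"] True by (auto simp: T_def)
    then have "B (2 ^ i) t = 0" for i t using polyfun_zero[OF B(1) inf] by blast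
    then show "B u t = 0" using polyfun_zero[OF B(2) inf] by blast
  qed
next
  case s: False
  \<comment> \<open>With \<open>v = 2 ^ Suc i\<close> and \<open>u = s * v\<close>, the geometric
    sum makes \<open>1 + (u - s) * h\<close> equal to \<open>v ^ j\<close>. The \<open>Suc\<close>
    keeps \<open>v\<close> different from 1, so that \<open>u\<close> differs from \<open>s\<close>
    and \<open>v\<close> has infinitely many powers.\<close>
  define T where "T = {(s * 2 ^ Suc i, (\<Sum>k<j. (2 ^ Suc i) ^ k) / s) | i j :: nat. True}"
  have tau: "1 + (s * 2 ^ i - s) * ((\<Sum>k<j. (2 ^ i) ^ k) / s) = (2 ^ i) ^ j" for i j
    using power_diff_1_eq[of "2 ^ i :: qbar" j] s by (simp add: field_simps)
  have ne: "(2 :: qbar) ^ Suc i \<noteq> 1" for i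
    using power_of_2_inj[THEN injD, of "Suc i" 0] by auto
  show ?thesis
  proof (rule that[of T])
    show "u \<in> K \<and> h \<in> K" if h: "(u, h) \<in> T" "subfield K qbar_ring" "s \<in> K" for u h K
    proof -
      have "(\<Sum>k<j. (2 ^ Suc i) ^ k) \<in> K" for i j
        by (induction j) (auto intro!: subfield_closed[OF h(2)] simp del: power_Suc)
      then show ?thesis using h by (auto simp: T_def simp del: power_Suc intro!: subfield_closed[OF h(2)])
    qed
    show "w u = 1 \<and> w h \<le> 1 \<and> w (1 + (u - s) * h) = 1"
      if h: "(u, h) \<in> T" "ultrametric w" "w 2 = 1" "s \<noteq> 0 \<Longrightarrow> w s = 1" for u h w
    proof -
      have "w (\<Sum>k<j. (2 ^ Suc i) ^ k) \<le> 1" for i j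
        by (rule um_sum_le_1[OF h(2)]) (simp add: um_power[OF h(2)] h(3) um_mult[OF h(2)])
      moreover have "w s = 1" using h(4) s by blast
      ultimately show ?thesis using h(1,3) tau
        by (auto simp: T_def um_mult[OF h(2)] um_divide[OF h(2)] um_power[OF h(2)] simp del: power_Suc)
    qed
    show "u \<noteq> 0 \<and> u \<noteq> s" if "(u, h) \<in> T" for u h
      using that s ne by (auto simp: T_def simp del: power_Suc)
    fix B and u t :: qbar
    assume B: "\<And>u. polyfun (B u)" "\<And>t. polyfun (\<lambda>u. B u t)"
      "\<And>u h. (u, h) \<in> T \<Longrightarrow> B u (1 + (u - s) * h) = 0"
    have inf: "infinite (range (\<lambda>j. ((2 :: qbar) ^ Suc i) ^ j))" for i
    proof -
      have "inj (\<lambda>j. ((2 :: qbar) ^ Suc i) ^ j)"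
      proof (rule injI)
        fix j k assume "((2 :: qbar) ^ Suc i) ^ j = (2 ^ Suc i) ^ k"
        then have "(2 :: qbar) ^ (Suc i * j) = 2 ^ (Suc i * k)" by (simp only: power_mult)
        then have "Suc i * j = Suc i * k" using power_of_2_inj[THEN injD] by blast
        then show "j = k" by (metis mult_cancel_left nat.simps(3))
      qed
      then show ?thesis by (simp add: finite_image_iff)
    qed
    have "B (s * 2 ^ Suc i) ((2 ^ Suc i) ^ j) = 0" for i j
      using B(3)[of "s * 2 ^ Suc i" "(\<Sum>k<j. (2 ^ Suc i) ^ k) / s"] unfolding tau
      by (auto simp: T_def simp del: power_Suc)
    then have 1: "B (s * 2 ^ Suc i) t = 0" for i t using polyfun_zero[OF B(1) inf[of i]] by blast
    have inf': "infinite (range (\<lambda>i. s * (2 :: qbar) ^ Suc i))"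
    proof -
      have "inj (\<lambda>i. s * (2 :: qbar) ^ Suc i)"
        using power_of_2_inj s by (auto intro!: injI dest: injD)
      then show ?thesis by (simp add: finite_image_iff del: power_Suc)
    qed
    show "B u t = 0" by (rule polyfun_zero[OF B(2) inf']) (use 1 in auto)
  qed
qed

text \<open>The ideal memberships behind \<open>delta_simple_root\<close>, with each abbreviation
  made a variable. Here \<open>(1, Y, Z, W)\<close> is the vertex of a degenerate conic,
  \<open>k\<close> is \<open>\<alpha> - s\<close>, and \<open>e\<close>, \<open>f\<close>,
  \<open>g\<close>, \<open>N\<close> are the coefficients of the pencil at
  \<open>\<alpha>\<close>.\<close>

lemma conic_identities:
  fixes a b c d e f g k p q r s N W Y Z \<alpha> :: "'a::field"
  shows "(2 * \<alpha> - s) * e + N * a + b * g + f * c = 0 \<Longrightarrow> e = - (N * Y * Z) \<Longrightarrow> N * Y = g \<Longrightarrow> N * Z = f \<Longrightarrow>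
      N * (a + b * Y + c * Z - (2 * \<alpha> - s) * Y * Z) = 0"
    and "e = k * a + d * p \<Longrightarrow> f = k * b + d * q \<Longrightarrow> g = k * c + d * r \<Longrightarrow> e = - (N * Y * Z) \<Longrightarrow>
      N * Y = g \<Longrightarrow> N * Z = f \<Longrightarrow> k * W = p + q * Y + r * Z \<Longrightarrow> N = \<alpha> * k \<Longrightarrow> k = \<alpha> - s \<Longrightarrow>
      k * (d * W + k * (Y * Z)) = - k * (a + b * Y + c * Z - (2 * \<alpha> - s) * Y * Z)"
    and "e = k * a + d * p \<Longrightarrow> f = k * b + d * q \<Longrightarrow> g = k * c + d * r \<Longrightarrow> e = - (N * Y * Z) \<Longrightarrow>
      N * Y = g \<Longrightarrow> N * Z = f \<Longrightarrow> k * W = p + q * Y + r * Z \<Longrightarrow> N = \<alpha> * k \<Longrightarrow>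
      k * (a * 1 + b * Y + c * Z + d * W) = k * (\<alpha> * (Y * Z))"
    and "f = k * b + d * q \<Longrightarrow> N * Z = f \<Longrightarrow> N = \<alpha> * k \<Longrightarrow>
      k * (W * b - Z * (\<alpha> * W) - q * (Y * Z)) = - q * (d * W + k * (Y * Z))"
    and "e = k * a + d * p \<Longrightarrow> e = - (N * Y * Z) \<Longrightarrow> N = \<alpha> * k \<Longrightarrow>
      k * (W * (\<alpha> * (Y * Z)) + W * a - p * (Y * Z)) = - p * (d * W + k * (Y * Z))"
  by Groebner_Basis.algebra+

section \<open>The equation l1 l2 l3 = m1 m2 m3 and its pencil of conics\<close>

locale trihedral =
  fixes F :: "qbar ^ 4 \<Rightarrow> qbar" and l1 l2 l3 m1 m2 m3 e1 e2 e3 e4 :: "qbar ^ 4"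
    and a b c d p q r s :: qbar
  assumes hpF: "hp 3 F" and ns: "nonsing F"
    and F: "\<And>x. F x = lf l1 x * lf l2 x * lf l3 x - lf m1 x * lf m2 x * lf m3 x"
    and dual [simp]:
    "lf l1 e1 = 1" "lf l1 e2 = 0" "lf l1 e3 = 0" "lf l1 e4 = 0"
    "lf m1 e1 = 0" "lf m1 e2 = 1" "lf m1 e3 = 0" "lf m1 e4 = 0"
    "lf m2 e1 = 0" "lf m2 e2 = 0" "lf m2 e3 = 1" "lf m2 e4 = 0"
    "lf l2 e1 = 0" "lf l2 e2 = 0" "lf l2 e3 = 0" "lf l2 e4 = 1"
    and basis: "\<And>x. x = lf l1 x *s e1 + lf m1 x *s e2 + lf m2 x *s e3 + lf l2 x *s e4"
    and l3: "\<And>x. lf l3 x = a * lf l1 x + b * lf m1 x + c * lf m2 x + d * lf l2 x"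
    and m3: "\<And>x. lf m3 x = p * lf l1 x + q * lf m1 x + r * lf m2 x + s * lf l2 x"
begin

definition pt :: "qbar \<Rightarrow> qbar \<Rightarrow> qbar \<Rightarrow> qbar \<Rightarrow> qbar ^ 4" where
  "pt x y z w = x *s e1 + y *s e2 + z *s e3 + w *s e4"

lemma lf_pt [simp]: "lf l1 (pt x y z w) = x" "lf m1 (pt x y z w) = y" "lf m2 (pt x y z w) = z"
  "lf l2 (pt x y z w) = w"
  by (simp_all add: pt_def)

lemma pt_nonzero [simp]: "pt x y z w = 0 \<longleftrightarrow> x = 0 \<and> y = 0 \<and> z = 0 \<and> w = 0"
proof
  assume "pt x y z w = 0"
  then show "x = 0 \<and> y = 0 \<and> z = 0 \<and> w = 0" using lf_pt[of x y z w] lf_zero by metis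
qed (simp add: pt_def)

lemma pt_lf: "x = pt (lf l1 x) (lf m1 x) (lf m2 x) (lf l2 x)"
  unfolding pt_def by (rule basis)

lemma pt_scale: "k *s pt x y z w = pt (k * x) (k * y) (k * z) (k * w)"
  unfolding pt_def by (simp add: vec_eq_iff algebra_simps)

text \<open>Eight of the nine ways to choose two of the \<open>l\<close> and two of the
  \<open>m\<close>. In the ninth the four forms are the coordinates \<open>X = l1\<close>,
  \<open>Y = m1\<close>, \<open>Z = m2\<close>, \<open>W = l2\<close>.\<close>

lemma star:
  "lf l1 x = 0 \<Longrightarrow> lf l2 x = 0 \<Longrightarrow> lf m1 x = 0 \<Longrightarrow> lf m3 x = 0 \<Longrightarrow> x = 0"
  "lf l1 x = 0 \<Longrightarrow> lf l2 x = 0 \<Longrightarrow> lf m2 x = 0 \<Longrightarrow> lf m3 x = 0 \<Longrightarrow> x = 0"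
  "lf l1 x = 0 \<Longrightarrow> lf l3 x = 0 \<Longrightarrow> lf m1 x = 0 \<Longrightarrow> lf m2 x = 0 \<Longrightarrow> x = 0"
  "lf l1 x = 0 \<Longrightarrow> lf l3 x = 0 \<Longrightarrow> lf m1 x = 0 \<Longrightarrow> lf m3 x = 0 \<Longrightarrow> x = 0"
  "lf l1 x = 0 \<Longrightarrow> lf l3 x = 0 \<Longrightarrow> lf m2 x = 0 \<Longrightarrow> lf m3 x = 0 \<Longrightarrow> x = 0"
  "lf l2 x = 0 \<Longrightarrow> lf l3 x = 0 \<Longrightarrow> lf m1 x = 0 \<Longrightarrow> lf m2 x = 0 \<Longrightarrow> x = 0"
  "lf l2 x = 0 \<Longrightarrow> lf l3 x = 0 \<Longrightarrow> lf m1 x = 0 \<Longrightarrow> lf m3 x = 0 \<Longrightarrow> x = 0"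
  "lf l2 x = 0 \<Longrightarrow> lf l3 x = 0 \<Longrightarrow> lf m2 x = 0 \<Longrightarrow> lf m3 x = 0 \<Longrightarrow> x = 0"
  subgoal by (rule nonsing_star[OF ns, of l1 l2 l3 m1 m3 m2]) (simp_all add: F mult_ac)
  subgoal by (rule nonsing_star[OF ns, of l1 l2 l3 m2 m3 m1]) (simp_all add: F mult_ac)
  subgoal by (rule nonsing_star[OF ns, of l1 l3 l2 m1 m2 m3]) (simp_all add: F mult_ac)
  subgoal by (rule nonsing_star[OF ns, of l1 l3 l2 m1 m3 m2]) (simp_all add: F mult_ac)
  subgoal by (rule nonsing_star[OF ns, of l1 l3 l2 m2 m3 m1]) (simp_all add: F mult_ac)
  subgoal by (rule nonsing_star[OF ns, of l2 l3 l1 m1 m2 m3]) (simp_all add: F mult_ac)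
  subgoal by (rule nonsing_star[OF ns, of l2 l3 l1 m1 m3 m2]) (simp_all add: F mult_ac)
  subgoal by (rule nonsing_star[OF ns, of l2 l3 l1 m2 m3 m1]) (simp_all add: F mult_ac)
  done

text \<open>Each quantity is a coefficient or a minor of \<open>l3\<close> and \<open>m3\<close>. If
  it vanished, the explicit vector in its proof would be a nonzero common zero of the kind that
  \<open>star\<close> excludes.\<close>

lemma nz: "d \<noteq> 0" "a \<noteq> 0" "q \<noteq> 0" "r \<noteq> 0"
  "d * q - s * b \<noteq> 0" "d * r - s * c \<noteq> 0" "a * r - p * c \<noteq> 0" "a * q - p * b \<noteq> 0"
proof -
  show d: "d \<noteq> 0" using star(3)[of "pt 0 0 0 1"] by (auto simp: l3)
  show a: "a \<noteq> 0" using star(6)[of "pt 1 0 0 0"] by (auto simp: l3)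
  show "q \<noteq> 0" using star(2)[of "pt 0 1 0 0"] by (auto simp: m3)
  show "r \<noteq> 0" using star(1)[of "pt 0 0 1 0"] by (auto simp: m3)
  show "d * q - s * b \<noteq> 0" using star(5)[of "pt 0 d 0 (- b)"] d by (auto simp: l3 m3 algebra_simps)
  show "d * r - s * c \<noteq> 0" using star(4)[of "pt 0 0 d (- c)"] d by (auto simp: l3 m3 algebra_simps)
  show "a * r - p * c \<noteq> 0" using star(7)[of "pt c 0 (- a) 0"] a by (auto simp: l3 m3 algebra_simps)
  show "a * q - p * b \<noteq> 0" using star(8)[of "pt b (- a) 0 0"] a by (auto simp: l3 m3 algebra_simps)
qed

text \<open>The planes \<open>m3 = u l2\<close> cut out a pencil of conics
  \<open>(N Y - g X) (N Z - f X) = \<delta> X\<^sup>2\<close> in the coordinates \<open>X, Y, Z\<close>;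
  the roots of \<open>\<delta>\<close> are the parameters of the remaining degenerate conics.\<close>

definition "eu u = (u - s) * a + d * p"
definition "fu u = (u - s) * b + d * q"
definition "gu u = (u - s) * c + d * r"
definition "Nu u = u * (u - s)"
definition "delta u = Nu u * eu u + fu u * gu u"

lemmas u_defs = eu_def fu_def gu_def Nu_def delta_def

text \<open>At \<open>0\<close> and at \<open>s\<close> the factor \<open>Nu\<close> vanishes, and
  what is left of \<open>delta\<close> is a product of constants from \<open>nz\<close>.\<close>

lemma delta_root_ne: "delta \<alpha> = 0 \<Longrightarrow> \<alpha> \<noteq> 0 \<and> \<alpha> \<noteq> s"
proof -
  have "delta 0 = (d * q - s * b) * (d * r - s * c)" "delta s = (d * q) * (d * r)"
    by (simp_all add: u_defs algebra_simps)
  then show "delta \<alpha> = 0 \<Longrightarrow> \<alpha> \<noteq> 0 \<and> \<alpha> \<noteq> s" using nz by auto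
qed

text \<open>The expression is the derivative of \<open>delta\<close> at \<open>\<alpha>\<close>. The
  section by the plane \<open>m3 = \<alpha> l2\<close> is singular at the vertex of its degenerate
  conic, so there the gradient of \<open>F\<close> is a multiple of \<open>m3 - \<alpha> l2\<close>.
  A double root would make the multiple zero and the surface singular.\<close>

lemma delta_simple_root:
  assumes "delta \<alpha> = 0"
  shows "(2 * \<alpha> - s) * eu \<alpha> + Nu \<alpha> * a + b * gu \<alpha> + fu \<alpha> * c \<noteq> 0"
proof
  assume D: "(2 * \<alpha> - s) * eu \<alpha> + Nu \<alpha> * a + b * gu \<alpha> + fu \<alpha> * c = 0"
  define k where "k = \<alpha> - s"
  define N where "N = Nu \<alpha>"
  have k: "k \<noteq> 0" and N: "N \<noteq> 0" "N = \<alpha> * k"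
    using delta_root_ne[OF assms] by (auto simp: k_def N_def Nu_def)
  define e f g where "e = eu \<alpha>" "f = fu \<alpha>" "g = gu \<alpha>"
  note efg = e_f_g_def
  have e: "e = k * a + d * p" and f: "f = k * b + d * q" and g: "g = k * c + d * r"
    by (simp_all add: efg u_defs k_def)
  have del: "N * e + f * g = 0" using assms by (simp add: delta_def N_def efg)
  have D': "(2 * \<alpha> - s) * e + N * a + b * g + f * c = 0" using D by (simp add: efg N_def)
  define Y Z where "Y = g / N" "Z = f / N"
  have Y: "N * Y = g" and Z: "N * Z = f" using N by (simp_all add: Y_Z_def)
  define W where "W = (p + q * Y + r * Z) / k"
  have W: "k * W = p + q * Y + r * Z" using k by (simp add: W_def)
  have eYZ: "e = - (N * Y * Z)"
  proof -
    have "N * e = - (f * g)" using del by (simp add: eq_neg_iff_add_eq_0)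
    also have "\<dots> = N * (- (N * Y * Z))" unfolding Y[symmetric] Z[symmetric] by (simp add: algebra_simps)
    finally have "N * e = N * (- (N * Y * Z))" .
    then show ?thesis using N by (metis mult_cancel_left)
  qed
  \<comment> \<open>The derivative of \<open>F\<close> at the vertex in the direction
    \<open>e4\<close>; the other three partial derivatives turn out to be multiples of it.\<close>
  define \<Delta> where "\<Delta> = d * W + k * (Y * Z)"
  have "\<Delta> = 0"
  proof -
    have "N * (a + b * Y + c * Z - (2 * \<alpha> - s) * Y * Z) = 0"
      by (rule conic_identities(1)[OF D' eYZ Y Z])
    then have 1: "a + b * Y + c * Z - (2 * \<alpha> - s) * Y * Z = 0" using N by simp
    have "k * \<Delta> = - k * (a + b * Y + c * Z - (2 * \<alpha> - s) * Y * Z)"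
      unfolding \<Delta>_def by (rule conic_identities(2)[OF e f g eYZ Y Z W N(2) k_def])
    then have "k * \<Delta> = 0" using 1 by simp
    then show ?thesis using k by simp
  qed
  define x where "x = pt 1 Y Z W"
  have m3x: "lf m3 x = \<alpha> * W" using W by (simp add: m3 x_def k_def algebra_simps)
  have l3x: "lf l3 x = \<alpha> * (Y * Z)"
  proof -
    have "k * lf l3 x = k * (\<alpha> * (Y * Z))"
      unfolding l3 x_def lf_pt by (rule conic_identities(3)[OF e f g eYZ Y Z W N(2)])
    then show ?thesis using k by simp
  qed
  have c4: "lf l3 x + d * W - s * (Y * Z) = 0"
    using \<open>\<Delta> = 0\<close> unfolding l3x \<Delta>_def k_def by (simp add: algebra_simps)
  have c2: "W * b - Z * lf m3 x - q * (Y * Z) = 0"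
  proof -
    have "k * (W * b - Z * lf m3 x - q * (Y * Z)) = - q * \<Delta>"
      unfolding m3x \<Delta>_def by (rule conic_identities(4)[OF f Z N(2)])
    then show ?thesis using \<open>\<Delta> = 0\<close> k by simp
  qed
  have c3: "W * c - Y * lf m3 x - r * (Y * Z) = 0"
  proof -
    have "k * (W * c - Y * lf m3 x - r * (Z * Y)) = - r * (d * W + k * (Z * Y))"
      unfolding m3x by (rule conic_identities(4)[OF g Y N(2)])
    then have "k * (W * c - Y * lf m3 x - r * (Y * Z)) = - r * \<Delta>"
      by (simp add: \<Delta>_def mult.commute)
    then show ?thesis using \<open>\<Delta> = 0\<close> k by simp
  qed
  have c1: "W * lf l3 x + W * a - p * (Y * Z) = 0"
  proof -
    have "k * (W * lf l3 x + W * a - p * (Y * Z)) = - p * \<Delta>"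
      unfolding l3x \<Delta>_def by (rule conic_identities(5)[OF e eYZ N(2)])
    then show ?thesis using \<open>\<Delta> = 0\<close> k by simp
  qed
  have "x = 0"
  proof (rule nonsing_critical[OF ns F])
    show "F x = 0" unfolding F l3x m3x by (simp add: x_def)
    fix y
    have "lf l1 y * lf l2 x * lf l3 x + lf l1 x * lf l2 y * lf l3 x + lf l1 x * lf l2 x * lf l3 y
      - (lf m1 y * lf m2 x * lf m3 x + lf m1 x * lf m2 y * lf m3 x + lf m1 x * lf m2 x * lf m3 y)
      = lf l1 y * (W * lf l3 x + W * a - p * (Y * Z)) + lf m1 y * (W * b - Z * lf m3 x - q * (Y * Z))
      + lf m2 y * (W * c - Y * lf m3 x - r * (Y * Z)) + lf l2 y * (lf l3 x + d * W - s * (Y * Z))"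
      unfolding l3[of y] m3[of y] by (simp add: x_def algebra_simps)
    then show "lf l1 y * lf l2 x * lf l3 x + lf l1 x * lf l2 y * lf l3 x + lf l1 x * lf l2 x * lf l3 y
      - (lf m1 y * lf m2 x * lf m3 x + lf m1 x * lf m2 y * lf m3 x + lf m1 x * lf m2 x * lf m3 y) = 0"
      unfolding c1 c2 c3 c4 by simp
  qed
  then show False by (simp add: x_def)
qed

text \<open>As a polynomial in \<open>u\<close>, \<open>delta\<close> is a cubic with leading
  coefficient \<open>a\<close>, and by \<open>delta_simple_root\<close> its roots are
  simple.\<close>

lemma delta_roots:
  obtains \<alpha> \<beta> \<gamma> where "\<alpha> \<noteq> \<beta>" "\<alpha> \<noteq> \<gamma>" "\<beta> \<noteq> \<gamma>" "\<And>u. delta u = a * (u - \<alpha>) * (u - \<beta>) * (u - \<gamma>)"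
proof -
  define P where "P = [:0, - s, 1:] * [:d * p - s * a, a:] + [:d * q - s * b, b:] * [:d * r - s * c, c:]"
  have P: "poly P u = delta u" for u by (simp add: P_def u_defs algebra_simps)
  have dP: "poly (pderiv P) u = (2 * u - s) * eu u + Nu u * a + b * gu u + fu u * c" for u
    by (simp add: P_def u_defs pderiv_pCons pderiv_mult pderiv_add algebra_simps)
  have deg: "Polynomial.degree P = 3" "Polynomial.lead_coeff P = a"
    using nz(2) by (simp_all add: P_def eval_nat_numeral)
  then have "P \<noteq> 0" by auto
  then obtain A where A: "size A = Polynomial.degree P" "P = smult (Polynomial.lead_coeff P) (\<Prod>x\<in>#A. [:- x, 1:])"
    using alg_closed_imp_factorization[of P] by blast
  obtain \<alpha> A1 where A1: "A = add_mset \<alpha> A1" "size A1 = 2"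
    using A(1) deg size_eq_Suc_imp_eq_union[of A 2] by auto
  obtain \<beta> A2 where A2: "A1 = add_mset \<beta> A2" "size A2 = 1"
    using A1(2) size_eq_Suc_imp_eq_union[of A1 1] by auto
  obtain \<gamma> where A3: "A2 = {#\<gamma>#}" using A2(2) size_1_singleton_mset by blast
  have Pf: "P = smult a ([:- \<alpha>, 1:] * ([:- \<beta>, 1:] * [:- \<gamma>, 1:]))"
    using A(2) deg(2) by (simp only: A1(1) A2(1) A3 image_mset_add_mset prod_mset.add_mset) simp
  have f: "delta u = a * (u - \<alpha>) * (u - \<beta>) * (u - \<gamma>)" for u
    unfolding P[symmetric] Pf by (simp add: algebra_simps)
  have d': "poly (pderiv P) u = a * ((u - \<beta>) * (u - \<gamma>) + (u - \<alpha>) * (u - \<gamma>) + (u - \<alpha>) * (u - \<beta>))" for u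
    unfolding Pf by (simp add: pderiv_smult pderiv_mult pderiv_pCons algebra_simps)
  have "poly (pderiv P) u \<noteq> 0" if "delta u = 0" for u
    unfolding dP by (rule delta_simple_root[OF that])
  then have "\<alpha> \<noteq> \<beta>" "\<alpha> \<noteq> \<gamma>" "\<beta> \<noteq> \<gamma>" using d'[of \<alpha>] d'[of \<beta>] f[of \<alpha>] f[of \<beta>] by auto
  then show ?thesis using that f by blast
qed

end

section \<open>Points on the conics with unit parameters\<close>

lemma conic_param_identities:
  fixes a b c d e f g h k p q r s t u W Y Z :: "'a::field"
  assumes "e = k * a + d * p" "f = k * b + d * q" "g = k * c + d * r"
    "u * Y = c - d * r * h" "t = - d * r * (1 + k * h)" "t * Z = e + f * Y"
    "t * W = r * (a + b * Y - d * h * (p + q * Y))"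
  shows "t * (k * W) = t * (p + q * Y + r * Z)"
    and "t * (a * 1 + b * Y + c * Z + d * W) = t * (u * (Y * Z))"
    and "(u * k) * Y - g = t"
  using assms by Groebner_Basis.algebra+

lemma conic_param_inverse_identities:
  fixes a b c d e f g h k p q r s t u W Y Z :: "'a::field"
  assumes "e = k * a + d * p" "f = k * b + d * q" "g = k * c + d * r"
    "k * W = p + q * Y + r * Z" "a * 1 + b * Y + c * Z + d * W = u * (Y * Z)"
  shows "(u * k * Y - g) * (u * k * Z - f) = (u * k) * e + f * g"
    and "u * k * Y - g = - d * r * (1 + k * h) \<Longrightarrow> k * (u * Y) = k * (c - d * r * h)"
    and "(u * k * Y - g) * Z = e + f * Y"
  using assms by Groebner_Basis.algebra+

text \<open>Every term on the right is a multiple of \<open>S\<close> or of \<open>W\<close>. So a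
  point that nearly satisfies the line equation \<open>S = 0\<close> and has a small
  \<open>W\<close> also has a small \<open>(u - \<alpha>) Y Z\<close>.\<close>

lemma degenerate_conic_identity:
  fixes a b c d e f g k p q r s u W Y Z S \<alpha> \<kappa> n :: "'a::field"
  assumes "e = \<kappa> * a + d * p" "f = \<kappa> * b + d * q" "g = \<kappa> * c + d * r" "n = \<alpha> * \<kappa>" "n * e + f * g = 0"
    "k * W = p + q * Y + r * Z" "a * 1 + b * Y + c * Z + d * W = u * (Y * Z)" "S = n * Y - g"
  shows "(n * \<kappa>) * ((u - \<alpha>) * (Y * Z)) = f * S - n * Z * S - n * d * (k * W) + n * \<kappa> * d * W"
  using assms by Groebner_Basis.algebra

lemma degenerate_conic_line_identity:
  fixes a b c d e f g p q r s x y z w \<alpha> \<kappa> n :: "'a::field"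
  assumes "e = \<kappa> * a + d * p" "f = \<kappa> * b + d * q" "g = \<kappa> * c + d * r" "n = \<alpha> * \<kappa>" "n * e + f * g = 0"
    "\<kappa> * w = p * x + q * y + r * z" "n * y = g * x"
  shows "n * \<kappa> * (x * (a * x + b * y + c * z + d * w) - \<alpha> * (y * z)) = 0"
  using assms by Groebner_Basis.algebra

context trihedral
begin

text \<open>For \<open>X = 1\<close> the conic is \<open>(N Y - g) (N Z - f) = \<delta>\<close>, so
  the value \<open>t\<close> of \<open>N Y - g\<close> is a parameter. The choice
  \<open>t = - d r (1 + (u - s) h)\<close> is congruent to \<open>- g\<close> modulo
  \<open>u - s\<close>. This cancels the factor \<open>u - s\<close> of \<open>N\<close> in
  \<open>Y\<close>, and the same factor cancels in \<open>W\<close>, where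
  \<open>(u - s) W = p + q Y + r Z\<close>. The only denominators left are \<open>u\<close> and
  \<open>t\<close>, which are units.\<close>

definition "Yc u h = (c - d * r * h) / u"
definition "tc u h = - d * r * (1 + (u - s) * h)"
definition "Zc u h = (eu u + fu u * Yc u h) / tc u h"
definition "Wc u h = r * (a + b * Yc u h - d * h * (p + q * Yc u h)) / tc u h"
definition "Pc u h = pt 1 (Yc u h) (Zc u h) (Wc u h)"

lemma Pc_props:
  assumes "u \<noteq> 0" "tc u h \<noteq> 0"
  shows "(u - s) * Wc u h = p + q * Yc u h + r * Zc u h"
    and "a * 1 + b * Yc u h + c * Zc u h + d * Wc u h = u * (Yc u h * Zc u h)"
    and "Nu u * Yc u h - gu u = tc u h"
    and "lf m3 (Pc u h) = u * Wc u h" and "lf l3 (Pc u h) = u * (Yc u h * Zc u h)"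
    and "F (Pc u h) = 0"
proof -
  have *: "u * Yc u h = c - d * r * h" "tc u h * Zc u h = eu u + fu u * Yc u h"
    "tc u h * Wc u h = r * (a + b * Yc u h - d * h * (p + q * Yc u h))"
    using assms by (simp_all add: Yc_def Zc_def Wc_def)
  note ids = conic_param_identities[OF eu_def fu_def gu_def *(1) tc_def *(2,3)]
  show 1: "(u - s) * Wc u h = p + q * Yc u h + r * Zc u h" using ids(1) assms(2) by simp
  show 2: "a * 1 + b * Yc u h + c * Zc u h + d * Wc u h = u * (Yc u h * Zc u h)" using ids(2) assms(2) by simp
  show "Nu u * Yc u h - gu u = tc u h" using ids(3) by (simp add: Nu_def)
  show m: "lf m3 (Pc u h) = u * Wc u h" using 1 by (simp add: Pc_def m3 algebra_simps)
  show l: "lf l3 (Pc u h) = u * (Yc u h * Zc u h)" using 2 by (simp add: Pc_def l3)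
  show "F (Pc u h) = 0" unfolding F m l by (simp add: Pc_def)
qed

lemma Pc_nonzero [simp]: "Pc u h \<noteq> 0"
  by (simp add: Pc_def)

text \<open>Dividing by \<open>l1\<close> makes \<open>X = 1\<close>; since \<open>delta u\<close>
  is nonzero so is \<open>t = N Y - g\<close>, and \<open>h\<close> is solved from \<open>t\<close>
  because \<open>u\<close> differs from \<open>s\<close>.\<close>

lemma Pc_surj:
  assumes "F x = 0" "lf l1 x \<noteq> 0" "lf l2 x \<noteq> 0" "u = lf m3 x / lf l2 x" "u \<noteq> 0" "u \<noteq> s" "delta u \<noteq> 0"
  obtains h where "x = lf l1 x *s Pc u h" "tc u h \<noteq> 0"
proof -
  define j where "j = 1 / lf l1 x"
  define y where "y = j *s x"
  have j: "j \<noteq> 0" "j * lf l1 x = 1" using assms(2) by (simp_all add: j_def)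
  define Y Z W where "Y = lf m1 y" "Z = lf m2 y" "W = lf l2 y"
  note YZW = Y_Z_W_def
  have X: "lf l1 y = 1" using j by (simp add: y_def)
  have "W \<noteq> 0" using assms(3) j by (simp add: YZW y_def)
  have m3y: "lf m3 y = u * W" using assms(3,4) by (simp add: YZW y_def)
  have kW: "(u - s) * W = p + q * Y + r * Z"
    using m3y unfolding m3 X by (simp add: YZW algebra_simps)
  have "F y = 0" using hp_scale[OF hpF, of j x] assms(1) by (simp add: y_def)
  then have "W * lf l3 y = W * (u * (Y * Z))" unfolding F X m3y by (simp add: YZW mult_ac)
  then have "lf l3 y = u * (Y * Z)" using \<open>W \<noteq> 0\<close> by simp
  then have l3y: "a * 1 + b * Y + c * Z + d * W = u * (Y * Z)" unfolding l3 X by (simp add: YZW)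
  note ids = conic_param_inverse_identities[OF eu_def fu_def gu_def kW l3y]
  define t where "t = u * (u - s) * Y - gu u"
  have t0: "t \<noteq> 0" using ids(1) assms(7) by (auto simp: t_def delta_def Nu_def)
  define h where "h = (t / (- d * r) - 1) / (u - s)"
  have tc: "tc u h = t" using assms(6) nz(1,4) by (simp add: tc_def h_def)
  have "(u - s) * (u * Y) = (u - s) * (c - d * r * h)"
    by (rule ids(2)) (use tc in \<open>simp only: tc_def t_def\<close>)
  then have "u * Y = c - d * r * h" using assms(6) by simp
  then have Y: "Yc u h = Y" using assms(5) by (simp add: Yc_def field_simps)
  have "t * Z = eu u + fu u * Y" using ids(3) by (simp only: t_def)
  then have Z: "Zc u h = Z" using t0 by (simp add: Zc_def tc Y field_simps)
  have "(u - s) * Wc u h = (u - s) * W"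
    using Pc_props(1)[of u h] assms(5) t0 tc kW by (simp add: Y Z)
  then have W: "Wc u h = W" using assms(6) by simp
  have "y = Pc u h" unfolding Pc_def Y Z W by (subst pt_lf) (simp add: X YZW)
  then have "lf l1 x *s Pc u h = x" using j by (metis y_def vector_smult_assoc mult.commute vector_smult_lid)
  then show ?thesis using that tc t0 by metis
qed

text \<open>Multiplying by \<open>u (u - s)^2 t\<close> and writing
  \<open>h = (\<tau> - 1) / (u - s)\<close> makes all coordinates polynomials in \<open>u\<close>
  and \<open>\<tau>\<close>, the two quantities that run through units.\<close>

lemma Pc_scaled:
  assumes "u \<noteq> 0" "u \<noteq> s" "tc u h \<noteq> 0" "\<tau> = 1 + (u - s) * h"
    and "y = c * (u - s) - d * r * (\<tau> - 1)" "t = - d * r * \<tau>"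
  shows "pt (u * (u - s)^2 * t) ((u - s) * t * y) ((u - s) * (eu u * u * (u - s) + fu u * y))
      (r * ((a * u * (u - s) + b * y) * (u - s) - d * (\<tau> - 1) * (p * u * (u - s) + q * y)))
    = (u * (u - s)^2 * t) *s Pc u h"
proof -
  define k where "k = u - s"
  have t: "t = tc u h" using assms(4,6) by (simp add: tc_def)
  have y: "y = u * k * Yc u h" using assms(1) by (simp add: assms(4,5) Yc_def k_def algebra_simps)
  have Z: "t * Zc u h = eu u + fu u * Yc u h" using assms(3) by (simp add: Zc_def t)
  have W: "t * Wc u h = r * (a + b * Yc u h - d * h * (p + q * Yc u h))" using assms(3) by (simp add: Wc_def t)
  have "u * k^2 * t * Zc u h = k * (eu u * u * k + fu u * y)"
    using arg_cong[OF Z, of "\<lambda>x. u * k^2 * x"] unfolding y by (simp add: algebra_simps power2_eq_square)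
  moreover have "u * k^2 * t * Wc u h = r * ((a * u * k + b * y) * k - d * (\<tau> - 1) * (p * u * k + q * y))"
    using arg_cong[OF W, of "\<lambda>x. u * k^2 * x"] unfolding y assms(4) k_def[symmetric]
    by (simp add: algebra_simps power2_eq_square)
  moreover have "u * k^2 * t * Yc u h = k * t * y" unfolding y by (simp add: algebra_simps power2_eq_square)
  ultimately show ?thesis unfolding Pc_def pt_scale k_def[symmetric] by (simp only: mult_1_right)
qed

lemma Pc_dense:
  assumes T: "\<And>u h. (u, h) \<in> T \<Longrightarrow> u \<noteq> 0 \<and> u \<noteq> s \<and> tc u h \<noteq> 0"
    and dense: "\<And>B u t. (\<And>u. polyfun (B u)) \<Longrightarrow> (\<And>t. polyfun (\<lambda>u. B u t)) \<Longrightarrow>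
       (\<And>u h. (u, h) \<in> T \<Longrightarrow> B u (1 + (u - s) * h) = 0) \<Longrightarrow> B u t = 0"
    and G: "hp n G" "\<And>u h. (u, h) \<in> T \<Longrightarrow> G (Pc u h) = 0"
    and "F x = 0"
  shows "G x = 0"
proof -
  define V where "V = (\<lambda>u \<tau>. pt (u * (u - s)^2 * (- d * r * \<tau>)) ((u - s) * (- d * r * \<tau>) * (c * (u - s) - d * r * (\<tau> - 1)))
      ((u - s) * (eu u * u * (u - s) + fu u * (c * (u - s) - d * r * (\<tau> - 1))))
      (r * ((a * u * (u - s) + b * (c * (u - s) - d * r * (\<tau> - 1))) * (u - s)
        - d * (\<tau> - 1) * (p * u * (u - s) + q * (c * (u - s) - d * r * (\<tau> - 1))))))"
  have V: "V u (1 + (u - s) * h) = (u * (u - s)^2 * tc u h) *s Pc u h" if "u \<noteq> 0" "u \<noteq> s" "tc u h \<noteq> 0" for u h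
    unfolding V_def using Pc_scaled[OF that refl refl refl] by (simp add: tc_def)
  have V0: "G (V u \<tau>) = 0" for u \<tau>
  proof (rule dense[where B = "\<lambda>u \<tau>. G (V u \<tau>)"])
    show "polyfun (\<lambda>\<tau>. G (V u \<tau>))" for u
      by (rule hp_polyfun[OF G(1)]) (simp add: V_def pt_def)
    show "polyfun (\<lambda>u. G (V u \<tau>))" for \<tau>
      by (rule hp_polyfun[OF G(1)]) (simp add: V_def pt_def eu_def fu_def)
    show "G (V u (1 + (u - s) * h)) = 0" if "(u, h) \<in> T" for u h
      using T[OF that] G(2)[OF that] by (simp add: V hp_scale[OF G(1)])
  qed
  obtain \<alpha> \<beta> \<gamma> where \<delta>: "\<And>u. delta u = a * (u - \<alpha>) * (u - \<beta>) * (u - \<gamma>)"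
    using delta_roots by metis
  \<comment> \<open>Off these planes \<open>Pc_surj\<close> applies: \<open>l1\<close> and
    \<open>l2\<close> are nonzero, and \<open>u = m3 / l2\<close> differs from \<open>0\<close>,
    from \<open>s\<close> and from the roots of \<open>delta\<close>.\<close>
  show ?thesis
  proof (rule nonsing_removable[OF hpF ns _ _ G(1) _ \<open>F x = 0\<close>,
      of "{l1, l2, m3, m3 - s *s l2, m3 - \<alpha> *s l2, m3 - \<beta> *s l2, m3 - \<gamma> *s l2}"])
    have "lf (m3 - k *s l2) e2 \<noteq> 0" for k using nz by (simp add: m3)
    then have "m3 - k *s l2 \<noteq> 0" for k by (metis lf_zero_left)
    from this[of 0] this show "0 \<notin> {l1, l2, m3, m3 - s *s l2, m3 - \<alpha> *s l2, m3 - \<beta> *s l2, m3 - \<gamma> *s l2}"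
      using dual(1,16) by (auto simp del: dual)
    fix x assume x: "F x = 0"
      "\<And>l. l \<in> {l1, l2, m3, m3 - s *s l2, m3 - \<alpha> *s l2, m3 - \<beta> *s l2, m3 - \<gamma> *s l2} \<Longrightarrow> lf l x \<noteq> 0"
    define u where "u = lf m3 x / lf l2 x"
    have n: "lf l1 x \<noteq> 0" "lf l2 x \<noteq> 0" "lf m3 x \<noteq> 0" using x(2) by auto
    have ne: "u \<noteq> k" if "m3 - k *s l2 \<in> {l1, l2, m3, m3 - s *s l2, m3 - \<alpha> *s l2, m3 - \<beta> *s l2, m3 - \<gamma> *s l2}" for k
      using x(2)[OF that] n by (auto simp: u_def field_simps)
    have u: "u \<noteq> 0" "u \<noteq> s" "delta u \<noteq> 0" using n nz ne by (auto simp: u_def \<delta>)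
    then obtain h where h: "x = lf l1 x *s Pc u h" "tc u h \<noteq> 0"
      using Pc_surj[OF x(1) n(1,2) u_def] by blast
    have "G (Pc u h) = 0"
      using V0[of u "1 + (u - s) * h"] u h(2) by (simp add: V hp_scale[OF G(1)])
    then show "G x = 0" by (subst h(1)) (simp add: hp_scale[OF G(1)])
  qed simp
qed

end

section \<open>Avoiding the nine lines modulo a place\<close>

context trihedral
begin

text \<open>The \<open>2\<close> makes the parameters from \<open>unit_pairs\<close> units. The two
  minors are the units that keep \<open>W\<close> and \<open>Y Z\<close> from being small
  together.\<close>

definition coeffs_set :: "qbar set" where
  "coeffs_set = {2, a, b, c, d, p, q, r, s, a * r - p * c, a * q - p * b} \<union>
    (\<Union>v\<in>{l1, l2, l3, m1, m2, m3, e1, e2, e3, e4}. range (\<lambda>i. v $ i))"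

lemma finite_coeffs_set: "finite coeffs_set"
  unfolding coeffs_set_def by auto

text \<open>For a root \<open>\<alpha>\<close> of \<open>delta\<close> the conic in the plane
  \<open>m3 = \<alpha> l2\<close> splits into the lines \<open>N Y = g X\<close> and
  \<open>N Z = f X\<close>; this is the first of them.\<close>

definition nline :: "qbar \<Rightarrow> point set" where
  "nline \<alpha> = pline (m3 - \<alpha> *s l2) (Nu \<alpha> *s m1 - gu \<alpha> *s l1)"

context
  fixes w :: "qbar \<Rightarrow> real" and u h :: qbar
  assumes um: "ultrametric w" and wE: "\<And>x. x \<in> coeffs_set \<Longrightarrow> x \<noteq> 0 \<Longrightarrow> w x = 1"
    and wu: "w u = 1" "w h \<le> 1" "w (1 + (u - s) * h) = 1"
begin

lemma wE_le: "x \<in> coeffs_set \<Longrightarrow> w x \<le> 1"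
  using wE um_eq_0[OF um, of 0] by (cases "x = 0") auto

lemma w_consts: "w a \<le> 1" "w b \<le> 1" "w c \<le> 1" "w d \<le> 1" "w p \<le> 1" "w q \<le> 1" "w r \<le> 1" "w s \<le> 1" "w u \<le> 1"
  using wE_le wu by (auto simp: coeffs_set_def)

lemmas w_int = w_consts wu(2) um_add_le_1[OF um] um_diff_le_1[OF um] um_mult_le_1[OF um]
lemmas w_small = um_add_lt_1[OF um] um_diff_lt_1[OF um] um_mult_lt_1[OF um] um_mult_lt_1'[OF um]

lemma w_units: "w d = 1" "w r = 1" "w (a * r - p * c) = 1" "w (a * q - p * b) = 1"
  using nz by (auto intro!: wE simp: coeffs_set_def)

lemma w_tc: "w (tc u h) = 1"
  by (simp only: tc_def um_mult[OF um] um_minus[OF um] w_units wu mult_1_right)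

lemma u_tc: "u \<noteq> 0" "tc u h \<noteq> 0"
  using w_tc wu(1) um_eq_0[OF um, of 0] by (auto simp del: um_eq_0)

lemma w_YZW: "w (Yc u h) \<le> 1" "w (Zc u h) \<le> 1" "w (Wc u h) \<le> 1"
proof -
  have "w (c - d * r * h) \<le> 1" by (intro w_int)
  then show Y: "w (Yc u h) \<le> 1" unfolding Yc_def by (simp add: um_divide[OF um] wu)
  have "w (eu u + fu u * Yc u h) \<le> 1" unfolding eu_def fu_def by (intro w_int Y)
  then show "w (Zc u h) \<le> 1" unfolding Zc_def by (simp add: um_divide[OF um] w_tc)
  have "w (r * (a + b * Yc u h - d * h * (p + q * Yc u h))) \<le> 1" by (intro w_int Y)
  then show "w (Wc u h) \<le> 1" unfolding Wc_def by (simp add: um_divide[OF um] w_tc del: um_mult)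
qed

text \<open>If \<open>W\<close> and \<open>Y\<close> were small, the two equations of the conic
  would reduce to \<open>p + r Z = 0\<close> and \<open>a + c Z = 0\<close>, and the minor
  \<open>a r - p c\<close> would be small. The case of a small \<open>Z\<close> leads to the other
  minor.\<close>

lemma w_YZ_not_small: "w (Wc u h) < 1 \<Longrightarrow> \<not> w (Yc u h * Zc u h) < 1"
proof
  assume W: "w (Wc u h) < 1" and YZ: "w (Yc u h * Zc u h) < 1"
  note e = Pc_props(1,2)[OF u_tc]
  have "w (Yc u h) < 1 \<or> w (Zc u h) < 1"
    using YZ w_YZW by (metis antisym_conv2 mult_1 um_mult[OF um] less_irrefl)
  then show False
  proof
    assume Y: "w (Yc u h) < 1"
    have "a * r - p * c = r * (u * (Yc u h * Zc u h) - b * Yc u h - d * Wc u h) - c * ((u - s) * Wc u h - q * Yc u h)"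
      unfolding e(1) e(2)[symmetric] by (simp add: algebra_simps)
    also have "w \<dots> < 1"
      by (intro w_small(2) w_small(4) w_consts YZ Y W w_int(12))
    finally show False using w_units by simp
  next
    assume Z: "w (Zc u h) < 1"
    have "a * q - p * b = q * (u * (Yc u h * Zc u h) - c * Zc u h - d * Wc u h) - b * ((u - s) * Wc u h - r * Zc u h)"
      unfolding e(1) e(2)[symmetric] by (simp add: algebra_simps)
    also have "w \<dots> < 1"
      by (intro w_small(2) w_small(4) w_consts YZ Z W w_int(12))
    finally show False using w_units by simp
  qed
qed

text \<open>If \<open>u\<close> is close to \<open>\<alpha>\<close>, then the unit \<open>t\<close>
  is close to the second equation of the line, which is small. Otherwise \<open>W\<close> is small,
  and \<open>degenerate_conic_identity\<close> makes \<open>Y Z\<close> small too.\<close>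

lemma w_nline:
  assumes \<alpha>: "delta \<alpha> = 0" "w \<alpha> = 1" "w (\<alpha> - s) = 1"
    and 1: "w (u * Wc u h - \<alpha> * Wc u h) < 1" and 2: "w (Nu \<alpha> * Yc u h - gu \<alpha>) < 1"
  shows False
proof -
  note e = Pc_props(1,2)[OF u_tc]
  have \<alpha>1: "w \<alpha> \<le> 1" using \<alpha> by simp
  have i: "w (Nu \<alpha>) \<le> 1" "w (fu \<alpha>) \<le> 1" unfolding Nu_def fu_def by (intro w_int \<alpha>1)+
  have A: False if U: "w (u - \<alpha>) < 1"
  proof -
    have "tc u h = (Nu \<alpha> * Yc u h - gu \<alpha>) + (u - \<alpha>) * ((u + \<alpha> - s) * Yc u h - c)"
      unfolding Pc_props(3)[OF u_tc, symmetric] Nu_def gu_def by (simp add: algebra_simps)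
    also have "w \<dots> < 1" by (intro w_small(1)[OF 2] w_small(3)[OF U] w_int \<alpha>1 w_YZW)
    finally show False using w_tc by simp
  qed
  have or: "w x < 1 \<or> w y < 1" if "w (x * y) < 1" for x y
  proof (rule ccontr)
    assume "\<not> (w x < 1 \<or> w y < 1)"
    then have "1 * 1 \<le> w x * w y" by (intro mult_mono) auto
    then show False using that by (simp add: um_mult[OF um])
  qed
  have "w ((u - \<alpha>) * Wc u h) < 1" using 1 by (simp add: left_diff_distrib del: um_mult)
  then have W: "w (Wc u h) < 1" using or A by blast
  define S where "S = Nu \<alpha> * Yc u h - gu \<alpha>"
  have S: "w S < 1" using 2 by (simp add: S_def)
  have id: "(Nu \<alpha> * (\<alpha> - s)) * ((u - \<alpha>) * (Yc u h * Zc u h)) =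
    fu \<alpha> * S - Nu \<alpha> * Zc u h * S - Nu \<alpha> * d * ((u - s) * Wc u h) + Nu \<alpha> * (\<alpha> - s) * d * Wc u h"
    by (rule degenerate_conic_identity[OF eu_def fu_def gu_def Nu_def _ e S_def]) (use \<alpha> in \<open>simp add: delta_def\<close>)
  have "w (fu \<alpha> * S - Nu \<alpha> * Zc u h * S - Nu \<alpha> * d * ((u - s) * Wc u h) + Nu \<alpha> * (\<alpha> - s) * d * Wc u h) < 1"
    by (intro w_small(1,2) w_small(4) S W) (intro w_int i w_YZW \<alpha>1)+
  then have "w ((Nu \<alpha> * (\<alpha> - s)) * ((u - \<alpha>) * (Yc u h * Zc u h))) < 1" unfolding id .
  moreover have "w (Nu \<alpha> * (\<alpha> - s)) = 1" using \<alpha> by (simp add: Nu_def um_mult[OF um])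
  ultimately have "w ((u - \<alpha>) * (Yc u h * Zc u h)) < 1" by (subst (asm) um_mult[OF um]) simp
  then show False using or A w_YZ_not_small[OF W] by blast
qed

text \<open>The coordinate \<open>l1\<close> of the point is 1, which disposes of the three lines in
  \<open>l1 = 0\<close>. Every other line either forces both \<open>W\<close> and \<open>Y Z\<close>
  to be small or is an \<open>nline\<close>.\<close>

lemma Pc_avoids:
  assumes \<alpha>: "\<And>\<alpha>. \<alpha> \<in> roots \<Longrightarrow> delta \<alpha> = 0 \<and> w \<alpha> = 1 \<and> w (\<alpha> - s) = 1"
    and D: "D = pline l1 m1 \<union> pline l1 m2 \<union> pline l1 m3 \<union> pline l2 m1 \<union> pline l2 m2 \<union> pline l3 m3 \<union> (\<Union>\<alpha>\<in>roots. nline \<alpha>)"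
  shows "reduction w (proj_point (Pc u h)) \<notin> reduction w ` D"
proof
  assume red: "reduction w (proj_point (Pc u h)) \<in> reduction w ` D"
  have vec: "w (v $ i) \<le> 1" if "v \<in> {l1, l2, l3, m1, m2, m3, e1, e2, e3, e4}" for v i
    using that by (intro wE_le) (auto simp: coeffs_set_def)
  have l1x: "lf l1 (Pc u h) = 1" by (simp add: Pc_def)
  have int: "w (Pc u h $ i) \<le> 1" for i
    unfolding Pc_def pt_def by (simp add: um_add_le_1[OF um] um_mult_le_1[OF um] vec w_YZW del: um_mult)
  have Dp: "D \<subseteq> proj_space"
    unfolding D nline_def pline_def using mem_proj_space by auto
  have w1: "w (lf l1 (Pc u h)) = 1" by (simp add: l1x um_1[OF um])
  obtain y where y: "y \<noteq> 0" "proj_point y \<in> D" "\<And>i. w (Pc u h $ i - y $ i) < 1"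
    using reduction_memD[OF um int vec w1 red Dp] by blast
  have close: "w (lf l (Pc u h)) < 1" if "\<And>i. w (l $ i) \<le> 1" "lf l y = 0" for l
    by (rule lf_close[OF um that(1) y(3) that(2)])
  have l1y: "lf l1 y \<noteq> 0" using close[OF vec, of l1] w1 by auto
  have lf: "lf m1 (Pc u h) = Yc u h" "lf m2 (Pc u h) = Zc u h" "lf l2 (Pc u h) = Wc u h"
    by (simp_all add: Pc_def)
  have YZ: "w (Yc u h * Zc u h) < 1" if "w (Yc u h) < 1 \<or> w (Zc u h) < 1"
    using that w_small(3,4) w_YZW by blast
  consider "lf l2 y = 0" "lf m1 y = 0 \<or> lf m2 y = 0" | "lf l3 y = 0" "lf m3 y = 0"
    | \<alpha> where "\<alpha> \<in> roots" "lf (m3 - \<alpha> *s l2) y = 0" "lf (Nu \<alpha> *s m1 - gu \<alpha> *s l1) y = 0"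
    using y(1,2) l1y unfolding D nline_def by auto
  then show False
  proof cases
    case 1
    then have "w (Wc u h) < 1" using close[of l2, OF vec] lf by simp
    moreover have "w (Yc u h * Zc u h) < 1"
      using 1(2) close[of m1, OF vec] close[of m2, OF vec] lf YZ by auto
    ultimately show False using w_YZ_not_small by blast
  next
    case 2
    have "w (u * Wc u h) < 1" "w (u * (Yc u h * Zc u h)) < 1"
      using close[of l3, OF vec] close[of m3, OF vec] 2 Pc_props(4,5)[OF u_tc] by simp_all
    then show False using w_YZ_not_small wu(1) by (simp add: um_mult[OF um])
  next
    case (3 \<alpha>)
    note \<alpha> = \<alpha>[OF 3(1)]
    have \<alpha>1: "w \<alpha> \<le> 1" using \<alpha> by simp
    have i: "w (Nu \<alpha>) \<le> 1" "w (gu \<alpha>) \<le> 1" unfolding Nu_def gu_def by (intro w_int \<alpha>1)+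
    have "w (lf (m3 - \<alpha> *s l2) (Pc u h)) < 1"
      by (rule close[OF _ 3(2)]) (simp add: um_diff_le_1[OF um] um_mult_le_1[OF um] vec \<alpha>1 del: um_mult)
    then have 1: "w (u * Wc u h - \<alpha> * Wc u h) < 1" by (simp add: Pc_props(4)[OF u_tc] lf)
    have "w (lf (Nu \<alpha> *s m1 - gu \<alpha> *s l1) (Pc u h)) < 1"
      by (rule close[OF _ 3(3)]) (simp add: um_diff_le_1[OF um] um_mult_le_1[OF um] vec i del: um_mult)
    then have 2: "w (Nu \<alpha> * Yc u h - gu \<alpha>) < 1" by (simp add: lf l1x)
    show False by (rule w_nline[OF _ _ _ 1 2]) (use \<alpha> in auto)
  qed
qed

end

section \<open>The nine lines and the dense set of points\<close>

lemma indep_lines: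
  "indep l1 m1" "indep l1 m2" "indep l1 m3" "indep l2 m1" "indep l2 m2" "indep l3 m3"
  "\<alpha> \<noteq> 0 \<Longrightarrow> \<alpha> \<noteq> s \<Longrightarrow> indep (m3 - \<alpha> *s l2) (Nu \<alpha> *s m1 - gu \<alpha> *s l1)"
proof -
  show "indep l1 m1" "indep l1 m2" "indep l2 m1" "indep l2 m2" unfolding indep_def using dual by blast+
  show "indep l1 m3" unfolding indep_def
    by (rule exI[of _ "e1 - (p / q) *s e2"], rule exI[of _ "(1 / q) *s e2"]) (use nz in \<open>simp add: m3\<close>)
  define k where "k = d * q - s * b"
  have k: "k \<noteq> 0" using nz by (simp add: k_def)
  have "lf l3 ((q / k) *s e4 - (s / k) *s e2) = (d * q - s * b) / k"
    "lf m3 ((q / k) *s e4 - (s / k) *s e2) = 0"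
    "lf l3 ((d / k) *s e2 - (b / k) *s e4) = 0"
    "lf m3 ((d / k) *s e2 - (b / k) *s e4) = (d * q - s * b) / k"
    by (simp_all add: l3 m3 algebra_simps diff_divide_distrib)
  then show "indep l3 m3" using k unfolding indep_def k_def[symmetric] by (metis divide_self)
  assume \<alpha>: "\<alpha> \<noteq> 0" "\<alpha> \<noteq> s"
  show "indep (m3 - \<alpha> *s l2) (Nu \<alpha> *s m1 - gu \<alpha> *s l1)" unfolding indep_def
    by (rule exI[of _ "(1 / r) *s e3"], rule exI[of _ "(1 / Nu \<alpha>) *s (e2 - (q / r) *s e3)"])
       (use nz \<alpha> in \<open>simp add: m3 Nu_def\<close>)
qed

text \<open>In the plane \<open>m3 = \<alpha> l2\<close> the cubic is \<open>l2\<close> times the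
  conic \<open>l1 l3 - \<alpha> m1 m2\<close>, which vanishes on the line.\<close>

lemma F_nline:
  assumes "delta \<alpha> = 0" "lf (m3 - \<alpha> *s l2) y = 0" "lf (Nu \<alpha> *s m1 - gu \<alpha> *s l1) y = 0"
  shows "F y = 0"
proof -
  have n: "Nu \<alpha> * (\<alpha> - s) \<noteq> 0" using delta_root_ne[OF assms(1)] by (simp add: Nu_def)
  have m3y: "lf m3 y = \<alpha> * lf l2 y" using assms(2) by simp
  have 1: "(\<alpha> - s) * lf l2 y = p * lf l1 y + q * lf m1 y + r * lf m2 y"
    using m3y unfolding m3 by (simp add: algebra_simps)
  have 2: "Nu \<alpha> * lf m1 y = gu \<alpha> * lf l1 y" using assms(3) by simp
  have 0: "Nu \<alpha> * eu \<alpha> + fu \<alpha> * gu \<alpha> = 0" using assms(1) by (simp add: delta_def)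
  have "Nu \<alpha> * (\<alpha> - s) * (lf l1 y * lf l3 y - \<alpha> * (lf m1 y * lf m2 y)) = 0"
    unfolding l3 by (rule degenerate_conic_line_identity[OF eu_def fu_def gu_def Nu_def 0 1 2])
  then have "lf l1 y * lf l3 y - \<alpha> * (lf m1 y * lf m2 y) = 0" using n by simp
  then have "lf l2 y * (lf l1 y * lf l3 y) = lf l2 y * (\<alpha> * (lf m1 y * lf m2 y))" by simp
  then show ?thesis unfolding F m3y by (simp add: mult_ac)
qed

lemma distinct_lines:
  assumes roots: "delta \<alpha> = 0" "delta \<beta> = 0" "delta \<gamma> = 0" and ne: "\<alpha> \<noteq> \<beta>" "\<alpha> \<noteq> \<gamma>" "\<beta> \<noteq> \<gamma>"
  shows "distinct [pline l1 m1, pline l1 m2, pline l1 m3, pline l2 m1, pline l2 m2, pline l3 m3,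
    nline \<alpha>, nline \<beta>, nline \<gamma>]"
proof -
  note r0 = roots[THEN delta_root_ne]
  define A1 A2 A3 B1 B2 C N1 N2 N3 where
    "A1 = pline l1 m1" "A2 = pline l1 m2" "A3 = pline l1 m3" "B1 = pline l2 m1" "B2 = pline l2 m2"
    "C = pline l3 m3" "N1 = nline \<alpha>" "N2 = nline \<beta>" "N3 = nline \<gamma>"
  note L = this
  have e: "e2 = pt 0 1 0 0" "e3 = pt 0 0 1 0" "e4 = pt 0 0 0 1" by (simp_all add: pt_def)
  \<comment> \<open>Test points that separate the lines: three coordinate points, \<open>Q\<close>
    on \<open>A3\<close>, \<open>R\<close> on \<open>C\<close> with \<open>m1 = 0\<close>, and
    \<open>S1\<close>, \<open>S2\<close> with \<open>l1 = m1 = 0\<close> in the planes of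
    \<open>N1\<close> and \<open>N2\<close>.\<close>
  define P2 P3 P4 Q R S1 S2 where "P2 = proj_point (pt 0 1 0 0)" "P3 = proj_point (pt 0 0 1 0)"
    "P4 = proj_point (pt 0 0 0 1)" "Q = proj_point (pt 0 0 s (- r))"
    "R = proj_point (pt (c * s - d * r) 0 (d * p - a * s) (a * r - p * c))"
    "S1 = proj_point (pt 0 0 (\<alpha> - s) r)" "S2 = proj_point (pt 0 0 (\<beta> - s) r)"
  note P = this
  have x: "a * r - c * p \<noteq> 0" "d * r - c * s \<noteq> 0" using nz by (simp_all add: mult.commute)
  have "P3 \<in> A1" "P3 \<in> B1" "P3 \<notin> A2" "P3 \<notin> A3" "P3 \<notin> B2" "P3 \<notin> C" "P3 \<notin> N1" "P3 \<notin> N2" "P3 \<notin> N3"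
    "P2 \<in> A2" "P2 \<in> B2" "P2 \<notin> A3" "P2 \<notin> C" "P2 \<notin> N1" "P2 \<notin> N2" "P2 \<notin> N3"
    "P4 \<in> A1" "P4 \<in> A2" "P4 \<notin> B1" "P4 \<notin> B2"
    using nz by (simp_all add: L P nline_def l3 m3)
  moreover have "Q \<in> A3" "Q \<notin> C" "Q \<notin> N1" "Q \<notin> N2" "Q \<notin> N3"
    using nz r0 x by (simp_all add: L P nline_def l3 m3 mult.commute)
  moreover have "R \<in> C"
    using nz by (simp add: L P l3 m3 algebra_simps)
  moreover have "lf m3 (pt (c * s - d * r) 0 (d * p - a * s) (a * r - p * c)) = 0"
    by (simp add: m3 algebra_simps)
  then have "R \<notin> N1" "R \<notin> N2" "R \<notin> N3"
    using nz r0 x by (simp_all add: L P nline_def mult.commute)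
  moreover have m3s: "lf m3 (pt 0 0 (u - s) r) = u * r" for u by (simp add: m3 algebra_simps)
  have "S1 \<in> N1" "S1 \<notin> N2" "S1 \<notin> N3" "S2 \<in> N2" "S2 \<notin> N3"
    using nz r0 ne by (simp_all add: L P nline_def m3s)
  ultimately have "distinct [A1, A2, A3, B1, B2, C, N1, N2, N3]"
    by (simp only: distinct.simps list.set insert_iff empty_iff de_Morgan_disj) (intro conjI; blast)
  then show ?thesis unfolding L .
qed

text \<open>The first five lines are named because \<open>dense_integral_disjoint\<close> recognises
  the given five lines among them.\<close>

lemma dense_integral_nine_lines:
  assumes G: "F = form 3 G"
  obtains L where "\<And>i. i \<in> {1..9::nat} \<Longrightarrow> line_over UNIV (L i) \<and> L i \<subseteq> zero_locus 3 G" "inj_on L {1..9}"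
    "dense_integral (zero_locus 3 G) (\<Union>i\<in>{1..9}. L i)"
    "L 1 = pline l1 m1" "L 2 = pline l1 m2" "L 3 = pline l1 m3" "L 4 = pline l2 m1" "L 5 = pline l2 m2"
proof -
  obtain \<alpha> \<beta> \<gamma> where ne: "\<alpha> \<noteq> \<beta>" "\<alpha> \<noteq> \<gamma>" "\<beta> \<noteq> \<gamma>"
    and \<delta>: "\<And>u. delta u = a * (u - \<alpha>) * (u - \<beta>) * (u - \<gamma>)"
    using delta_roots by metis
  have roots: "delta \<alpha> = 0" "delta \<beta> = 0" "delta \<gamma> = 0" by (simp_all add: \<delta>)
  note r0 = roots[THEN delta_root_ne]
  define Ls where "Ls = [pline l1 m1, pline l1 m2, pline l1 m3, pline l2 m1, pline l2 m2, pline l3 m3,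
    nline \<alpha>, nline \<beta>, nline \<gamma>]"
  define L where "L = (\<lambda>i. Ls ! (i - 1))"
  have LU: "L ` {1..9} = set Ls"
  proof -
    have "L ` {1..9} = (\<lambda>i. Ls ! i) ` {..<length Ls}"
    proof -
      have "(\<lambda>i. i - 1) ` {1..9::nat} = {..<9}"
        by (force simp: image_iff intro: bexI[of _ "Suc _"])
      moreover have "length Ls = 9" by (simp add: Ls_def)
      moreover have "L ` {1..9} = (\<lambda>i. Ls ! i) ` (\<lambda>i. i - 1) ` {1..9}" by (simp add: L_def image_image)
      ultimately show ?thesis by simp
    qed
    then show ?thesis by (simp add: set_conv_nth image_def lessThan_def) blast
  qed
  define D where "D = pline l1 m1 \<union> pline l1 m2 \<union> pline l1 m3 \<union> pline l2 m1 \<union> pline l2 m2 \<union> pline l3 m3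
    \<union> (\<Union>x\<in>{\<alpha>, \<beta>, \<gamma>}. nline x)"
  have DU: "D = (\<Union>i\<in>{1..9}. L i)" unfolding LU D_def Ls_def by auto
  have "dense_integral (zero_locus 3 G) D"
  proof (rule unit_pairs[of s])
  fix T assume T:
    "\<And>u h K. (u, h) \<in> T \<Longrightarrow> subfield K qbar_ring \<Longrightarrow> s \<in> K \<Longrightarrow> u \<in> K \<and> h \<in> K"
    "\<And>u h w. (u, h) \<in> T \<Longrightarrow> ultrametric w \<Longrightarrow> w 2 = 1 \<Longrightarrow> (s \<noteq> 0 \<Longrightarrow> w s = 1) \<Longrightarrow>
       w u = 1 \<and> w h \<le> 1 \<and> w (1 + (u - s) * h) = 1"
    "\<And>u h. (u, h) \<in> T \<Longrightarrow> u \<noteq> 0 \<and> u \<noteq> s"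
    "\<And>B u t. (\<And>u. polyfun (B u)) \<Longrightarrow> (\<And>t. polyfun (\<lambda>u. B u t)) \<Longrightarrow>
       (\<And>u h. (u, h) \<in> T \<Longrightarrow> B u (1 + (u - s) * h) = 0) \<Longrightarrow> B u t = 0"
  \<comment> \<open>At the trivial absolute value the unit statement about \<open>T\<close> says
    that \<open>1 + (u - s) * h\<close> is nonzero.\<close>
  have Ttc: "u \<noteq> 0 \<and> u \<noteq> s \<and> tc u h \<noteq> 0" if "(u, h) \<in> T" for u h
    using T(2)[OF that ultrametric_trivial] T(3)[OF that] nz by (auto simp: tc_def split: if_splits)
  define A where "A = {proj_point (Pc u h) | u h. (u, h) \<in> T}"
  define E where "E = coeffs_set \<union> {\<alpha>, \<beta>, \<gamma>, \<alpha> - s, \<beta> - s, \<gamma> - s}"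
  show ?thesis
    unfolding dense_integral_def
  proof (intro exI[of _ E] exI[of _ A] conjI allI impI ballI)
    show "finite E" unfolding E_def using finite_coeffs_set by simp
    show "A \<subseteq> zero_locus 3 G"
      unfolding A_def using Ttc Pc_props(6) by (auto simp: G[symmetric])
    show "A \<subseteq> rational_points K" if K: "subfield K qbar_ring" "E \<subseteq> K" for K
    proof -
      have cK: "a \<in> K" "b \<in> K" "c \<in> K" "d \<in> K" "p \<in> K" "q \<in> K" "r \<in> K" "s \<in> K"
        "\<And>i. e1 $ i \<in> K" "\<And>i. e2 $ i \<in> K" "\<And>i. e3 $ i \<in> K" "\<And>i. e4 $ i \<in> K"
        using K(2) unfolding E_def coeffs_set_def by auto
      note cl = subfield_closed[OF K(1)]
      have "Pc u h $ i \<in> K" if "(u, h) \<in> T" for u h i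
      proof -
        have u: "u \<in> K" "h \<in> K" using T(1)[OF that K(1)] cK by auto
        have Y: "Yc u h \<in> K" unfolding Yc_def by (intro cl cK u)
        have t: "tc u h \<in> K" unfolding tc_def by (intro cl cK u)
        have Z: "Zc u h \<in> K" unfolding Zc_def eu_def fu_def by (intro cl cK u Y t)
        have W: "Wc u h \<in> K" unfolding Wc_def by (intro cl cK u Y t)
        show ?thesis unfolding Pc_def pt_def by (simp add: cl cK Y Z W)
      qed
      then show ?thesis unfolding A_def rational_points_def by (auto intro: Pc_nonzero)
    qed
    show "reduction w P \<notin> reduction w ` D" if w: "ultrametric w" "\<forall>x\<in>E. x \<noteq> 0 \<longrightarrow> w x = 1" and "P \<in> A" for w P
    proof -
      obtain u h where uh: "(u, h) \<in> T" "P = proj_point (Pc u h)" using \<open>P \<in> A\<close> unfolding A_def by blast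
      have wE: "w x = 1" if "x \<in> coeffs_set" "x \<noteq> 0" for x using w(2) that by (auto simp: E_def)
      have "w 2 = 1" "s \<noteq> 0 \<Longrightarrow> w s = 1" by (auto intro!: wE simp: coeffs_set_def)
      then have wu: "w u = 1" "w h \<le> 1" "w (1 + (u - s) * h) = 1" using T(2)[OF uh(1) w(1)] by auto
      show ?thesis unfolding uh(2)
        by (rule Pc_avoids[OF w(1) wE wu _ D_def]) (use roots r0 w(2) in \<open>auto simp: E_def\<close>)
    qed
    show "zero_locus 3 G \<subseteq> zariski_closure A"
    proof (rule zero_locus_subset_closureI)
      fix n G' x assume G': "\<And>x. proj_point x \<in> A \<Longrightarrow> x \<noteq> 0 \<Longrightarrow> form n G' x = 0" and x: "form 3 G x = 0"
      show "form n G' x = 0"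
      proof (rule Pc_dense[where T = T and G = "form n G'"])
        show "form n G' (Pc u h) = 0" if "(u, h) \<in> T" for u h
          using that by (intro G') (auto simp: A_def)
        show "F x = 0" using x by (simp add: G)
      qed (rule Ttc T(4) hp_form; assumption?)+
    qed
  qed
  qed
  then have dense: "dense_integral (zero_locus 3 G) (\<Union>i\<in>{1..9}. L i)" unfolding DU .
  have "line_over UNIV l \<and> l \<subseteq> zero_locus 3 G" if "l \<in> set Ls" for l
  proof
    show "line_over UNIV l"
      using that indep_lines r0 unfolding Ls_def nline_def by (auto intro!: pline_line_over)
    have "F y = 0" if "y \<noteq> 0" "proj_point y \<in> l" for y
      using that \<open>l \<in> set Ls\<close> F_nline[OF roots(1), of y] F_nline[OF roots(2), of y] F_nline[OF roots(3), of y]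
      unfolding Ls_def nline_def by (auto simp: F)
    moreover have "\<exists>y. y \<noteq> 0 \<and> P = proj_point y" if "P \<in> l" for P
      using that \<open>l \<in> set Ls\<close> unfolding Ls_def nline_def pline_def by auto
    ultimately show "l \<subseteq> zero_locus 3 G" unfolding G by (metis proj_point_in_zero_locus subsetI)
  qed
  then have line: "line_over UNIV (L i) \<and> L i \<subseteq> zero_locus 3 G" if "i \<in> {1..9}" for i
    using that LU by blast
  have "inj_on L {1..9}"
  proof (rule eq_card_imp_inj_on)
    show "card (L ` {1..9}) = card {1..9::nat}"
      unfolding LU using distinct_card[OF distinct_lines[OF roots ne]] by (simp add: Ls_def)
  qed simp
  then show ?thesis using that[OF line _ dense] by (simp add: L_def Ls_def)
qed

end

lemma nine_lines:
  assumes ns: "nonsing (form 3 G)"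
    and F: "\<And>x. form 3 G x = lf l1 x * lf l2 x * lf l3 x - lf m1 x * lf m2 x * lf m3 x"
  obtains L where "\<And>i. i \<in> {1..9::nat} \<Longrightarrow> line_over UNIV (L i) \<and> L i \<subseteq> zero_locus 3 G" "inj_on L {1..9}"
    "dense_integral (zero_locus 3 G) (\<Union>i\<in>{1..9}. L i)"
    "L 1 = pline l1 m1" "L 2 = pline l1 m2" "L 3 = pline l1 m3" "L 4 = pline l2 m1" "L 5 = pline l2 m2"
proof (rule dual_basis4[of l1 m1 m2 l2])
  show "x = 0" if "lf l1 x = 0" "lf m1 x = 0" "lf m2 x = 0" "lf l2 x = 0" for x
    by (rule nonsing_star[OF ns F that(1,4,2,3)])
  fix e1 e2 e3 e4
  assume e: "lf l1 e1 = 1" "lf l1 e2 = 0" "lf l1 e3 = 0" "lf l1 e4 = 0"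
    "lf m1 e1 = 0" "lf m1 e2 = 1" "lf m1 e3 = 0" "lf m1 e4 = 0"
    "lf m2 e1 = 0" "lf m2 e2 = 0" "lf m2 e3 = 1" "lf m2 e4 = 0"
    "lf l2 e1 = 0" "lf l2 e2 = 0" "lf l2 e3 = 0" "lf l2 e4 = 1"
    and b: "\<And>x. x = lf l1 x *s e1 + lf m1 x *s e2 + lf m2 x *s e3 + lf l2 x *s e4"
  have lin: "lf l x = lf l e1 * lf l1 x + lf l e2 * lf m1 x + lf l e3 * lf m2 x + lf l e4 * lf l2 x" for l x
    by (subst b[of x]) (simp add: mult.commute)
  interpret trihedral "form 3 G" l1 l2 l3 m1 m2 m3 e1 e2 e3 e4
    "lf l3 e1" "lf l3 e2" "lf l3 e3" "lf l3 e4" "lf m3 e1" "lf m3 e2" "lf m3 e3" "lf m3 e4"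
    by unfold_locales (rule hp_form ns F e b lin)+
  show ?thesis by (rule dense_integral_nine_lines[OF refl]) (rule that; assumption)
qed

section \<open>Five lines, three of them through a common transversal\<close>

lemma one_plus_power_of_2: "1 + 2 ^ k \<noteq> (0 :: qbar)"
proof -
  have "1 + 2 ^ k = (of_nat (1 + 2 ^ k) :: qbar)" by simp
  then show ?thesis by (simp only: of_nat_eq_0_iff add_is_0 one_neq_zero simp_thms)
qed

text \<open>A direction \<open>(z, w)\<close> is measured by the ratio \<open>s\<close> of
  \<open>\<epsilon> w + \<theta> z\<close> to \<open>\<epsilon> w + \<theta>' z\<close>, with the
  second form scaled to 1. On solutions of the Pell equation this ratio is a power of
  \<open>\<theta> / \<theta>'\<close>.\<close>

lemma homogeneous_zero:
  fixes B :: "qbar \<Rightarrow> qbar \<Rightarrow> qbar"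
  assumes hom: "\<And>k z w. B (k * z) (k * w) = k ^ n * B z w"
    and poly: "\<And>f g. polyfun f \<Longrightarrow> polyfun g \<Longrightarrow> polyfun (\<lambda>s. B (f s) (g s))"
    and ne: "\<theta> \<noteq> \<theta>'" "\<epsilon> \<noteq> 0" and inf: "infinite S"
    and S: "\<And>s. s \<in> S \<Longrightarrow> B ((s - 1) / (\<theta> - \<theta>')) ((1 - \<theta>' * ((s - 1) / (\<theta> - \<theta>'))) / \<epsilon>) = 0"
  shows "B z w = 0"
proof -
  have 0: "B ((s - 1) / (\<theta> - \<theta>')) ((1 - \<theta>' * ((s - 1) / (\<theta> - \<theta>'))) / \<epsilon>) = 0" for s
  proof (rule polyfun_zero[OF _ inf S])
    show "polyfun (\<lambda>s. B ((s - 1) / (\<theta> - \<theta>')) ((1 - \<theta>' * ((s - 1) / (\<theta> - \<theta>'))) / \<epsilon>))"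
      unfolding divide_inverse by (intro poly polyfun_mult polyfun_diff polyfun_id polyfun_const)
  qed assumption
  have 1: "B z w = 0" if "\<epsilon> * w + z * \<theta>' \<noteq> 0" for z w
  proof -
    define k where "k = \<epsilon> * w + z * \<theta>'"
    define s where "s = (\<epsilon> * w + z * \<theta>) / k"
    have k: "k \<noteq> 0" using that by (simp add: k_def)
    have "k * (s - 1) = z * (\<theta> - \<theta>')" using k by (simp add: s_def k_def field_simps)
    define A where "A = (s - 1) / (\<theta> - \<theta>')"
    have z: "k * A = z" using \<open>k * (s - 1) = _\<close> ne by (simp add: A_def field_simps)
    have "k * ((1 - \<theta>' * A) / \<epsilon>) = (k - \<theta>' * (k * A)) / \<epsilon>"
      by (simp add: right_diff_distrib mult.left_commute)
    also have "\<dots> = (k - \<theta>' * z) / \<epsilon>" by (simp only: z)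
    also have "\<dots> = w" using ne by (simp add: k_def)
    finally have w: "k * ((1 - \<theta>' * A) / \<epsilon>) = w" .
    show ?thesis using hom[of k A "(1 - \<theta>' * A) / \<epsilon>"] 0[of s] unfolding z w A_def[symmetric] by simp
  qed
  show ?thesis
  proof (cases "\<epsilon> * w + z * \<theta>' = 0")
    case True
    \<comment> \<open>The directions outside this chart: \<open>B\<close> is a polynomial function
      of its second argument, which can be moved off the excluded value.\<close>
    have "B z (w + 0) = 0"
    proof (rule polyfun_zero_except[of "\<lambda>x. B z (w + x)" "{0}"])
      show "polyfun (\<lambda>x. B z (w + x))" by (rule poly) auto
      fix x :: qbar assume "x \<notin> {0}"
      moreover have "\<epsilon> * (w + x) + z * \<theta>' = (\<epsilon> * w + z * \<theta>') + \<epsilon> * x" by (simp add: algebra_simps)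
      ultimately have "\<epsilon> * (w + x) + z * \<theta>' \<noteq> 0" using True ne by simp
      then show "B z (w + x) = 0" by (rule 1)
    qed simp
    then show ?thesis by simp
  qed (rule 1)
qed

text \<open>Coordinates \<open>(a, b)\<close> of the powers of a root of \<open>\<theta>\<^sup>2 - t \<theta> + n = 0\<close>, so
  \<open>\<theta> ^ i = a \<theta> + b\<close>: solutions of a Pell equation, up to powers of \<open>n\<close>.\<close>

fun pell :: "'a::comm_ring_1 \<Rightarrow> 'a \<Rightarrow> nat \<Rightarrow> 'a \<times> 'a" where
  "pell t n 0 = (0, 1)"
| "pell t n (Suc i) = (case pell t n i of (a, b) \<Rightarrow> (b + t * a, - (n * a)))"

text \<open>The left side is the norm of \<open>b + a \<theta>\<close>, which is
  multiplicative.\<close>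

lemma pell_norm:
  fixes t n :: "'a::comm_ring_1"
  shows "pell t n i = (a, b) \<Longrightarrow> b * b + t * a * b + n * a * a = n ^ i"
proof (induction i arbitrary: a b)
  case (Suc i)
  obtain a' b' where ab: "pell t n i = (a', b')" by fastforce
  then have "a = b' + t * a'" "b = - (n * a')" using Suc.prems by auto
  then have "b * b + t * a * b + n * a * a = n * (b' * b' + t * a' * b' + n * a' * a')"
    by (simp add: algebra_simps)
  then show ?case using Suc.IH[OF ab] by simp
qed auto

lemma pell_power:
  fixes \<theta> :: "'a::comm_ring_1"
  assumes "t = \<theta> + \<theta>'" "n = \<theta> * \<theta>'"
  shows "pell t n i = (a, b) \<Longrightarrow> b + a * \<theta> = \<theta> ^ i \<and> b + a * \<theta>' = \<theta>' ^ i"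
proof (induction i arbitrary: a b)
  case (Suc i)
  obtain a' b' where ab: "pell t n i = (a', b')" by fastforce
  then have "a = b' + t * a'" "b = - (n * a')" using Suc.prems by auto
  then have "b + a * \<theta> = \<theta> * (b' + a' * \<theta>)" "b + a * \<theta>' = \<theta>' * (b' + a' * \<theta>')"
    by (simp_all add: assms algebra_simps)
  then show ?case using Suc.IH[OF ab] by simp
qed auto

lemma pell_polyfun: "polyfun f \<Longrightarrow> polyfun g \<Longrightarrow>
   polyfun (\<lambda>s. fst (pell (f s) (g s) i)) \<and> polyfun (\<lambda>s. snd (pell (f s) (g s) i))"
  by (induction i) (auto simp: case_prod_beta)

lemma pell_subfield:
  assumes "subfield K qbar_ring" "t \<in> K" "n \<in> K"
  shows "fst (pell t n i) \<in> K \<and> snd (pell t n i) \<in> K"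
  by (induction i) (auto simp: case_prod_beta intro!: subfield_closed[OF assms(1)] assms)

lemma pell_integral:
  assumes "ultrametric w" "w t \<le> 1" "w n \<le> 1"
  shows "w (fst (pell t n i)) \<le> 1 \<and> w (snd (pell t n i)) \<le> 1"
proof (induction i)
  case 0 show ?case using um_1[OF assms(1)] um_eq_0[OF assms(1), of 0] by simp
next
  case (Suc i)
  then show ?case
    using um_add_le_1[OF assms(1)] um_mult_le_1[OF assms(1)] assms
    by (simp add: case_prod_beta um_minus[OF assms(1)] del: um_mult)
qed

text \<open>Integral directions \<open>(z, w)\<close> in which the quadratic form
  \<open>\<epsilon> w\<^sup>2 + (\<gamma> - u \<epsilon>') z w - u \<gamma>' z\<^sup>2\<close> takes a unit as its value.\<close>

lemma pell_directions:
  fixes \<gamma> \<epsilon> \<gamma>' \<epsilon>' :: qbar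
  assumes nz: "\<epsilon> \<noteq> 0" "\<gamma>' \<noteq> 0"
  obtains R where
    "\<And>u z w K. (u, z, w) \<in> R \<Longrightarrow> subfield K qbar_ring \<Longrightarrow> {\<gamma>, \<epsilon>, \<gamma>', \<epsilon>'} \<subseteq> K \<Longrightarrow> u \<in> K \<and> z \<in> K \<and> w \<in> K"
    "\<And>u z w v. (u, z, w) \<in> R \<Longrightarrow> ultrametric v \<Longrightarrow> (\<And>x. x \<in> {2, \<gamma>, \<epsilon>, \<gamma>', \<epsilon>'} \<Longrightarrow> x \<noteq> 0 \<Longrightarrow> v x = 1) \<Longrightarrow>
       v u = 1 \<and> v z \<le> 1 \<and> v w \<le> 1 \<and> v (\<epsilon> * w^2 + (\<gamma> - u * \<epsilon>') * z * w - u * \<gamma>' * z^2) = 1"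
    "\<And>B n u z w. (\<And>u k z w. B u (k * z) (k * w) = k ^ n * B u z w) \<Longrightarrow>
       (\<And>f g h. polyfun f \<Longrightarrow> polyfun g \<Longrightarrow> polyfun h \<Longrightarrow> polyfun (\<lambda>s. B (f s) (g s) (h s))) \<Longrightarrow>
       (\<And>u z w. (u, z, w) \<in> R \<Longrightarrow> B u z w = 0) \<Longrightarrow> B u z w = 0"
proof (cases "\<gamma> = 0 \<and> \<epsilon>' = 0")
  case True
  \<comment> \<open>With this \<open>u\<close> the form is
    \<open>(\<epsilon> w - 2^i z) (\<epsilon> w + 2^i z) / \<epsilon>\<close>, and \<open>z\<close>,
    \<open>w\<close> are solved from the factors being 1 and \<open>2^j\<close>. The case is
    separate because here the two roots are opposite for every \<open>u\<close>, so their ratio is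
    never one of the powers of two used below.\<close>
  define R :: "(qbar \<times> qbar \<times> qbar) set" where "R = {((2 ^ i)^2 / (\<epsilon> * \<gamma>'), (2 ^ j - 1) / (2 * 2 ^ i), (2 ^ j + 1) / (2 * \<epsilon>)) | i j :: nat. True}"
  show ?thesis
  proof (rule that[of R])
    show "u \<in> K \<and> z \<in> K \<and> w \<in> K" if h: "(u, z, w) \<in> R" "subfield K qbar_ring" "{\<gamma>, \<epsilon>, \<gamma>', \<epsilon>'} \<subseteq> K" for u z w K
    proof -
      obtain i j where "u = (2 ^ i)^2 / (\<epsilon> * \<gamma>')" "z = (2 ^ j - 1) / (2 * 2 ^ i)" "w = (2 ^ j + 1) / (2 * \<epsilon>)"
        using h(1) by (auto simp: R_def)
      then show ?thesis using h(3) by (auto intro!: subfield_closed[OF h(2)])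
    qed
    show "v u = 1 \<and> v z \<le> 1 \<and> v w \<le> 1 \<and> v (\<epsilon> * w^2 + (\<gamma> - u * \<epsilon>') * z * w - u * \<gamma>' * z^2) = 1"
      if h: "(u, z, w) \<in> R" and um: "ultrametric v" and E: "\<And>x. x \<in> {2, \<gamma>, \<epsilon>, \<gamma>', \<epsilon>'} \<Longrightarrow> x \<noteq> 0 \<Longrightarrow> v x = 1" for u z w v
    proof -
      obtain i j where ij: "u = (2 ^ i)^2 / (\<epsilon> * \<gamma>')" "z = (2 ^ j - 1) / (2 * 2 ^ i)" "w = (2 ^ j + 1) / (2 * \<epsilon>)"
        using h by (auto simp: R_def)
      have c: "v 2 = 1" "v \<epsilon> = 1" "v \<gamma>' = 1" using E nz by auto
      have p: "v (2 ^ k) = 1" for k by (simp add: um_power[OF um] c)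
      have "v (2 ^ j - 1) \<le> 1" "v (2 ^ j + 1) \<le> 1"
        using um_diff_le_1[OF um] um_add_le_1[OF um] p um_1[OF um] by simp_all
      moreover have "\<epsilon> * w^2 + (\<gamma> - u * \<epsilon>') * z * w - u * \<gamma>' * z^2 = 2 ^ j / \<epsilon>"
        using True nz by (simp add: ij power2_eq_square field_simps)
      ultimately show ?thesis
        by (simp add: ij um_divide[OF um] um_mult[OF um] um_power[OF um] c)
    qed
    fix B n and u z w :: qbar
    assume B: "\<And>u k z w. B u (k * z) (k * w) = k ^ n * B u z w"
       "\<And>f g h. polyfun f \<Longrightarrow> polyfun g \<Longrightarrow> polyfun h \<Longrightarrow> polyfun (\<lambda>s. B (f s) (g s) (h s))"
       "\<And>u z w. (u, z, w) \<in> R \<Longrightarrow> B u z w = 0"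
    have inf: "infinite (range (\<lambda>i. (2 :: qbar) ^ i))"
      using power_of_2_inj by (simp add: finite_image_iff)
    have 1: "B ((2 ^ i)^2 / (\<epsilon> * \<gamma>')) z w = 0" for i z w
    proof (rule homogeneous_zero[where B = "B ((2 ^ i)^2 / (\<epsilon> * \<gamma>'))" and n = n and \<theta> = "2 ^ i" and \<theta>' = "- (2 ^ i)" and \<epsilon> = \<epsilon>, OF B(1) _ _ nz(1) inf])
      show "polyfun (\<lambda>s. B ((2 ^ i)^2 / (\<epsilon> * \<gamma>')) (f s) (g s))" if "polyfun f" "polyfun g" for f g
        by (rule B(2)) (use that in auto)
      fix s :: qbar assume "s \<in> range (\<lambda>i. 2 ^ i)"
      then obtain j where s: "s = 2 ^ j" by blast
      have "(s - 1) / (2 ^ i - - (2 ^ i)) = (2 ^ j - 1) / (2 * 2 ^ i)" by (simp add: s)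
      moreover have "(1 - - (2 ^ i) * ((s - 1) / (2 ^ i - - (2 ^ i)))) / \<epsilon> = (2 ^ j + 1) / (2 * \<epsilon>)"
        using nz by (simp add: s field_simps)
      ultimately show "B ((2 ^ i)^2 / (\<epsilon> * \<gamma>')) ((s - 1) / (2 ^ i - - (2 ^ i)))
          ((1 - - (2 ^ i) * ((s - 1) / (2 ^ i - - (2 ^ i)))) / \<epsilon>) = 0"
        by (simp only:) (rule B(3), auto simp: R_def)
    qed simp
    have "inj (\<lambda>i. (2 ^ i :: qbar)^2 / (\<epsilon> * \<gamma>'))"
      using nz by (auto intro!: injI simp: power_mult[symmetric] inj_eq[OF power_of_2_inj])
    then have "infinite (range (\<lambda>i. (2 ^ i :: qbar)^2 / (\<epsilon> * \<gamma>')))" by (simp add: finite_image_iff)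
    then show "B u z w = 0"
      by (rule polyfun_zero[rotated]) (use 1 in \<open>auto intro!: B(2)\<close>)
  qed
next
  case False
  \<comment> \<open>With \<open>a = z\<close> and \<open>b = \<epsilon> w\<close>, the form times
    \<open>\<epsilon>\<close> is the norm \<open>b^2 + t a b + n a^2\<close>, and \<open>n\<close>
    is a unit when \<open>u\<close> is a power of two.\<close>
  define t n where "t = (\<lambda>u. \<gamma> - u * \<epsilon>')" "n = (\<lambda>u. - (u * \<epsilon> * \<gamma>'))"
  note tn = this
  define R :: "(qbar \<times> qbar \<times> qbar) set" where
    "R = {(2 ^ i, fst (pell (t (2 ^ i)) (n (2 ^ i)) j), snd (pell (t (2 ^ i)) (n (2 ^ i)) j) / \<epsilon>) | i j :: nat. True}"
  show ?thesis
  proof (rule that[of R])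
    show "u \<in> K \<and> z \<in> K \<and> w \<in> K" if h: "(u, z, w) \<in> R" "subfield K qbar_ring" "{\<gamma>, \<epsilon>, \<gamma>', \<epsilon>'} \<subseteq> K" for u z w K
    proof -
      obtain i j where ij: "u = 2 ^ i" "z = fst (pell (t u) (n u) j)" "w = snd (pell (t u) (n u) j) / \<epsilon>"
        using h(1) by (auto simp: R_def)
      have u: "u \<in> K" unfolding ij(1) by (intro subfield_closed[OF h(2)])
      have "t u \<in> K" "n u \<in> K" unfolding tn using h(3) u by (auto intro!: subfield_closed[OF h(2)])
      from pell_subfield[OF h(2) this] show ?thesis
        using h(3) u unfolding ij(2,3) by (auto intro!: subfield_closed[OF h(2)])
    qed
    show "v u = 1 \<and> v z \<le> 1 \<and> v w \<le> 1 \<and> v (\<epsilon> * w^2 + (\<gamma> - u * \<epsilon>') * z * w - u * \<gamma>' * z^2) = 1"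
      if h: "(u, z, w) \<in> R" and um: "ultrametric v" and E: "\<And>x. x \<in> {2, \<gamma>, \<epsilon>, \<gamma>', \<epsilon>'} \<Longrightarrow> x \<noteq> 0 \<Longrightarrow> v x = 1" for u z w v
    proof -
      obtain i j where ij: "u = 2 ^ i" "z = fst (pell (t u) (n u) j)" "w = snd (pell (t u) (n u) j) / \<epsilon>"
        using h by (auto simp: R_def)
      have c: "v 2 = 1" "v \<epsilon> = 1" "v \<gamma>' = 1" using E nz by auto
      have c': "v \<gamma> \<le> 1" "v \<epsilon>' \<le> 1" using E[of \<gamma>] E[of \<epsilon>'] um_eq_0[OF um, of 0]
        by (cases "\<gamma> = 0"; cases "\<epsilon>' = 0"; simp del: um_eq_0)+
      have u: "v u = 1" by (simp add: ij um_power[OF um] c)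
      have "v (t u) \<le> 1" unfolding tn by (intro um_diff_le_1[OF um] um_mult_le_1[OF um]) (simp_all add: c' u)
      moreover have n: "v (n u) = 1" by (simp add: tn um_mult[OF um] um_minus[OF um] c u)
      ultimately have zw: "v z \<le> 1" "v w \<le> 1"
        using pell_integral[OF um, of "t u" "n u" j] by (simp_all add: ij(2,3) um_divide[OF um] c)
      have "pell (t u) (n u) j = (z, \<epsilon> * w)" using nz by (simp add: ij(2,3))
      from pell_norm[OF this] have "\<epsilon> * (\<epsilon> * w^2 + (\<gamma> - u * \<epsilon>') * z * w - u * \<gamma>' * z^2) = n u ^ j"
        by (simp add: tn power2_eq_square algebra_simps)
      then have "v \<epsilon> * v (\<epsilon> * w^2 + (\<gamma> - u * \<epsilon>') * z * w - u * \<gamma>' * z^2) = 1"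
        by (simp only: um_mult[OF um, symmetric] um_power[OF um] n power_one)
      then show ?thesis using u zw c by simp
    qed
    fix B m and u z w :: qbar
    assume B: "\<And>u k z w. B u (k * z) (k * w) = k ^ m * B u z w"
       "\<And>f g h. polyfun f \<Longrightarrow> polyfun g \<Longrightarrow> polyfun h \<Longrightarrow> polyfun (\<lambda>s. B (f s) (g s) (h s))"
       "\<And>u z w. (u, z, w) \<in> R \<Longrightarrow> B u z w = 0"
    have inf: "infinite (range (\<lambda>i. (2 :: qbar) ^ i))"
      using power_of_2_inj by (simp add: finite_image_iff)
    have 1: "B u (fst (pell (t u) (n u) j)) (snd (pell (t u) (n u) j) / \<epsilon>) = 0" for u j
    proof (rule polyfun_zero[where f = "\<lambda>u. B u (fst (pell (t u) (n u) j)) (snd (pell (t u) (n u) j) / \<epsilon>)", OF _ inf])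
      have "polyfun t" "polyfun n" unfolding tn by (intro polyfun_diff polyfun_minus polyfun_mult polyfun_id polyfun_const)+
      note pf = pell_polyfun[OF this, of j]
      show "polyfun (\<lambda>u. B u (fst (pell (t u) (n u) j)) (snd (pell (t u) (n u) j) / \<epsilon>))"
        unfolding divide_inverse by (rule B(2)) (use pf in auto)
      have Rm: "(2 ^ i, fst (pell (t (2 ^ i)) (n (2 ^ i)) j), snd (pell (t (2 ^ i)) (n (2 ^ i)) j) / \<epsilon>) \<in> R" for i
        unfolding R_def by blast
      show "B s (fst (pell (t s) (n s) j)) (snd (pell (t s) (n s) j) / \<epsilon>) = 0" if "s \<in> range (\<lambda>i. 2 ^ i)" for s
        using that by (auto intro: B(3) Rm)
    qed
    text \<open>Over special values of \<open>u\<close> the ratio of the two conjugate roots is a power of two, so the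
      solutions have infinitely many directions.\<close>
    have 2: "B u z w = 0" if u: "t u ^ 2 * 2 ^ k = n u * (1 + 2 ^ k)^2" "u \<noteq> 0" "k > 0" for u z w k
    proof -
      define \<rho> :: qbar where "\<rho> = 2 ^ k"
      have r1: "1 + \<rho> \<noteq> 0" unfolding \<rho>_def by (rule one_plus_power_of_2)
      have r2: "\<rho> \<noteq> 1" using power_of_2_inj[THEN injD, of k 0] u(3) by (auto simp: \<rho>_def)
      have r0: "\<rho> \<noteq> 0" by (simp add: \<rho>_def)
      have n0: "n u \<noteq> 0" using u nz by (simp add: tn)
      then have t0: "t u \<noteq> 0" using u(1) r1 by (auto simp: \<rho>_def)
      \<comment> \<open>The roots are to satisfy \<open>\<theta> = \<rho> \<theta>'\<close> and
        \<open>\<theta> + \<theta>' = t\<close>; the assumption on \<open>u\<close> then makes their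
        product \<open>n\<close>.\<close>
      define \<theta>' where "\<theta>' = t u / (1 + \<rho>)"
      define \<theta> where "\<theta> = \<rho> * \<theta>'"
      have th0: "\<theta>' \<noteq> 0" "\<theta> \<noteq> \<theta>'" using t0 r1 r2 by (simp_all add: \<theta>'_def \<theta>_def)
      have t': "(1 + \<rho>) * \<theta>' = t u" using r1 by (simp add: \<theta>'_def)
      then have s: "t u = \<theta> + \<theta>'" by (simp add: \<theta>_def algebra_simps)
      have "(1 + \<rho>)^2 * (\<theta> * \<theta>') = ((1 + \<rho>) * \<theta>')^2 * \<rho>"
        by (simp add: \<theta>_def power_mult_distrib power2_eq_square mult_ac)
      also have "\<dots> = (1 + \<rho>)^2 * n u" using u(1) unfolding t' \<rho>_def[symmetric] by (simp add: mult.commute)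
      finally have p: "n u = \<theta> * \<theta>'" using r1 by simp
      have "inj (\<lambda>j. \<rho> ^ j)"
        using u(3) by (auto intro!: injI simp: \<rho>_def power_mult[symmetric] inj_eq[OF power_of_2_inj])
      then have inf': "infinite (range (\<lambda>j. \<rho> ^ j))" by (simp add: finite_image_iff)
      show ?thesis
      proof (rule homogeneous_zero[where B = "B u" and n = m and \<theta> = \<theta> and \<theta>' = \<theta>' and \<epsilon> = \<epsilon>, OF B(1) _ th0(2) nz(1) inf'])
        show "polyfun (\<lambda>s. B u (f s) (g s))" if "polyfun f" "polyfun g" for f g
          by (rule B(2)) (use that in auto)
        fix x assume "x \<in> range (\<lambda>j. \<rho> ^ j)"
        then obtain j where x: "x = \<rho> ^ j" by blast
        obtain a b where ab: "pell (t u) (n u) j = (a, b)" by fastforce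
        note pp = pell_power[OF s p ab]
        define i where "i = 1 / \<theta>' ^ j"
        have i: "i * \<theta>' ^ j = 1" "i * \<theta> ^ j = x" using th0 by (simp_all add: i_def x \<theta>_def power_mult_distrib)
        have ib: "i * (b + a * \<theta>) = x" "i * (b + a * \<theta>') = 1" using pp i by simp_all
        have "i * a * (\<theta> - \<theta>') = i * (b + a * \<theta>) - i * (b + a * \<theta>')" by (simp add: algebra_simps)
        then have a: "(x - 1) / (\<theta> - \<theta>') = i * a" using th0 unfolding ib by (simp add: field_simps)
        have "i * b = i * (b + a * \<theta>') - \<theta>' * (i * a)" by (simp add: algebra_simps)
        then have "1 - \<theta>' * (i * a) = i * b" unfolding ib by simp
        then have b: "(1 - \<theta>' * ((x - 1) / (\<theta> - \<theta>'))) / \<epsilon> = i * (b / \<epsilon>)" unfolding a by simp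
        show "B u ((x - 1) / (\<theta> - \<theta>')) ((1 - \<theta>' * ((x - 1) / (\<theta> - \<theta>'))) / \<epsilon>) = 0"
          unfolding b unfolding a B(1) using 1[of u j] by (simp add: ab)
      qed
    qed
    have "\<exists>u. t u ^ 2 * 2 ^ Suc k = n u * (1 + 2 ^ Suc k)^2 \<and> u \<noteq> 0" for k
    proof -
      define \<rho> :: qbar where "\<rho> = 2 ^ Suc k"
      have r1: "1 + \<rho> \<noteq> 0" unfolding \<rho>_def by (rule one_plus_power_of_2)
      have r0: "\<rho> \<noteq> 0" by (simp add: \<rho>_def)
      define M where "M = \<epsilon> * \<gamma>' * (1 + \<rho>)^2"
      have M: "M \<noteq> 0" using nz r1 by (simp add: M_def)
      \<comment> \<open>An equation of degree at most two in \<open>u\<close> with constant term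
        \<open>\<rho> \<gamma>^2\<close>. For \<open>\<gamma> = 0\<close> its nonzero root is
        written down; otherwise none of its roots is zero.\<close>
      have "\<exists>u. \<rho> * (\<gamma> - u * \<epsilon>')^2 + u * M = 0 \<and> u \<noteq> 0"
      proof (cases "\<gamma> = 0")
        case True
        then have "\<epsilon>' \<noteq> 0" using False by simp
        then show ?thesis using M r0 True
          by (intro exI[of _ "- M / (\<rho> * \<epsilon>'^2)"]) (simp add: field_simps power2_eq_square)
      next
        case g: False
        have "Polynomial.degree [:\<rho> * \<gamma>^2, M - 2 * \<rho> * \<gamma> * \<epsilon>', \<rho> * \<epsilon>'^2:] > 0"
          using M r0 by (cases "\<epsilon>' = 0") auto
        then obtain u where "poly [:\<rho> * \<gamma>^2, M - 2 * \<rho> * \<gamma> * \<epsilon>', \<rho> * \<epsilon>'^2:] u = 0"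
          using alg_closed_imp_poly_has_root by blast
        then have "\<rho> * (\<gamma> - u * \<epsilon>')^2 + u * M = 0" by (simp add: algebra_simps power2_eq_square)
        moreover have "u \<noteq> 0" using calculation g r0 by auto
        ultimately show ?thesis by blast
      qed
      then show ?thesis unfolding tn \<rho>_def[symmetric] M_def
        by (elim ex_forward) (auto simp: algebra_simps power2_eq_square add_eq_0_iff)
    qed
    then obtain U where U: "\<And>k. t (U k) ^ 2 * 2 ^ Suc k = n (U k) * (1 + 2 ^ Suc k)^2" "\<And>k. U k \<noteq> 0" by metis
    have "inj U"
    proof (rule injI)
      fix i j assume ij: "U i = U j"
      define x y :: qbar where "x = 2 ^ Suc i" "y = 2 ^ Suc j"
      have n0: "n (U j) \<noteq> 0" using U(2) nz by (simp add: tn)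
      have 1: "t (U j) ^ 2 * x = n (U j) * (1 + x)^2" "t (U j) ^ 2 * y = n (U j) * (1 + y)^2"
        using U(1)[of i] U(1)[of j] ij by (simp_all add: x_y_def)
      have "n (U j) * ((1 + x)^2 * y) = n (U j) * ((1 + y)^2 * x)"
        unfolding mult.assoc[symmetric] 1[symmetric] by (simp only: mult.assoc mult.commute[of x y])
      then have "(1 + x)^2 * y = (1 + y)^2 * x" using n0 by simp
      \<comment> \<open>Equal parameters have the same pair of roots, so the ratios \<open>x\<close>
        and \<open>y\<close> are equal or inverse to each other, and \<open>x * y\<close> is a
        positive power of two.\<close>
      then have "(x - y) * (x * y - 1) = 0" by (simp add: algebra_simps power2_eq_square)
      moreover have "x * y \<noteq> 1" using power_of_2_inj[THEN injD, of "Suc i + Suc j" 0]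
        by (auto simp: x_y_def power_add)
      ultimately have "x = y" by simp
      then have "Suc i = Suc j" unfolding x_y_def using power_of_2_inj[THEN injD] by blast
      then show "i = j" by simp
    qed
    then have "infinite (range U)" by (simp add: finite_image_iff)
    then show "B u z w = 0"
    proof (rule polyfun_zero[where f = "\<lambda>u. B u z w", rotated])
      show "polyfun (\<lambda>u. B u z w)" by (rule B(2)) auto
      show "B s z w = 0" if "s \<in> range U" for s
        using that 2[OF U(1,2)] by auto
    qed
  qed
qed

text \<open>Eliminating \<open>w\<close> by \<open>n w = u m z\<close> computes the resultant of the
  quadratic form \<open>q2\<close> and the linear form \<open>ll\<close>, from which a factor
  \<open>u\<close> splits off.\<close>

lemma conic_singular_identity:
  fixes \<epsilon> \<gamma> \<epsilon>' \<gamma>' n m u w z :: "'a::field"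
  assumes "n * w = u * m * z"
  shows "n^2 * (\<epsilon> * w^2 + (\<gamma> - u * \<epsilon>') * z * w - u * \<gamma>' * z^2)
    = z^2 * (u * (\<epsilon> * u * m^2 + (\<gamma> - u * \<epsilon>') * n * m - \<gamma>' * n^2))"
  using assms by Groebner_Basis.algebra

lemma transversal_conic_identities:
  fixes \<alpha> \<beta> \<gamma> \<epsilon> \<alpha>' \<beta>' \<gamma>' \<epsilon>' u z w k Q L :: "'a::field"
  assumes "Q = \<epsilon> * w^2 + (\<gamma> - u * \<epsilon>') * z * w - u * \<gamma>' * z^2"
    "L = (\<alpha> + \<beta> * u) * w - u * (\<alpha>' + \<beta>' * u) * z"
  shows "Q * - (L * w) * (\<alpha> * Q + \<beta> * (u * Q) + \<gamma> * - (L * z) + \<epsilon> * - (L * w)) -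
      - (L * z) * (\<alpha>' * Q + \<beta>' * (u * Q) + \<gamma>' * - (L * z) + \<epsilon>' * - (L * w)) * (u * Q) = 0"
    and "k * (k * w) * (\<alpha> * k + \<beta> * (k * u) + \<gamma> * (k * z) + \<epsilon> * (k * w)) -
      k * z * (\<alpha>' * k + \<beta>' * (k * u) + \<gamma>' * (k * z) + \<epsilon>' * (k * w)) * (k * u) = k^3 * (Q + L)"
  using assms by Groebner_Basis.algebra+

section \<open>The pencil of planes through the line l1 = m3 = 0\<close>

locale transversal =
  fixes F :: "qbar ^ 4 \<Rightarrow> qbar" and l1 l2 l3 m1 m2 m3 e1 e2 e3 e4 :: "qbar ^ 4"
    and \<alpha> \<beta> \<gamma> \<epsilon> \<alpha>' \<beta>' \<gamma>' \<epsilon>' :: qbar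
  assumes hpF: "hp 3 F" and ns: "nonsing F"
    and F: "\<And>x. F x = lf l1 x * lf l2 x * lf l3 x - lf m1 x * lf m2 x * lf m3 x"
    and dual [simp]:
    "lf l1 e1 = 1" "lf l1 e2 = 0" "lf l1 e3 = 0" "lf l1 e4 = 0"
    "lf m3 e1 = 0" "lf m3 e2 = 1" "lf m3 e3 = 0" "lf m3 e4 = 0"
    "lf m1 e1 = 0" "lf m1 e2 = 0" "lf m1 e3 = 1" "lf m1 e4 = 0"
    "lf l2 e1 = 0" "lf l2 e2 = 0" "lf l2 e3 = 0" "lf l2 e4 = 1"
    and basis: "\<And>x. x = lf l1 x *s e1 + lf m3 x *s e2 + lf m1 x *s e3 + lf l2 x *s e4"
    and l3: "\<And>x. lf l3 x = \<alpha> * lf l1 x + \<beta> * lf m3 x + \<gamma> * lf m1 x + \<epsilon> * lf l2 x"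
    and m2: "\<And>x. lf m2 x = \<alpha>' * lf l1 x + \<beta>' * lf m3 x + \<gamma>' * lf m1 x + \<epsilon>' * lf l2 x"
begin

definition qt :: "qbar \<Rightarrow> qbar \<Rightarrow> qbar \<Rightarrow> qbar \<Rightarrow> qbar ^ 4" where
  "qt x y z w = x *s e1 + y *s e2 + z *s e3 + w *s e4"

lemma lf_qt [simp]: "lf l1 (qt x y z w) = x" "lf m3 (qt x y z w) = y" "lf m1 (qt x y z w) = z"
  "lf l2 (qt x y z w) = w"
  by (simp_all add: qt_def)

lemma qt_nonzero [simp]: "qt x y z w = 0 \<longleftrightarrow> x = 0 \<and> y = 0 \<and> z = 0 \<and> w = 0"
proof
  assume "qt x y z w = 0"
  then show "x = 0 \<and> y = 0 \<and> z = 0 \<and> w = 0" using lf_qt[of x y z w] lf_zero by metis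
qed (simp add: qt_def)

lemma qt_lf: "x = qt (lf l1 x) (lf m3 x) (lf m1 x) (lf l2 x)"
  unfolding qt_def by (rule basis)

lemma qt_scale: "k *s qt x y z w = qt (k * x) (k * y) (k * z) (k * w)"
  unfolding qt_def by (simp add: vec_eq_iff algebra_simps)

text \<open>If one of the constants vanished, the vector in its proof would be a nonzero point at
  which two factors of each product vanish.\<close>

lemma nz: "\<epsilon> \<noteq> 0" "\<gamma>' \<noteq> 0" "\<alpha> \<noteq> 0" "\<gamma>' * \<alpha> - \<gamma> * \<alpha>' \<noteq> 0"
proof -
  have "qt 0 0 0 1 = 0" if "\<epsilon> = 0"
    by (rule nonsing_star[OF ns, of l1 l3 l2 m1 m3 m2]) (simp_all add: F l3 that mult_ac)
  then show "\<epsilon> \<noteq> 0" by auto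
  have "qt 0 0 1 0 = 0" if "\<gamma>' = 0"
    by (rule nonsing_star[OF ns, of l1 l2 l3 m2 m3 m1]) (simp_all add: F m2 that mult_ac)
  then show "\<gamma>' \<noteq> 0" by auto
  have "qt 1 0 0 0 = 0" if "\<alpha> = 0"
    by (rule nonsing_star[OF ns, of l2 l3 l1 m1 m3 m2]) (simp_all add: F l3 that mult_ac)
  then show a: "\<alpha> \<noteq> 0" by auto
  have "qt \<gamma> 0 (- \<alpha>) 0 = 0" if "\<gamma>' * \<alpha> - \<gamma> * \<alpha>' = 0"
    by (rule nonsing_star[OF ns, of l2 l3 l1 m2 m3 m1])
      (use that in \<open>simp_all add: F l3 m2 mult_ac\<close>)
  then show "\<gamma>' * \<alpha> - \<gamma> * \<alpha>' \<noteq> 0" using a by auto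
qed

definition "q2 u z w = \<epsilon> * w^2 + (\<gamma> - u * \<epsilon>') * z * w - u * \<gamma>' * z^2"
definition "ll u z w = (\<alpha> + \<beta> * u) * w - u * (\<alpha>' + \<beta>' * u) * z"

text \<open>The plane \<open>m3 = u l1\<close> cuts out the conic \<open>q2 + l1 ll = 0\<close> through the point
  \<open>z = w = 0\<close>; \<open>V u z w\<close> is its second point of intersection with the line in direction \<open>(z, w)\<close>.\<close>

definition "V u z w = qt (q2 u z w) (u * q2 u z w) (- (ll u z w * z)) (- (ll u z w * w))"

lemma F_V: "F (V u z w) = 0"
  unfolding F l3 m2 V_def lf_qt by (rule transversal_conic_identities(1)[OF q2_def ll_def])

lemma V_scale: "V u (k * z) (k * w) = k^2 *s V u z w"
  unfolding V_def qt_scale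
  by (simp add: q2_def ll_def power_mult_distrib power2_eq_square algebra_simps)

text \<open>A point off the excluded planes is the second intersection of its conic with the line
  from the base point \<open>z = w = 0\<close>, since \<open>q2\<close> and \<open>ll\<close> do not
  vanish together in its direction.\<close>

lemma V_dense:
  assumes R: "\<And>B n u z w. (\<And>u k z w. B u (k * z) (k * w) = k ^ n * B u z w) \<Longrightarrow>
       (\<And>f g h. polyfun f \<Longrightarrow> polyfun g \<Longrightarrow> polyfun h \<Longrightarrow> polyfun (\<lambda>s. B (f s) (g s) (h s))) \<Longrightarrow>
       (\<And>u z w. (u, z, w) \<in> R \<Longrightarrow> B u z w = 0) \<Longrightarrow> B u z w = 0"
    and G: "hp n G" "\<And>u z w. (u, z, w) \<in> R \<Longrightarrow> G (V u z w) = 0"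
    and "F x = 0"
  shows "G x = 0"
proof -
  have V0: "G (V u z w) = 0" for u z w
  proof (rule R[where B = "\<lambda>u z w. G (V u z w)" and n = "2 * n"])
    show "G (V u (k * z) (k * w)) = k ^ (2 * n) * G (V u z w)" for u k z w
      unfolding V_scale hp_scale[OF G(1)] by (simp add: power_mult)
    show "polyfun (\<lambda>s. G (V (f s) (g s) (h s)))" if "polyfun f" "polyfun g" "polyfun h" for f g h
      by (rule hp_polyfun[OF G(1)]) (simp add: V_def qt_def q2_def ll_def that)
  qed (rule G(2))
  \<comment> \<open>Up to a factor \<open>u\<close>, the resultant of \<open>q2\<close> and
    \<open>ll\<close>. Planes \<open>m3 = u l1\<close> in which it vanishes are discarded; by
    \<open>nz\<close> it is not identically zero.\<close>
  define P where "P = [:0, \<epsilon>:] * [:\<alpha>', \<beta>':] ^ 2 + [:\<gamma>, - \<epsilon>':] * [:\<alpha>, \<beta>:] * [:\<alpha>', \<beta>':] - smult \<gamma>' ([:\<alpha>, \<beta>:] ^ 2)"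
  have P: "poly P u = \<epsilon> * u * (\<alpha>' + \<beta>' * u)^2 + (\<gamma> - u * \<epsilon>') * (\<alpha> + \<beta> * u) * (\<alpha>' + \<beta>' * u) - \<gamma>' * (\<alpha> + \<beta> * u)^2" for u
    by (simp add: P_def algebra_simps)
  have "poly P 0 = - (\<alpha> * (\<gamma>' * \<alpha> - \<gamma> * \<alpha>'))" by (simp add: P algebra_simps power2_eq_square)
  then have "P \<noteq> 0" using nz by auto
  then have fin: "finite {u. poly P u = 0}" by (rule poly_roots_finite)
  define Ls where "Ls = {l1, m3, m1} \<union> (\<lambda>u. m3 - u *s l1) ` {u. poly P u = 0}"
  show ?thesis
  proof (rule nonsing_removable[OF hpF ns _ _ G(1) _ \<open>F x = 0\<close>, of Ls])
    show "finite Ls" unfolding Ls_def using fin by simp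
    have "lf (m3 - u *s l1) e2 \<noteq> 0" for u by simp
    then have "m3 - u *s l1 \<noteq> 0" for u by (metis lf_zero_left)
    moreover have "l1 \<noteq> 0" "m3 \<noteq> 0" "m1 \<noteq> 0" using dual(1,6,11) by (auto simp del: dual)
    ultimately show "0 \<notin> Ls" unfolding Ls_def by fastforce
    fix x assume x: "F x = 0" "\<And>l. l \<in> Ls \<Longrightarrow> lf l x \<noteq> 0"
    define k where "k = lf l1 x"
    have n: "k \<noteq> 0" "lf m3 x \<noteq> 0" "lf m1 x \<noteq> 0" using x(2) by (auto simp: Ls_def k_def)
    define u z w where "u = lf m3 x / k" "z = lf m1 x / k" "w = lf l2 x / k"
    have xq: "x = qt k (k * u) (k * z) (k * w)"
      by (subst qt_lf) (simp add: u_z_w_def k_def[symmetric] n)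
    have u: "u \<noteq> 0" "z \<noteq> 0" using n by (simp_all add: u_z_w_def)
    have "lf (m3 - u *s l1) x \<noteq> 0" if "poly P u = 0"
      by (rule x(2)) (use that in \<open>unfold Ls_def, blast\<close>)
    then have Pu: "poly P u \<noteq> 0" using n by (auto simp: u_z_w_def k_def)
    have lx: "lf l1 x = k" "lf m3 x = k * u" "lf m1 x = k * z" "lf l2 x = k * w"
      using n by (simp_all add: u_z_w_def k_def)
    have "F x = k^3 * (q2 u z w + ll u z w)"
      unfolding F l3 m2 lx by (rule transversal_conic_identities(2)[OF q2_def ll_def])
    then have ql: "q2 u z w + ll u z w = 0" using x(1) n by simp
    have q: "q2 u z w \<noteq> 0"
    proof
      assume q0: "q2 u z w = 0"
      then have "(\<alpha> + \<beta> * u) * w = u * (\<alpha>' + \<beta>' * u) * z" using ql by (simp add: ll_def)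
      then have "(\<alpha> + \<beta> * u)^2 * q2 u z w = z^2 * (u * poly P u)"
        unfolding q2_def P by (rule conic_singular_identity)
      then show False using q0 u Pu by simp
    qed
    have "q2 u z w = - ll u z w" using ql by (simp add: eq_neg_iff_add_eq_0)
    then have L: "- (ll u z w * z) = q2 u z w * z" "- (ll u z w * w) = q2 u z w * w" by simp_all
    have "V u z w = (q2 u z w / k) *s x"
      unfolding V_def L by (subst xq) (simp add: qt_scale n mult.commute)
    then have "(q2 u z w / k) ^ n * G x = 0" using V0[of u z w] hp_scale[OF G(1)] by metis
    then show "G x = 0" using q n by simp
  qed
qed

end

text \<open>All five lines lie in the planes \<open>l1 = 0\<close> and \<open>m3 = 0\<close>, and at
  the points, once scaled, these two forms take the unit values 1 and \<open>u\<close>.\<close>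

lemma dense_integral_five_lines:
  assumes ns: "nonsing (form 3 G)"
    and F: "\<And>x. form 3 G x = lf l1 x * lf l2 x * lf l3 x - lf m1 x * lf m2 x * lf m3 x"
  shows "dense_integral (zero_locus 3 G)
    (pline l1 m1 \<union> pline l1 m2 \<union> pline l1 m3 \<union> pline m3 l2 \<union> pline m3 l3)" (is "dense_integral _ ?D")
proof (rule dual_basis4[of l1 m3 m1 l2])
  show "x = 0" if "lf l1 x = 0" "lf m3 x = 0" "lf m1 x = 0" "lf l2 x = 0" for x
    by (rule nonsing_star[OF ns, of l1 l2 l3 m1 m3 m2]) (simp_all add: F that)
  fix e1 e2 e3 e4
  assume e: "lf l1 e1 = 1" "lf l1 e2 = 0" "lf l1 e3 = 0" "lf l1 e4 = 0"
    "lf m3 e1 = 0" "lf m3 e2 = 1" "lf m3 e3 = 0" "lf m3 e4 = 0"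
    "lf m1 e1 = 0" "lf m1 e2 = 0" "lf m1 e3 = 1" "lf m1 e4 = 0"
    "lf l2 e1 = 0" "lf l2 e2 = 0" "lf l2 e3 = 0" "lf l2 e4 = 1"
    and b: "\<And>x. x = lf l1 x *s e1 + lf m3 x *s e2 + lf m1 x *s e3 + lf l2 x *s e4"
  have lin: "lf l x = lf l e1 * lf l1 x + lf l e2 * lf m3 x + lf l e3 * lf m1 x + lf l e4 * lf l2 x" for l x
    by (subst b[of x]) (simp add: mult.commute)
  define \<alpha> \<beta> \<gamma> \<epsilon> where "\<alpha> = lf l3 e1" "\<beta> = lf l3 e2" "\<gamma> = lf l3 e3" "\<epsilon> = lf l3 e4"
  define \<alpha>' \<beta>' \<gamma>' \<epsilon>' where "\<alpha>' = lf m2 e1" "\<beta>' = lf m2 e2" "\<gamma>' = lf m2 e3" "\<epsilon>' = lf m2 e4"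
  note defs = \<alpha>_\<beta>_\<gamma>_\<epsilon>_def \<alpha>'_\<beta>'_\<gamma>'_\<epsilon>'_def
  interpret transversal "form 3 G" l1 l2 l3 m1 m2 m3 e1 e2 e3 e4 \<alpha> \<beta> \<gamma> \<epsilon> \<alpha>' \<beta>' \<gamma>' \<epsilon>'
    unfolding defs by unfold_locales (rule hp_form ns F e b lin)+
  show ?thesis
  proof (rule pell_directions[OF nz(1,2), of \<gamma> \<epsilon>'])
    fix R assume R:
      "\<And>u z w K. (u, z, w) \<in> R \<Longrightarrow> subfield K qbar_ring \<Longrightarrow> {\<gamma>, \<epsilon>, \<gamma>', \<epsilon>'} \<subseteq> K \<Longrightarrow> u \<in> K \<and> z \<in> K \<and> w \<in> K"
      "\<And>u z w v. (u, z, w) \<in> R \<Longrightarrow> ultrametric v \<Longrightarrow> (\<And>x. x \<in> {2, \<gamma>, \<epsilon>, \<gamma>', \<epsilon>'} \<Longrightarrow> x \<noteq> 0 \<Longrightarrow> v x = 1) \<Longrightarrow>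
         v u = 1 \<and> v z \<le> 1 \<and> v w \<le> 1 \<and> v (\<epsilon> * w^2 + (\<gamma> - u * \<epsilon>') * z * w - u * \<gamma>' * z^2) = 1"
      "\<And>B n u z w. (\<And>u k z w. B u (k * z) (k * w) = k ^ n * B u z w) \<Longrightarrow>
         (\<And>f g h. polyfun f \<Longrightarrow> polyfun g \<Longrightarrow> polyfun h \<Longrightarrow> polyfun (\<lambda>s. B (f s) (g s) (h s))) \<Longrightarrow>
         (\<And>u z w. (u, z, w) \<in> R \<Longrightarrow> B u z w = 0) \<Longrightarrow> B u z w = 0"
    have q0: "q2 u z w \<noteq> 0" if "(u, z, w) \<in> R" for u z w
      using R(2)[OF that ultrametric_trivial] by (auto simp: q2_def split: if_splits)
    define A where "A = {proj_point (V u z w) | u z w. (u, z, w) \<in> R}"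
    define E where "E = {2, \<alpha>, \<beta>, \<gamma>, \<epsilon>, \<alpha>', \<beta>', \<gamma>', \<epsilon>'} \<union> (\<Union>v\<in>{l1, m3, e1, e2, e3, e4}. range (\<lambda>i. v $ i))"
    have V0: "V u z w \<noteq> 0" if "(u, z, w) \<in> R" for u z w
      using q0[OF that] by (simp add: V_def)
    show ?thesis
      unfolding dense_integral_def
    proof (intro exI[of _ E] exI[of _ A] conjI allI impI ballI)
      show "finite E" unfolding E_def by simp
      show "A \<subseteq> zero_locus 3 G" unfolding A_def using V0 F_V by auto
      show "A \<subseteq> rational_points K" if K: "subfield K qbar_ring" "E \<subseteq> K" for K
      proof -
        have cK: "\<alpha> \<in> K" "\<beta> \<in> K" "\<gamma> \<in> K" "\<epsilon> \<in> K" "\<alpha>' \<in> K" "\<beta>' \<in> K" "\<gamma>' \<in> K" "\<epsilon>' \<in> K"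
          "\<And>i. e1 $ i \<in> K" "\<And>i. e2 $ i \<in> K" "\<And>i. e3 $ i \<in> K" "\<And>i. e4 $ i \<in> K"
          using K(2) unfolding E_def by auto
        note cl = subfield_closed[OF K(1)]
        have "V u z w $ i \<in> K" if "(u, z, w) \<in> R" for u z w i
        proof -
          have u: "u \<in> K" "z \<in> K" "w \<in> K" using R(1)[OF that K(1)] cK by auto
          have q: "q2 u z w \<in> K" unfolding q2_def by (intro cl cK u)
          have l: "ll u z w \<in> K" unfolding ll_def by (intro cl cK u)
          show ?thesis unfolding V_def qt_def by (simp add: cl cK q l u)
        qed
        then show ?thesis unfolding A_def rational_points_def using V0 by blast
      qed
      show "zero_locus 3 G \<subseteq> zariski_closure A"
      proof (rule zero_locus_subset_closureI)
        fix n G' x assume G': "\<And>x. proj_point x \<in> A \<Longrightarrow> x \<noteq> 0 \<Longrightarrow> form n G' x = 0" and x: "form 3 G x = 0"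
        show "form n G' x = 0"
        proof (rule V_dense[where R = R and G = "form n G'"])
          show "form n G' (V u z w) = 0" if "(u, z, w) \<in> R" for u z w
            using that V0 by (intro G') (auto simp: A_def)
        qed (rule R(3) hp_form x; assumption?)+
      qed
      show "reduction v P \<notin> reduction v ` ?D"
        if um: "ultrametric v" and v: "\<forall>x\<in>E. x \<noteq> 0 \<longrightarrow> v x = 1" and "P \<in> A" for v P
      proof
        assume red: "reduction v P \<in> reduction v ` ?D"
        obtain u z w where uzw: "(u, z, w) \<in> R" "P = proj_point (V u z w)" using \<open>P \<in> A\<close> unfolding A_def by blast
        have v1: "v x \<le> 1" if "x \<in> E" for x
          using that v um_eq_0[OF um, of 0] by (cases "x = 0") (auto simp del: um_eq_0)
        have vec: "v (a $ i) \<le> 1" if "a \<in> {l1, m3, e1, e2, e3, e4}" for a i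
          using that by (intro v1) (auto simp: E_def)
        have c: "v \<alpha> \<le> 1" "v \<beta> \<le> 1" "v \<gamma> \<le> 1" "v \<epsilon> \<le> 1" "v \<alpha>' \<le> 1" "v \<beta>' \<le> 1" "v \<gamma>' \<le> 1" "v \<epsilon>' \<le> 1"
          by (auto intro: v1 simp: E_def)
        have vR: "v u = 1" "v z \<le> 1" "v w \<le> 1" "v (q2 u z w) = 1"
        proof -
          have "v x = 1" if "x \<in> {2, \<gamma>, \<epsilon>, \<gamma>', \<epsilon>'}" "x \<noteq> 0" for x
            using v that unfolding E_def by blast
          from R(2)[OF uzw(1) um this]
          show "v u = 1" "v z \<le> 1" "v w \<le> 1" "v (q2 u z w) = 1" unfolding q2_def by simp_all
        qed
        then have u1: "v u \<le> 1" by simp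
        \<comment> \<open>The coordinate \<open>l1\<close> of \<open>V u z w\<close> is the unit
          \<open>q2 u z w\<close>, which is scaled to 1.\<close>
        define k where "k = 1 / q2 u z w"
        have k: "k * q2 u z w = 1" "k \<noteq> 0" "v k \<le> 1"
          using q0[OF uzw(1)] vR by (simp_all add: k_def um_divide[OF um] um_1[OF um])
        define x where "x = k *s V u z w"
        have P: "P = proj_point x" unfolding x_def uzw(2) using k by (simp add: proj_point_scale)
        have xq: "x = qt 1 u (- (k * (ll u z w * z))) (- (k * (ll u z w * w)))"
          unfolding x_def V_def qt_scale using k by (simp add: mult.left_commute[of k u])
        have l: "v (ll u z w) \<le> 1" unfolding ll_def
          by (intro um_diff_le_1[OF um] um_add_le_1[OF um] um_mult_le_1[OF um] c vR u1)
        have int: "v (x $ i) \<le> 1" for i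
          unfolding xq qt_def
          by (simp add: um_add_le_1[OF um] um_mult_le_1[OF um] um_diff_le_1[OF um] um_minus[OF um] vec vR k l u1 del: um_mult)
        have lx: "v (lf l1 x) = 1" "v (lf m3 x) = 1" using vR by (simp_all add: xq um_1[OF um])
        have Dp: "?D \<subseteq> proj_space" unfolding pline_def using mem_proj_space by auto
        obtain y where y: "y \<noteq> 0" "proj_point y \<in> ?D" "\<And>i. v (x $ i - y $ i) < 1"
          using reduction_memD[OF um int vec lx(1) red[unfolded P] Dp] by blast
        have close: "v (lf l x) < 1" if "\<And>i. v (l $ i) \<le> 1" "lf l y = 0" for l
          by (rule lf_close[OF um that(1) y(3) that(2)])
        have "lf l1 y = 0 \<or> lf m3 y = 0" using y(1,2) by auto
        then show False using close[of l1, OF vec] close[of m3, OF vec] lx by auto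
      qed
    qed
  qed
qed

section \<open>Tritangent planes\<close>

text \<open>A linear subspace is irreducible: on the line through two of its points the product
  becomes a product of polynomials in one variable.\<close>

lemma hp_zero_product:
  assumes "hp d f" "hp d' g" "vec.subspace K" "\<And>x. x \<in> K \<Longrightarrow> f x * g x = 0"
  shows "(\<forall>x\<in>K. f x = 0) \<or> (\<forall>x\<in>K. g x = 0)"
proof -
  have "f z = 0 \<or> g y = 0" if zy: "z \<in> K" "y \<in> K" for z y
  proof (rule ccontr)
    assume n: "\<not> (f z = 0 \<or> g y = 0)"
    obtain p where p: "\<And>r. f (z + r *s (y - z)) = poly p r"
      using hp_line_polyfun[OF assms(1)] unfolding polyfun_def by blast
    obtain q where q: "\<And>r. g (z + r *s (y - z)) = poly q r"
      using hp_line_polyfun[OF assms(2)] unfolding polyfun_def by blast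
    have "poly (p * q) r = 0" for r
    proof -
      have "z + r *s (y - z) \<in> K"
        using assms(3) zy by (simp add: vec.subspace_add vec.subspace_scale vec.subspace_diff)
      from assms(4)[OF this] show ?thesis by (simp add: p q)
    qed
    then have "p * q = 0" using poly_all_0_iff_0 by blast
    then have "p = 0 \<or> q = 0" by simp
    then show False using p[of 0] q[of 1] n by auto
  qed
  then show ?thesis by blast
qed

lemma subspace_kernel: "vec.subspace {x. lf l x = 0}"
  by (rule vec.subspaceI) auto

lemma subspace_kernel2: "vec.subspace {x. lf l x = 0 \<and> lf m x = 0}"
  by (rule vec.subspaceI) auto

lemma kernel_basis:
  fixes l m :: "qbar ^ 4"
  assumes "indep l m"
  obtains a b where "lf l a = 0" "lf m a = 0" "lf l b = 0" "lf m b = 0" "a \<noteq> 0" "\<And>c. b \<noteq> c *s a"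
    "\<And>x. lf l x = 0 \<Longrightarrow> lf m x = 0 \<Longrightarrow> \<exists>s t. x = s *s a + t *s b"
proof -
  obtain B :: "(qbar ^ 4) set" where B: "vec.dim (vec.span B) = 2" "pline l m = proj_point ` (vec.span B - {0})"
    using pline_line_over[OF assms] by (auto simp: line_over_def linear_subspace_def numeral_2_eq_2)
  obtain C where C: "C \<subseteq> vec.span B" "vec.independent C" "vec.span B \<subseteq> vec.span C" "card C = vec.dim (vec.span B)"
    by (rule vec.basis_exists)
  obtain a b where ab: "C = {a, b}" "a \<noteq> b" using C(4) B(1) by (auto simp: card_2_iff)
  have s: "vec.span C = vec.span B" using C by (metis vec.span_subspace vec.subspace_span)
  have a0: "a \<noteq> 0" using C(2) ab vec.dependent_zero by auto
  have b0: "b \<noteq> 0" using C(2) ab vec.dependent_zero by auto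
  have "lf l x = 0 \<and> lf m x = 0" if "x \<in> C" "x \<noteq> 0" for x
  proof -
    have "proj_point x \<in> pline l m" unfolding B(2) using that C(1) by blast
    then show ?thesis using that(2) by simp
  qed
  then have k: "lf l a = 0" "lf m a = 0" "lf l b = 0" "lf m b = 0" using ab a0 b0 by auto
  have nb: "b \<noteq> c *s a" for c
  proof
    assume "b = c *s a"
    then have "b \<in> vec.span {a}" by (simp add: vec.span_base vec.span_scale)
    moreover have "b \<notin> vec.span (C - {b})" using C(2) ab unfolding vec.dependent_def by auto
    ultimately show False using ab by (simp add: insert_Diff_if)
  qed
  have sp: "\<exists>s t. x = s *s a + t *s b" if "lf l x = 0" "lf m x = 0" for x
  proof (cases "x = 0")
    case True then show ?thesis by (intro exI[of _ 0]) simp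
  next
    case False
    then have "proj_point x \<in> proj_point ` (vec.span B - {0})" using that B(2) by (metis proj_point_in_pline)
    then obtain y where y: "y \<in> vec.span B" "proj_point x = proj_point y" by blast
    then obtain c where "x = c *s y" using proj_point_eqD by blast
    then have "x \<in> vec.span {a, b}" using y(1) s ab(1) by (simp add: vec.span_scale)
    then obtain s where "x - s *s a \<in> vec.span {b}" by (auto simp: vec.span_insert)
    then obtain t where "x - s *s a = t *s b" by (auto simp: vec.span_singleton)
    then have "x = s *s a + t *s b" by (metis add.commute diff_add_cancel)
    then show ?thesis by blast
  qed
  show ?thesis by (rule that[OF k a0 nb sp])
qed

lemma pline_add: "pline h (m + c *s h) = pline h m" "pline h (c *s h + m) = pline h m"
  unfolding pline_def by (rule Collect_cong; auto)+

lemma pline_scale: "c \<noteq> 0 \<Longrightarrow> pline h (c *s m) = pline h m"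
  unfolding pline_def by (rule Collect_cong) auto

lemma indep_nonzero: "indep l m \<Longrightarrow> l \<noteq> 0 \<and> m \<noteq> 0"
  unfolding indep_def by auto

text \<open>The form \<open>h\<close> is a combination of two equations of the line and can be
  exchanged for one that occurs with a nonzero coefficient.\<close>

lemma line_in_plane:
  assumes "line_over UNIV L" "L \<subseteq> pplane h" "h \<noteq> 0"
  obtains m where "indep h m" "L = pline h m"
proof -
  obtain l m where lm: "indep l m" "L = pline l m" using line_over_pline[OF assms(1)] by blast
  have "lf h x = 0" if x: "lf l x = 0" "lf m x = 0" for x
  proof (cases "x = 0")
    case False
    then have "proj_point x \<in> L" using x lm by simp
    then show ?thesis using assms(2) False by (metis proj_point_in_pplane subsetD)
  qed simp
  then obtain \<alpha> \<beta> where h: "h = \<alpha> *s l + \<beta> *s m" using indep_kernel_span[OF lm(1)] by blast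
  obtain v v' where v: "lf l v = 1" "lf m v = 0" "lf l v' = 0" "lf m v' = 1"
    using lm(1) by (auto simp: indep_def)
  show ?thesis
  proof (cases "\<alpha> = 0")
    case False
    have "indep h m" unfolding indep_def
      by (rule exI[of _ "(1 / \<alpha>) *s v"], rule exI[of _ "v' - (\<beta> / \<alpha>) *s v"]) (simp add: h v False)
    moreover have "L = pline h m" unfolding lm(2) pline_def h using False by (intro Collect_cong) auto
    ultimately show ?thesis by (rule that)
  next
    case True
    then have b: "\<beta> \<noteq> 0" using assms(3) h by auto
    have "indep h l" unfolding indep_def
      by (rule exI[of _ "(1 / \<beta>) *s v'"], rule exI[of _ "v"]) (simp add: h v b True)
    moreover have "L = pline h l" unfolding lm(2) pline_def h using b True by (intro Collect_cong) auto
    ultimately show ?thesis by (rule that)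
  qed
qed

lemma pline_eqI:
  assumes "indep h m" "indep h n" "\<And>x. lf h x = 0 \<Longrightarrow> lf m x = 0 \<Longrightarrow> lf n x = 0"
  shows "pline h m = pline h n"
proof -
  obtain \<alpha> \<beta> where n: "n = \<alpha> *s h + \<beta> *s m" using indep_kernel_span[OF assms(1,3)] by blast
  have "\<beta> \<noteq> 0"
  proof
    assume "\<beta> = 0"
    then have "n = \<alpha> *s h" using n by simp
    then show False using assms(2) unfolding indep_def by auto
  qed
  then show ?thesis unfolding n by (simp add: pline_add pline_scale)
qed

lemma form_zero_on_line:
  assumes "pline h m \<subseteq> zero_locus 3 G" "lf h x = 0" "lf m x = 0"
  shows "form 3 G x = 0"
proof (cases "x = 0")
  case True then show ?thesis using form_scale[of 3 G 0 x] by simp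
next
  case False
  then have "proj_point x \<in> pline h m" using assms by simp
  then have "proj_point x \<in> zero_locus 3 G" using assms(1) by blast
  then show ?thesis using False by simp
qed

section \<open>The cubic on a plane that contains lines of the surface\<close>

lemma hp_factor_line:
  assumes "hp (Suc d) f" "hp d' k" "indep h m" "\<And>x. lf h x = 0 \<Longrightarrow> lf m x = 0 \<Longrightarrow> k x * f x = 0"
    and "\<exists>x. lf h x = 0 \<and> lf m x = 0 \<and> k x \<noteq> 0"
  obtains g f' where "hp d g" "hp d f'" "\<And>x. f x = lf h x * g x + lf m x * f' x"
proof -
  have "\<forall>x\<in>{x. lf h x = 0 \<and> lf m x = 0}. f x = 0"
    using hp_zero_product[OF assms(2,1) subspace_kernel2[of h m]] assms(4,5) by blast
  then show ?thesis using hp_divide_line[OF assms(1,3)] that by blast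
qed

lemma hp_divide_plane:
  assumes "hp (Suc d) f" "hp d' k" "h \<noteq> 0" "\<And>x. lf h x = 0 \<Longrightarrow> k x * f x = 0"
    and "\<exists>x. lf h x = 0 \<and> k x \<noteq> 0"
  obtains g where "hp d g" "\<And>x. f x = lf h x * g x"
proof -
  have "\<forall>x\<in>{x. lf h x = 0}. f x = 0"
    using hp_zero_product[OF assms(2,1) subspace_kernel[of h]] assms(4,5) by blast
  then show ?thesis using hp_divide_linear[OF assms(1,3)] that by blast
qed

text \<open>Modulo \<open>h\<close> the cubic is divisible by \<open>m1\<close>. The quotient
  vanishes on the second line, so it is divisible by \<open>m2\<close>, and a linear factor is
  left.\<close>

lemma two_lines_in_plane:
  assumes F: "hp 3 F" and i: "indep h m1" "indep h m2" and ne: "pline h m1 \<noteq> pline h m2"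
    and z: "\<And>x. lf h x = 0 \<Longrightarrow> lf m1 x = 0 \<Longrightarrow> F x = 0" "\<And>x. lf h x = 0 \<Longrightarrow> lf m2 x = 0 \<Longrightarrow> F x = 0"
  obtains g n where "hp 2 g" "\<And>x. F x = lf h x * g x + lf m1 x * lf m2 x * lf n x"
proof -
  have F3: "hp (Suc 2) F" using F by (simp add: eval_nat_numeral)
  obtain g1 f1 where 1: "hp 2 g1" "hp 2 f1" "\<And>x. F x = lf h x * g1 x + lf m1 x * f1 x"
    using hp_divide_line[OF F3 i(1) z(1)] by blast
  have ex: "\<exists>x. lf h x = 0 \<and> lf m2 x = 0 \<and> lf m1 x \<noteq> 0"
    using pline_eqI[OF i(2,1)] ne by blast
  have prod: "lf m1 x * f1 x = 0" if "lf h x = 0" "lf m2 x = 0" for x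
    using z(2)[OF that] 1(3)[of x] that by simp
  have f1: "hp (Suc 1) f1" using 1(2) by (simp add: eval_nat_numeral)
  obtain g2 f2 where 2: "hp 1 g2" "hp 1 f2" "\<And>x. f1 x = lf h x * g2 x + lf m2 x * f2 x"
    using hp_factor_line[OF f1 hp_lf i(2) prod ex] by blast
  obtain n where n: "\<And>x. f2 x = lf n x" using hp_degree_1[OF 2(2)] by auto
  have "hp (1 + 1) (\<lambda>x. lf m1 x * g2 x)" by (rule hp_mult[OF hp_lf 2(1)])
  then have "hp 2 (\<lambda>x. g1 x + lf m1 x * g2 x)" using hp_add[OF 1(1)] by (simp add: eval_nat_numeral)
  moreover have "F x = lf h x * (g1 x + lf m1 x * g2 x) + lf m1 x * lf m2 x * lf n x" for x
    unfolding 1(3) 2(3) n by (simp add: algebra_simps)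
  ultimately show ?thesis by (rule that)
qed

text \<open>The factor left over from two lines vanishes on the third, so modulo \<open>h\<close> it
  is a multiple of \<open>m3\<close>. The multiple is nonzero because no plane lies on the
  surface.\<close>

lemma three_lines_in_plane:
  assumes F: "hp 3 F" "nonsing F" and i: "indep h m1" "indep h m2" "indep h m3"
    and ne: "pline h m1 \<noteq> pline h m2" "pline h m1 \<noteq> pline h m3" "pline h m2 \<noteq> pline h m3"
    and z: "\<And>x. lf h x = 0 \<Longrightarrow> lf m1 x = 0 \<Longrightarrow> F x = 0" "\<And>x. lf h x = 0 \<Longrightarrow> lf m2 x = 0 \<Longrightarrow> F x = 0"
      "\<And>x. lf h x = 0 \<Longrightarrow> lf m3 x = 0 \<Longrightarrow> F x = 0"
  obtains g c where "hp 2 g" "c \<noteq> 0" "\<And>x. F x = lf h x * g x + c * lf m1 x * lf m2 x * lf m3 x"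
proof -
  obtain g n where gn: "hp 2 g" "\<And>x. F x = lf h x * g x + lf m1 x * lf m2 x * lf n x"
    using two_lines_in_plane[OF F(1) i(1,2) ne(1) z(1,2)] by blast
  have h: "h \<noteq> 0" using indep_nonzero[OF i(1)] by simp
  let ?K = "{x. lf h x = 0 \<and> lf m3 x = 0}"
  have "lf m1 x * (lf m2 x * lf n x) = 0" if "x \<in> ?K" for x
    using z(3)[of x] gn(2)[of x] that by simp
  then have "(\<forall>x\<in>?K. lf m1 x = 0) \<or> (\<forall>x\<in>?K. lf m2 x * lf n x = 0)"
    by (rule hp_zero_product[OF hp_lf hp_mult[OF hp_lf hp_lf] subspace_kernel2])
  moreover have "\<not> (\<forall>x\<in>?K. lf m1 x = 0)" using pline_eqI[OF i(3,1)] ne(2) by blast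
  ultimately have "(\<forall>x\<in>?K. lf m2 x = 0) \<or> (\<forall>x\<in>?K. lf n x = 0)"
    using hp_zero_product[OF hp_lf hp_lf subspace_kernel2, of h m3 m2 n] by blast
  moreover have "\<not> (\<forall>x\<in>?K. lf m2 x = 0)" using pline_eqI[OF i(3,2)] ne(3) by blast
  ultimately have "lf n x = 0" if "lf h x = 0" "lf m3 x = 0" for x using that by blast
  then obtain \<alpha> c where n: "n = \<alpha> *s h + c *s m3" using indep_kernel_span[OF i(3)] by blast
  have "hp (1 + 1) (\<lambda>x. lf m1 x * lf m2 x)" by (rule hp_mult[OF hp_lf hp_lf])
  then have "hp 2 (\<lambda>x. g x + \<alpha> * (lf m1 x * lf m2 x))"
    using hp_add[OF gn(1) hp_cmult] by (simp add: eval_nat_numeral)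
  moreover have e: "F x = lf h x * (g x + \<alpha> * (lf m1 x * lf m2 x)) + c * lf m1 x * lf m2 x * lf m3 x" for x
    unfolding gn(2) n by (simp add: algebra_simps)
  moreover have "c \<noteq> 0"
  proof
    assume "c = 0"
    moreover obtain v where "lf h v = 0" "F v \<noteq> 0" using nonsing_plane[OF F h] by blast
    ultimately show False using e[of v] by simp
  qed
  ultimately show ?thesis using that by blast
qed

text \<open>On a fourth line one of the three linear factors would vanish, and the line would
  coincide with one of the first three.\<close>

lemma no_four_lines_in_plane:
  assumes F: "hp 3 F" "nonsing F" and i: "indep h m1" "indep h m2" "indep h m3" "indep h m4"
    and ne: "pline h m1 \<noteq> pline h m2" "pline h m1 \<noteq> pline h m3" "pline h m2 \<noteq> pline h m3"
      "pline h m1 \<noteq> pline h m4" "pline h m2 \<noteq> pline h m4" "pline h m3 \<noteq> pline h m4"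
    and z: "\<And>x. lf h x = 0 \<Longrightarrow> lf m1 x = 0 \<Longrightarrow> F x = 0" "\<And>x. lf h x = 0 \<Longrightarrow> lf m2 x = 0 \<Longrightarrow> F x = 0"
      "\<And>x. lf h x = 0 \<Longrightarrow> lf m3 x = 0 \<Longrightarrow> F x = 0" "\<And>x. lf h x = 0 \<Longrightarrow> lf m4 x = 0 \<Longrightarrow> F x = 0"
  shows False
proof -
  obtain g c where gc: "hp 2 g" "c \<noteq> 0" "\<And>x. F x = lf h x * g x + c * lf m1 x * lf m2 x * lf m3 x"
    using three_lines_in_plane[OF F i(1-3) ne(1-3) z(1-3)] by blast
  let ?K = "{x. lf h x = 0 \<and> lf m4 x = 0}"
  have "lf m1 x * (lf m2 x * lf m3 x) = 0" if "x \<in> ?K" for x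
    using z(4)[of x] gc(2,3) that by simp
  then have "(\<forall>x\<in>?K. lf m1 x = 0) \<or> (\<forall>x\<in>?K. lf m2 x * lf m3 x = 0)"
    by (rule hp_zero_product[OF hp_lf hp_mult[OF hp_lf hp_lf] subspace_kernel2])
  moreover have "\<not> (\<forall>x\<in>?K. lf m1 x = 0)" using pline_eqI[OF i(4,1)] ne(4) by blast
  ultimately have "(\<forall>x\<in>?K. lf m2 x = 0) \<or> (\<forall>x\<in>?K. lf m3 x = 0)"
    using hp_zero_product[OF hp_lf hp_lf subspace_kernel2, of h m4 m2 m3] by blast
  moreover have "\<not> (\<forall>x\<in>?K. lf m2 x = 0)" using pline_eqI[OF i(4,2)] ne(5) by blast
  moreover have "\<not> (\<forall>x\<in>?K. lf m3 x = 0)" using pline_eqI[OF i(4,3)] ne(6) by blast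
  ultimately show False by blast
qed

text \<open>The second equation is linear in \<open>c\<close>, of the form \<open>c D = N\<close>.
  Substitution into the first gives a quartic in \<open>a\<close> whose leading coefficient is
  nonzero by assumption.\<close>

lemma two_conics_meet:
  fixes \<alpha> \<alpha>' \<beta> \<beta>' \<gamma> \<gamma>' \<epsilon> \<epsilon>' p0 p1 p2 p3 :: qbar
  assumes "\<epsilon> \<noteq> 0" "\<gamma>' \<noteq> 0" "\<gamma> * \<epsilon>' - \<epsilon> * \<gamma>' \<noteq> 0"
  obtains a c where "a * \<alpha> + c * \<alpha>' + c * (p2 - a * \<gamma> - c * \<gamma>') = p0"
    "a * \<beta> + c * \<beta>' + a * (p3 - a * \<epsilon> - c * \<epsilon>') = p1"
proof -
  define N where "N = [:p1, - (\<beta> + p3), \<epsilon>:]"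
  define D where "D = [:\<beta>', - \<epsilon>':]"
  define P where "P = - smult \<gamma>' (N * N) - [:0, \<gamma>:] * N * D + [:0, \<alpha>:] * D * D + smult (\<alpha>' + p2) (N * D) - smult p0 (D * D)"
  have "Polynomial.coeff P 4 = \<epsilon> * (\<gamma> * \<epsilon>' - \<epsilon> * \<gamma>')"
    unfolding P_def N_def D_def by (simp add: eval_nat_numeral algebra_simps)
  then have "Polynomial.coeff P 4 \<noteq> 0" using assms by simp
  then have "Polynomial.degree P > 0" using le_degree[of P 4] by linarith
  then obtain a where a: "poly P a = 0" using alg_closed_imp_poly_has_root by blast
  define n d where "n = poly N a" "d = poly D a"
  have nd: "n = p1 - (\<beta> + p3) * a + \<epsilon> * a^2" "d = \<beta>' - \<epsilon>' * a"
    by (simp_all add: n_d_def N_def D_def algebra_simps power2_eq_square)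
  have P: "- \<gamma>' * n^2 - \<gamma> * a * n * d + \<alpha> * a * d^2 + (\<alpha>' + p2) * n * d - p0 * d^2 = 0"
    using a unfolding P_def by (simp add: n_d_def[symmetric] power2_eq_square algebra_simps)
  show ?thesis
  proof (cases "d = 0")
    case False
    define c where "c = n / d"
    have cd: "c * d = n" using False by (simp add: c_def)
    have "d^2 * (a * \<alpha> + c * \<alpha>' + c * (p2 - a * \<gamma> - c * \<gamma>') - p0) =
      - \<gamma>' * (c * d)^2 - \<gamma> * a * (c * d) * d + \<alpha> * a * d^2 + (\<alpha>' + p2) * (c * d) * d - p0 * d^2"
      by (simp add: algebra_simps power2_eq_square)
    then have "d^2 * (a * \<alpha> + c * \<alpha>' + c * (p2 - a * \<gamma> - c * \<gamma>') - p0) = 0" unfolding cd P .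
    then have 1: "a * \<alpha> + c * \<alpha>' + c * (p2 - a * \<gamma> - c * \<gamma>') = p0" using False by simp
    have "a * \<beta> + c * \<beta>' + a * (p3 - a * \<epsilon> - c * \<epsilon>') - p1 = c * d - n"
      unfolding nd by (simp add: algebra_simps power2_eq_square)
    then have "a * \<beta> + c * \<beta>' + a * (p3 - a * \<epsilon> - c * \<epsilon>') = p1" using cd by simp
    with 1 show ?thesis by (rule that)
  next
    \<comment> \<open>Here \<open>N\<close> vanishes along with \<open>D\<close>, so the second
      equation holds for every \<open>c\<close> and the first is solved as a quadratic in
      \<open>c\<close>.\<close>
    case True
    then have n0: "n = 0" using P assms by simp
    have "Polynomial.degree [:\<alpha> * a - p0, \<alpha>' + p2 - \<gamma> * a, - \<gamma>':] > 0" using assms by simp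
    then obtain c where "poly [:\<alpha> * a - p0, \<alpha>' + p2 - \<gamma> * a, - \<gamma>':] c = 0"
      using alg_closed_imp_poly_has_root by blast
    then have 1: "a * \<alpha> + c * \<alpha>' + c * (p2 - a * \<gamma> - c * \<gamma>') = p0" by (simp add: algebra_simps)
    have "a * \<beta> + c * \<beta>' + a * (p3 - a * \<epsilon> - c * \<epsilon>') - p1 = c * d - n"
      unfolding nd by (simp add: algebra_simps power2_eq_square)
    then have "a * \<beta> + c * \<beta>' + a * (p3 - a * \<epsilon> - c * \<epsilon>') = p1" using True n0 by simp
    with 1 show ?thesis by (rule that)
  qed
qed

text \<open>The hypotheses give \<open>F = h1 (n1 n2 + h2 p) + m1 m2 h2\<close> with a linear form
  \<open>p\<close>, and the claim amounts to
  \<open>p = a n2 + b n1 + c m2 + d m1 + a b h2 + c d h1\<close>. In the coordinates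
  \<open>h1\<close>, \<open>h2\<close>, \<open>m1\<close>, \<open>n1\<close> the coefficients of
  \<open>m1\<close> and \<open>n1\<close> determine \<open>d\<close> and \<open>b\<close>; the other
  two are the equations of \<open>two_conics_meet\<close>.\<close>

lemma trihedral_form_shared:
  assumes hpF: "hp 3 F" "nonsing F" and i: "indep h1 h2" and g: "hp 2 g"
    and F1: "\<And>x. F x = lf h1 x * g x + lf m1 x * lf m2 x * lf h2 x"
    and F2: "\<And>x. F x = lf h2 x * g' x + lf n1 x * lf n2 x * lf h1 x"
  obtains a b c d where "\<And>x. F x = lf h1 x * lf (n1 + a *s h2) x * lf (n2 + b *s h2) x
    - lf (m1 + c *s h1) x * lf (m2 + d *s h1) x * lf (- h2) x"
proof -
  have "hp (1 + 1) (\<lambda>x. lf n1 x * lf n2 x)" by (rule hp_mult[OF hp_lf hp_lf])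
  then have d2: "hp (Suc 1) (\<lambda>x. g x - lf n1 x * lf n2 x)" using hp_diff[OF g] by (simp add: eval_nat_numeral)
  have z: "lf h1 x * (g x - lf n1 x * lf n2 x) = 0" if "lf h2 x = 0" for x
    using F1[of x] F2[of x] that by (auto simp: algebra_simps)
  have "h2 \<noteq> 0" "\<exists>x. lf h2 x = 0 \<and> lf h1 x \<noteq> 0" using i unfolding indep_def by auto
  then obtain p' where p': "hp 1 p'" "\<And>x. g x - lf n1 x * lf n2 x = lf h2 x * p' x"
    using hp_divide_plane[OF d2 hp_lf _ z] by blast
  obtain p where p: "\<And>x. p' x = lf p x" using hp_degree_1[OF p'(1)] by auto
  have F: "F x = lf h1 x * (lf n1 x * lf n2 x + lf h2 x * lf p x) + lf m1 x * lf m2 x * lf h2 x" for x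
    using F1[of x] p'(2)[of x] unfolding p by (simp add: algebra_simps)
  \<comment> \<open>The analogue of \<open>nonsing_star\<close> for this shape of the
    equation.\<close>
  have star: "x = 0"
    if x: "lf h1 x = 0" "lf h2 x = 0" "lf m x = 0" "lf n x = 0" and m: "\<And>x. lf m1 x * lf m2 x = lf m x * lf m' x"
      and n: "\<And>x. lf n1 x * lf n2 x = lf n x * lf n' x" for x m n m' n'
  proof (rule ccontr)
    assume "x \<noteq> 0"
    then show False
    proof (rule nonsingD[OF hpF(2)])
      show "F x = 0" unfolding F using x by simp
      fix y
      show "\<exists>q. \<forall>s. F (x + s *s y) = s ^ 2 * poly q s"
        unfolding F m n
        by (rule exI[of _ "[:lf h1 y * lf n y * lf n' x + lf m y * lf m' x * lf h2 y + lf h1 y * lf h2 y * lf p x,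
            lf h1 y * lf n y * lf n' y + lf m y * lf m' y * lf h2 y + lf h1 y * lf h2 y * lf p y:]"])
          (simp add: x algebra_simps power2_eq_square)
    qed
  qed
  show ?thesis
  proof (rule dual_basis4[of h1 h2 m1 n1])
    show "x = 0" if "lf h1 x = 0" "lf h2 x = 0" "lf m1 x = 0" "lf n1 x = 0" for x
      by (rule star[OF that refl refl])
    fix e1 e2 e3 e4
    assume e: "lf h1 e1 = 1" "lf h1 e2 = 0" "lf h1 e3 = 0" "lf h1 e4 = 0"
      "lf h2 e1 = 0" "lf h2 e2 = 1" "lf h2 e3 = 0" "lf h2 e4 = 0"
      "lf m1 e1 = 0" "lf m1 e2 = 0" "lf m1 e3 = 1" "lf m1 e4 = 0"
      "lf n1 e1 = 0" "lf n1 e2 = 0" "lf n1 e3 = 0" "lf n1 e4 = 1"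
      and bas: "\<And>x. x = lf h1 x *s e1 + lf h2 x *s e2 + lf m1 x *s e3 + lf n1 x *s e4"
    have lin: "lf l x = lf l e1 * lf h1 x + lf l e2 * lf h2 x + lf l e3 * lf m1 x + lf l e4 * lf n1 x" for l x
      by (subst bas[of x]) (simp add: mult.commute)
    have "e4 = 0" if "lf n2 e4 = 0"
      by (rule star[of e4 m1 n2 m2 n1]) (simp_all add: e that mult.commute)
    then have \<epsilon>: "lf n2 e4 \<noteq> 0" using e(16) by auto
    have "e3 = 0" if "lf m2 e3 = 0"
      by (rule star[of e3 m2 n1 m1 n2]) (simp_all add: e that mult.commute)
    then have \<gamma>': "lf m2 e3 \<noteq> 0" using e(11) by auto
    have det: "lf n2 e3 * lf m2 e4 - lf n2 e4 * lf m2 e3 \<noteq> 0"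
    proof
      assume d: "lf n2 e3 * lf m2 e4 - lf n2 e4 * lf m2 e3 = 0"
      define v where "v = lf n2 e4 *s e3 - lf n2 e3 *s e4"
      have "v = 0"
        by (rule star[of v m2 n2 m1 n1]) (use d in \<open>simp_all add: v_def e mult.commute\<close>)
      then have "lf m1 v = 0" by simp
      then show False using \<epsilon> by (simp add: v_def e)
    qed
    obtain a c where ac: "a * lf n2 e1 + c * lf m2 e1 + c * (lf p e3 - a * lf n2 e3 - c * lf m2 e3) = lf p e1"
      "a * lf n2 e2 + c * lf m2 e2 + a * (lf p e4 - a * lf n2 e4 - c * lf m2 e4) = lf p e2"
      using two_conics_meet[OF \<epsilon> \<gamma>' det] by blast
    define b d where "b = lf p e4 - a * lf n2 e4 - c * lf m2 e4" "d = lf p e3 - a * lf n2 e3 - c * lf m2 e3"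
    note bd = this
    have px: "lf p x = a * lf n2 x + b * lf n1 x + c * lf m2 x + d * lf m1 x + a * b * lf h2 x + c * d * lf h1 x" for x
    proof -
      have 3: "lf p e3 = a * lf n2 e3 + c * lf m2 e3 + d" "lf p e4 = a * lf n2 e4 + b + c * lf m2 e4"
        by (simp_all add: bd)
      have 1: "lf p e1 = a * lf n2 e1 + c * lf m2 e1 + c * d" "lf p e2 = a * lf n2 e2 + c * lf m2 e2 + a * b"
        using ac by (simp_all add: bd)
      show ?thesis unfolding lin[of p x] lin[of n2 x] lin[of m2 x] 1 3 by (simp add: algebra_simps)
    qed
    show ?thesis
    proof (rule that[of a b c d])
      show "F x = lf h1 x * lf (n1 + a *s h2) x * lf (n2 + b *s h2) x
        - lf (m1 + c *s h1) x * lf (m2 + d *s h1) x * lf (- h2) x" for x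
        unfolding F px by (simp add: algebra_simps)
    qed
  qed
qed

text \<open>On the two-dimensional \<open>K\<close> the zeros of \<open>m\<close> are the multiples
  of \<open>e\<close>, so \<open>n\<close> vanishes on them too; one of these zeros is
  \<open>lf m z *s x - lf m x *s z\<close>.\<close>

lemma proportional_on_line:
  fixes h1 h2 m n e z :: "qbar ^ 4"
  assumes i: "indep h1 h2" and K: "K = {x. lf h1 x = 0 \<and> lf h2 x = 0}"
    and e: "e \<in> K" "e \<noteq> 0" "lf m e = 0" "lf n e = 0" and z: "z \<in> K" "lf m z \<noteq> 0"
  obtains k where "\<And>x. x \<in> K \<Longrightarrow> lf n x = k * lf m x"
proof -
  obtain a b where ab: "lf h1 a = 0" "lf h2 a = 0" "lf h1 b = 0" "lf h2 b = 0" "a \<noteq> 0" "\<And>c. b \<noteq> c *s a"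
    "\<And>x. lf h1 x = 0 \<Longrightarrow> lf h2 x = 0 \<Longrightarrow> \<exists>s t. x = s *s a + t *s b"
    using kernel_basis[OF i] by blast
  have sp: "\<exists>s t. x = s *s a + t *s b" if "x \<in> K" for x using that ab(7) K by blast
  obtain s t where st: "e = s *s a + t *s b" using sp[OF e(1)] by blast
  have st0: "s \<noteq> 0 \<or> t \<noteq> 0" using e(2) st by auto
  have mab: "lf m a \<noteq> 0 \<or> lf m b \<noteq> 0" using sp[OF z(1)] z(2) by auto
  have key: "lf n v = 0" if v: "v \<in> K" "lf m v = 0" for v
  proof -
    obtain s' t' where v': "v = s' *s a + t' *s b" using sp[OF v(1)] by blast
    have 1: "s * lf m a + t * lf m b = 0" "s' * lf m a + t' * lf m b = 0"
      using e(3) v(2) by (simp_all add: st v')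
    have "lf m a * (s * t' - s' * t) = (s * lf m a + t * lf m b) * t' - (s' * lf m a + t' * lf m b) * t"
      "lf m b * (s * t' - s' * t) = (s' * lf m a + t' * lf m b) * s - (s * lf m a + t * lf m b) * s'"
      by (simp_all add: algebra_simps)
    then have st': "s * t' = s' * t" using mab 1 by auto
    have "s * lf n v = s' * (s * lf n a) + (s * t') * lf n b" by (simp add: v' algebra_simps)
    also have "\<dots> = s' * lf n e" unfolding st' by (simp add: st algebra_simps)
    finally have 2: "s * lf n v = s' * lf n e" .
    have "t * lf n v = (s' * t) * lf n a + t' * (t * lf n b)" by (simp add: v' algebra_simps)
    also have "\<dots> = t' * lf n e" unfolding st'[symmetric] by (simp add: st algebra_simps)
    finally have "t * lf n v = t' * lf n e" .
    with 2 show ?thesis using e(4) st0 by auto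
  qed
  have "lf n x = (lf n z / lf m z) * lf m x" if "x \<in> K" for x
  proof -
    have "lf m z *s x - lf m x *s z \<in> K" using that z(1) by (simp add: K)
    then have "lf n (lf m z *s x - lf m x *s z) = 0" by (rule key) (simp add: mult.commute)
    then show ?thesis using z(2) by (simp add: field_simps)
  qed
  then show ?thesis by (rule that)
qed

lemma root_on_line:
  fixes h1 h2 n :: "qbar ^ 4"
  assumes "indep h1 h2"
  obtains e where "e \<noteq> 0" "lf h1 e = 0" "lf h2 e = 0" "lf n e = 0"
proof -
  obtain a b where ab: "lf h1 a = 0" "lf h2 a = 0" "lf h1 b = 0" "lf h2 b = 0" "a \<noteq> 0" "\<And>c. b \<noteq> c *s a"
    "\<And>x. lf h1 x = 0 \<Longrightarrow> lf h2 x = 0 \<Longrightarrow> \<exists>s t. x = s *s a + t *s b"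
    using kernel_basis[OF assms] by blast
  have "hp (Suc 0) (lf n)" using hp_lf[of n] by simp
  then obtain s t where "s *s a + t *s b \<noteq> 0" "lf n (s *s a + t *s b) = 0"
    using hp_root_on_line[OF _ ab(5,6)] by blast
  then show ?thesis using that[of "s *s a + t *s b"] ab by simp
qed

text \<open>Unique factorisation of a binary cubic form on the line where the two planes meet.\<close>

lemma match_factors:
  fixes h1 h2 m1 m2 m3 n1 n2 n3 z :: "qbar ^ 4"
  assumes i: "indep h1 h2" and K: "K = {x. lf h1 x = 0 \<and> lf h2 x = 0}"
    and prod: "\<And>x. x \<in> K \<Longrightarrow> c * (lf m1 x * lf m2 x * lf m3 x) = lf n1 x * lf n2 x * lf n3 x"
    and z: "z \<in> K" "c * (lf m1 z * lf m2 z * lf m3 z) \<noteq> 0"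
  obtains M1 M2 M3 k1 k2 k3 where "{M1, M2, M3} = {m1, m2, m3}"
    "\<And>x. lf M1 x * lf M2 x * lf M3 x = lf m1 x * lf m2 x * lf m3 x" "k1 \<noteq> 0" "k2 \<noteq> 0" "k3 \<noteq> 0"
    "\<And>x. x \<in> K \<Longrightarrow> lf n1 x = k1 * lf M1 x" "\<And>x. x \<in> K \<Longrightarrow> lf n2 x = k2 * lf M2 x"
    "\<And>x. x \<in> K \<Longrightarrow> lf n3 x = k3 * lf M3 x" "c = k1 * k2 * k3"
proof -
  have sK: "vec.subspace K" unfolding K by (rule subspace_kernel2)
  have nz: "c \<noteq> 0" "lf m1 z \<noteq> 0" "lf m2 z \<noteq> 0" "lf m3 z \<noteq> 0" "lf n1 z \<noteq> 0" "lf n2 z \<noteq> 0" "lf n3 z \<noteq> 0"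
    using z prod[OF z(1)] by auto
  obtain e where e: "e \<noteq> 0" "e \<in> K" "lf n1 e = 0" using root_on_line[OF i] K by blast
  have "lf m1 e = 0 \<or> lf m2 e = 0 \<or> lf m3 e = 0" using prod[OF e(2)] e(3) nz by simp
  then have "\<exists>M1 P Q. {M1, P, Q} = {m1, m2, m3} \<and> (\<forall>x. lf M1 x * (lf P x * lf Q x) = lf m1 x * lf m2 x * lf m3 x) \<and> lf M1 e = 0"
  proof (elim disjE)
    assume "lf m1 e = 0"
    then show ?thesis by (intro exI[of _ m1] exI[of _ m2] exI[of _ m3]) (simp add: mult_ac)
  next
    assume "lf m2 e = 0"
    then show ?thesis by (intro exI[of _ m2] exI[of _ m1] exI[of _ m3]) (auto simp: mult_ac)
  next
    assume "lf m3 e = 0"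
    then show ?thesis by (intro exI[of _ m3] exI[of _ m1] exI[of _ m2]) (auto simp: mult_ac)
  qed
  then obtain M1 P Q where M1: "{M1, P, Q} = {m1, m2, m3}"
    "\<And>x. lf M1 x * (lf P x * lf Q x) = lf m1 x * lf m2 x * lf m3 x" "lf M1 e = 0" by blast
  have nzM: "lf M1 z \<noteq> 0" "lf P z \<noteq> 0" "lf Q z \<noteq> 0" using M1(2)[of z] nz by auto
  obtain k1 where k1: "\<And>x. x \<in> K \<Longrightarrow> lf n1 x = k1 * lf M1 x"
    using proportional_on_line[OF i K e(2,1) M1(3) e(3) z(1) nzM(1)] by blast
  have k10: "k1 \<noteq> 0" using k1[OF z(1)] nz by auto
  have h2: "hp 2 (\<lambda>x. c * (lf P x * lf Q x) - k1 * (lf n2 x * lf n3 x))"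
    using hp_diff[OF hp_cmult[OF hp_mult[OF hp_lf hp_lf]] hp_cmult[OF hp_mult[OF hp_lf hp_lf]], of c P Q k1 n2 n3]
    by (simp add: eval_nat_numeral)
  have "lf M1 x * (c * (lf P x * lf Q x) - k1 * (lf n2 x * lf n3 x)) = 0" if "x \<in> K" for x
    using prod[OF that] k1[OF that] M1(2)[of x] by (simp add: algebra_simps)
  then have "(\<forall>x\<in>K. lf M1 x = 0) \<or> (\<forall>x\<in>K. c * (lf P x * lf Q x) - k1 * (lf n2 x * lf n3 x) = 0)"
    by (rule hp_zero_product[OF hp_lf h2 sK])
  then have PQ: "c * (lf P x * lf Q x) = k1 * (lf n2 x * lf n3 x)" if "x \<in> K" for x
    using nzM(1) z(1) that by auto
  obtain e' where e': "e' \<noteq> 0" "e' \<in> K" "lf n2 e' = 0" using root_on_line[OF i] K by blast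
  have "lf P e' = 0 \<or> lf Q e' = 0" using PQ[OF e'(2)] e'(3) nz by simp
  then have "\<exists>M2 M3. {M2, M3} = {P, Q} \<and> (\<forall>x. lf M2 x * lf M3 x = lf P x * lf Q x) \<and> lf M2 e' = 0"
  proof (elim disjE)
    assume "lf P e' = 0"
    then show ?thesis by (intro exI[of _ P] exI[of _ Q]) simp
  next
    assume "lf Q e' = 0"
    then show ?thesis by (intro exI[of _ Q] exI[of _ P]) auto
  qed
  then obtain M2 M3 where M2: "{M2, M3} = {P, Q}" "\<And>x. lf M2 x * lf M3 x = lf P x * lf Q x" "lf M2 e' = 0" by blast
  have nzM2: "lf M2 z \<noteq> 0" "lf M3 z \<noteq> 0" using M2(2)[of z] nzM by auto
  obtain k2 where k2: "\<And>x. x \<in> K \<Longrightarrow> lf n2 x = k2 * lf M2 x"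
    using proportional_on_line[OF i K e'(2,1) M2(3) e'(3) z(1) nzM2(1)] by blast
  have k20: "k2 \<noteq> 0" using k2[OF z(1)] nz by auto
  have "lf M2 x * (lf (c *s M3 - (k1 * k2) *s n3) x) = 0" if "x \<in> K" for x
    using PQ[OF that] k2[OF that] M2(2)[of x] by (simp add: algebra_simps)
  then have "(\<forall>x\<in>K. lf M2 x = 0) \<or> (\<forall>x\<in>K. lf (c *s M3 - (k1 * k2) *s n3) x = 0)"
    by (rule hp_zero_product[OF hp_lf hp_lf sK])
  then have "lf (c *s M3 - (k1 * k2) *s n3) x = 0" if "x \<in> K" for x
    using nzM2(1) z(1) that by auto
  then have k3: "lf n3 x = (c / (k1 * k2)) * lf M3 x" if "x \<in> K" for x
    using that k10 k20 by (simp add: field_simps)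
  show ?thesis
  proof (rule that[OF _ _ k10 k20 _ k1 k2 k3])
    show "{M1, M2, M3} = {m1, m2, m3}" using M1(1) M2(1) by auto
    show "lf M1 x * lf M2 x * lf M3 x = lf m1 x * lf m2 x * lf m3 x" for x
      unfolding M1(2)[symmetric] M2(2)[symmetric] by (simp add: mult.assoc)
  qed (use k10 k20 nz in auto)
qed

text \<open>Once the linear factors on the common line are matched, a single form can restrict to
  the chosen factor on each of the two planes. The product of three such forms agrees with
  \<open>F\<close> on both planes, so the difference is divisible by \<open>h1\<close> and
  \<open>h2\<close>.\<close>

lemma trihedral_form_disjoint:
  assumes hpF: "hp 3 F" and i: "indep h1 h2"
    and F1: "\<And>x. F x = lf h1 x * g x + c * lf m1 x * lf m2 x * lf m3 x"
    and F2: "\<And>x. F x = lf h2 x * g' x + lf n1 x * lf n2 x * lf n3 x"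
    and z: "lf h1 z = 0" "lf h2 z = 0" "c * (lf m1 z * lf m2 z * lf m3 z) \<noteq> 0"
  obtains l3 M1 M2 M3 where "\<And>x. F x = lf h1 x * lf h2 x * lf l3 x - lf M1 x * lf M2 x * lf M3 x"
    "{pline h1 M1, pline h1 M2, pline h1 M3} = {pline h1 m1, pline h1 m2, pline h1 m3}"
    "pline h2 M1 = pline h2 n1" "pline h2 M2 = pline h2 n2"
proof -
  define K where "K = {x. lf h1 x = 0 \<and> lf h2 x = 0}"
  have zK: "z \<in> K" using z by (simp add: K_def)
  have pr: "c * (lf m1 x * lf m2 x * lf m3 x) = lf n1 x * lf n2 x * lf n3 x" if "x \<in> K" for x
    using F1[of x] F2[of x] that by (simp add: K_def mult.assoc)
  show ?thesis
  proof (rule match_factors[OF i K_def pr zK z(3)])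
  fix P1 P2 P3 k1 k2 k3 assume P: "{P1, P2, P3} = {m1, m2, m3}"
    "\<And>x. lf P1 x * lf P2 x * lf P3 x = lf m1 x * lf m2 x * lf m3 x" "k1 \<noteq> 0" "k2 \<noteq> 0" "k3 \<noteq> 0"
    "\<And>x. x \<in> K \<Longrightarrow> lf n1 x = k1 * lf P1 x" "\<And>x. x \<in> K \<Longrightarrow> lf n2 x = k2 * lf P2 x"
    "\<And>x. x \<in> K \<Longrightarrow> lf n3 x = k3 * lf P3 x" "c = k1 * k2 * k3"
  \<comment> \<open>The forms \<open>k *s Q\<close> and \<open>n\<close> agree where the planes
    meet, so they differ by a combination of \<open>h1\<close> and \<open>h2\<close>; its two terms
    are distributed to the two sides.\<close>
  have glue: "\<exists>M \<alpha> \<beta>. M = k *s Q + \<alpha> *s h1 \<and> M = n + \<beta> *s h2"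
    if "\<And>x. x \<in> K \<Longrightarrow> lf n x = k * lf Q x" for n Q k
  proof -
    have "lf (n - k *s Q) x = 0" if "lf h1 x = 0" "lf h2 x = 0" for x
      using that \<open>\<And>x. x \<in> K \<Longrightarrow> lf n x = k * lf Q x\<close> by (simp add: K_def)
    then obtain \<alpha> \<beta> where "n - k *s Q = \<alpha> *s h1 + \<beta> *s h2" using indep_kernel_span[OF i] by blast
    then have "k *s Q + \<alpha> *s h1 = n + (- \<beta>) *s h2" by (simp add: vec_eq_iff algebra_simps)
    then show ?thesis by blast
  qed
  obtain M1 \<alpha>1 \<beta>1 where M1: "M1 = k1 *s P1 + \<alpha>1 *s h1" "M1 = n1 + \<beta>1 *s h2" using glue[OF P(6)] by blast
  obtain M2 \<alpha>2 \<beta>2 where M2: "M2 = k2 *s P2 + \<alpha>2 *s h1" "M2 = n2 + \<beta>2 *s h2" using glue[OF P(7)] by blast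
  obtain M3 \<alpha>3 \<beta>3 where M3: "M3 = k3 *s P3 + \<alpha>3 *s h1" "M3 = n3 + \<beta>3 *s h2" using glue[OF P(8)] by blast
  have p3: "hp (1 + 1 + 1) (\<lambda>x. lf M1 x * lf M2 x * lf M3 x)" by (intro hp_mult hp_lf)
  have h3: "hp (Suc 2) (\<lambda>x. F x - lf M1 x * lf M2 x * lf M3 x)"
    using hp_diff[of 3 F "\<lambda>x. lf M1 x * lf M2 x * lf M3 x"] hpF p3 by (simp add: eval_nat_numeral)
  have v1: "F x - lf M1 x * lf M2 x * lf M3 x = 0" if "lf h1 x = 0" for x
  proof -
    have "F x = (k1 * k2 * k3) * (lf P1 x * lf P2 x * lf P3 x)" using that unfolding P(2) by (simp add: F1 P(9))
    then show ?thesis using that by (simp add: M1(1) M2(1) M3(1))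
  qed
  have v2: "F x - lf M1 x * lf M2 x * lf M3 x = 0" if "lf h2 x = 0" for x
    using that by (simp add: F2 M1(2) M2(2) M3(2))
  have h: "h1 \<noteq> 0" "h2 \<noteq> 0" using indep_nonzero[OF i] by auto
  obtain q where q: "hp 2 q" "\<And>x. F x - lf M1 x * lf M2 x * lf M3 x = lf h1 x * q x"
    using hp_divide_linear[OF h3 h(1) v1] by blast
  have q2: "hp (Suc 1) q" using q(1) by (simp add: eval_nat_numeral)
  have "\<exists>x. lf h2 x = 0 \<and> lf h1 x \<noteq> 0" using i unfolding indep_def by auto
  moreover have "lf h1 x * q x = 0" if "lf h2 x = 0" for x using v2[OF that] q(2) by simp
  ultimately obtain r where r: "hp 1 r" "\<And>x. q x = lf h2 x * r x"
    using hp_divide_plane[OF q2 hp_lf h(2)] by blast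
  obtain l3 where l3: "\<And>x. r x = lf l3 x" using hp_degree_1[OF r(1)] by auto
  \<comment> \<open>The sign goes into the first factor, which changes none of the lines.\<close>
  have "F x = lf h1 x * lf h2 x * lf l3 x - lf (- M1) x * lf M2 x * lf M3 x" for x
    using q(2)[of x] unfolding r(2) l3 by (simp add: algebra_simps)
  moreover have l1: "pline h1 (- M1) = pline h1 P1" "pline h1 M2 = pline h1 P2" "pline h1 M3 = pline h1 P3"
    using P(3-5) pline_scale[of "-1" h1 M1] by (simp_all add: M1(1) M2(1) M3(1) pline_add pline_scale)
  have "{pline h1 (- M1), pline h1 M2, pline h1 M3} = {pline h1 m1, pline h1 m2, pline h1 m3}"
  proof -
    have "{pline h1 (- M1), pline h1 M2, pline h1 M3} = pline h1 ` {P1, P2, P3}" by (simp add: l1)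
    then show ?thesis unfolding P(1) by simp
  qed
  moreover have "pline h2 (- M1) = pline h2 n1" "pline h2 M2 = pline h2 n2"
    using pline_scale[of "-1" h2 M1] by (simp_all add: M1(2) M2(2) pline_add)
  ultimately show ?thesis by (rule that)
  qed
qed

section \<open>The configuration of five lines\<close>

lemma line_in_plane_ex:
  "line_over UNIV L \<Longrightarrow> L \<subseteq> pplane h \<Longrightarrow> h \<noteq> 0 \<Longrightarrow> \<exists>m. indep h m \<and> L = pline h m"
  using line_in_plane by metis

lemma card_lines_in_plane:
  assumes ns: "nonsing (form 3 G)" and h: "h \<noteq> 0" and inj: "inj_on L I"
    and L: "\<And>i. i \<in> I \<Longrightarrow> line_over UNIV (L i) \<and> L i \<subseteq> zero_locus 3 G \<and> L i \<subseteq> pplane h"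
  shows "card I \<le> 3"
proof (rule ccontr)
  assume "\<not> card I \<le> 3"
  then obtain J where J: "J \<subseteq> I" "card J = 4" using obtain_subset_with_card_n[of 4 I] by auto
  then obtain i j k l where ijkl: "J = {i, j, k, l}" "i \<noteq> j" "i \<noteq> k" "i \<noteq> l" "j \<noteq> k" "j \<noteq> l" "k \<noteq> l"
    by (auto simp: eval_nat_numeral card_Suc_eq)
  have m: "\<exists>m. indep h m \<and> L i = pline h m" if "i \<in> J" for i
    by (rule line_in_plane_ex) (use L[of i] that J(1) h in auto)
  obtain m1 where m1: "indep h m1" "L i = pline h m1" using m[of i] ijkl by blast
  obtain m2 where m2: "indep h m2" "L j = pline h m2" using m[of j] ijkl by blast
  obtain m3 where m3: "indep h m3" "L k = pline h m3" using m[of k] ijkl by blast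
  obtain m4 where m4: "indep h m4" "L l = pline h m4" using m[of l] ijkl by blast
  have ne: "L x \<noteq> L y" if "x \<in> J" "y \<in> J" "x \<noteq> y" for x y
    using inj_onD[OF inj] that J(1) by blast
  have s: "L x \<subseteq> zero_locus 3 G" if "x \<in> J" for x using L that J(1) by blast
  show False
  proof (rule no_four_lines_in_plane[OF hp_form ns m1(1) m2(1) m3(1) m4(1)])
    show "pline h m1 \<noteq> pline h m2" "pline h m1 \<noteq> pline h m3" "pline h m2 \<noteq> pline h m3"
      "pline h m1 \<noteq> pline h m4" "pline h m2 \<noteq> pline h m4" "pline h m3 \<noteq> pline h m4"
      unfolding m1(2)[symmetric] m2(2)[symmetric] m3(2)[symmetric] m4(2)[symmetric]
      by (rule ne; use ijkl in simp)+
    show "form 3 G x = 0" if "lf h x = 0" "lf m1 x = 0" for x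
      using form_zero_on_line[OF _ that] s[of i] ijkl m1 by simp
    show "form 3 G x = 0" if "lf h x = 0" "lf m2 x = 0" for x
      using form_zero_on_line[OF _ that] s[of j] ijkl m2 by simp
    show "form 3 G x = 0" if "lf h x = 0" "lf m3 x = 0" for x
      using form_zero_on_line[OF _ that] s[of k] ijkl m3 by simp
    show "form 3 G x = 0" if "lf h x = 0" "lf m4 x = 0" for x
      using form_zero_on_line[OF _ that] s[of l] ijkl m4 by simp
  qed
qed

definition nine_lines_dense :: "point set \<Rightarrow> bool" where
  "nine_lines_dense Xt \<longleftrightarrow> (\<exists>L. (\<forall>i\<in>{1..9::nat}. line_over UNIV (L i) \<and> L i \<subseteq> Xt) \<and> inj_on L {1..9} \<and>
     dense_integral Xt (\<Union>i\<in>{1..9}. L i))"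

text \<open>Adding multiples of \<open>h1\<close> to \<open>m1\<close>, \<open>m2\<close> and of
  \<open>h2\<close> to \<open>n1\<close>, \<open>n2\<close> does not change the lines cut out in the
  planes. So these are the lines of \<open>dense_integral_five_lines\<close> for
  \<open>l1 = h1\<close> and \<open>m3 = - h2\<close>.\<close>

lemma dense_integral_shared:
  assumes ns: "nonsing (form 3 G)" and i: "indep h1 h2"
    and L: "indep h1 m1" "indep h1 m2" "indep h2 n1" "indep h2 n2"
      "pline h1 m1 \<subseteq> zero_locus 3 G" "pline h1 m2 \<subseteq> zero_locus 3 G" "pline h1 h2 \<subseteq> zero_locus 3 G"
      "pline h2 n1 \<subseteq> zero_locus 3 G" "pline h2 n2 \<subseteq> zero_locus 3 G"
    and ne: "pline h1 m1 \<noteq> pline h1 m2" "pline h1 m1 \<noteq> pline h1 h2" "pline h1 m2 \<noteq> pline h1 h2"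
      "pline h2 n1 \<noteq> pline h2 n2" "pline h2 n1 \<noteq> pline h1 h2" "pline h2 n2 \<noteq> pline h1 h2"
  shows "dense_integral (zero_locus 3 G) (pline h1 m1 \<union> pline h1 m2 \<union> pline h1 h2 \<union> pline h2 n1 \<union> pline h2 n2)
    \<and> nine_lines_dense (zero_locus 3 G)"
proof -
  note c = pline_commute[of h1 h2]
  note z = form_zero_on_line
  obtain g k where g: "hp 2 g" "k \<noteq> 0" "\<And>x. form 3 G x = lf h1 x * g x + k * lf m1 x * lf m2 x * lf h2 x"
    using three_lines_in_plane[OF hp_form ns L(1,2) i ne(1-3) z[OF L(5)] z[OF L(6)] z[OF L(7)]] by blast
  obtain g' k' where g': "hp 2 g'" "k' \<noteq> 0" "\<And>x. form 3 G x = lf h2 x * g' x + k' * lf n1 x * lf n2 x * lf h1 x"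
    using three_lines_in_plane[OF hp_form ns L(3,4) i[THEN indep_commute[THEN iffD1]] ne(4) ne(5,6)[unfolded c]
        z[OF L(8)] z[OF L(9)] z[OF L(7)[unfolded c]]] by blast
  have 1: "form 3 G x = lf h1 x * g x + lf (k *s m1) x * lf m2 x * lf h2 x"
    "form 3 G x = lf h2 x * g' x + lf (k' *s n1) x * lf n2 x * lf h1 x" for x
    unfolding lf_scale_left by (rule g(3) g'(3))+
  obtain a b c d where F: "\<And>x. form 3 G x = lf h1 x * lf (k' *s n1 + a *s h2) x * lf (n2 + b *s h2) x
    - lf (k *s m1 + c *s h1) x * lf (m2 + d *s h1) x * lf (- h2) x"
    using trihedral_form_shared[OF hp_form ns i g(1) 1] by blast
  have neg: "pline h (- h2) = pline h h2" for h using pline_scale[of "-1" h h2] by simp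
  have "dense_integral (zero_locus 3 G) (pline h1 m1 \<union> pline h1 m2 \<union> pline h1 h2 \<union> pline h2 n1 \<union> pline h2 n2)"
    using dense_integral_five_lines[OF ns F] g(2) g'(2)
    unfolding pline_commute[of "- h2"] neg by (simp add: pline_add pline_scale pline_commute[of _ h2] neg)
  moreover have "nine_lines_dense (zero_locus 3 G)"
    unfolding nine_lines_dense_def by (rule nine_lines[OF ns F]) blast
  ultimately show ?thesis ..
qed

text \<open>The matching of factors may permute the three lines in the first plane, so only their
  union is compared. The two lines in the second plane keep their order.\<close>

lemma dense_integral_disjoint:
  assumes ns: "nonsing (form 3 G)" and i: "indep h1 h2"
    and L: "indep h1 m1" "indep h1 m2" "indep h1 m3" "indep h2 n1" "indep h2 n2"
      "pline h1 m1 \<subseteq> zero_locus 3 G" "pline h1 m2 \<subseteq> zero_locus 3 G" "pline h1 m3 \<subseteq> zero_locus 3 G"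
      "pline h2 n1 \<subseteq> zero_locus 3 G" "pline h2 n2 \<subseteq> zero_locus 3 G"
    and ne: "pline h1 m1 \<noteq> pline h1 m2" "pline h1 m1 \<noteq> pline h1 m3" "pline h1 m2 \<noteq> pline h1 m3"
      "pline h2 n1 \<noteq> pline h2 n2" "pline h1 m1 \<noteq> pline h1 h2" "pline h1 m2 \<noteq> pline h1 h2" "pline h1 m3 \<noteq> pline h1 h2"
  shows "dense_integral (zero_locus 3 G) (pline h1 m1 \<union> pline h1 m2 \<union> pline h1 m3 \<union> pline h2 n1 \<union> pline h2 n2)
    \<and> nine_lines_dense (zero_locus 3 G)"
proof -
  note z = form_zero_on_line
  obtain g k where g: "hp 2 g" "k \<noteq> 0" "\<And>x. form 3 G x = lf h1 x * g x + k * lf m1 x * lf m2 x * lf m3 x"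
    using three_lines_in_plane[OF hp_form ns L(1-3) ne(1-3) z[OF L(6)] z[OF L(7)] z[OF L(8)]] by blast
  obtain g' n3 where g': "hp 2 g'" "\<And>x. form 3 G x = lf h2 x * g' x + lf n1 x * lf n2 x * lf n3 x"
    using two_lines_in_plane[OF hp_form L(4,5) ne(4) z[OF L(9)] z[OF L(10)]] by blast
  let ?K = "{x. lf h1 x = 0 \<and> lf h2 x = 0}"
  have nK: "\<not> (\<forall>x\<in>?K. lf m x = 0)" if "indep h1 m" "pline h1 m \<noteq> pline h1 h2" for m
    using pline_eqI[OF i that(1)] that(2) by blast
  \<comment> \<open>None of the three lines is the common line of the planes, so none of the three
    factors vanishes identically on it.\<close>
  have "\<exists>x\<in>?K. k * (lf m1 x * lf m2 x * lf m3 x) \<noteq> 0"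
  proof (rule ccontr)
    assume "\<not> ?thesis"
    then have "lf m1 x * (lf m2 x * lf m3 x) = 0" if "x \<in> ?K" for x using that g(2) by auto
    then have "(\<forall>x\<in>?K. lf m1 x = 0) \<or> (\<forall>x\<in>?K. lf m2 x * lf m3 x = 0)"
      by (rule hp_zero_product[OF hp_lf hp_mult[OF hp_lf hp_lf] subspace_kernel2])
    then have "(\<forall>x\<in>?K. lf m2 x = 0) \<or> (\<forall>x\<in>?K. lf m3 x = 0)"
      using hp_zero_product[OF hp_lf hp_lf subspace_kernel2, of h1 h2 m2 m3] nK[OF L(1) ne(5)] by blast
    then show False using nK[OF L(2) ne(6)] nK[OF L(3) ne(7)] by blast
  qed
  then obtain v where v: "lf h1 v = 0" "lf h2 v = 0" "k * (lf m1 v * lf m2 v * lf m3 v) \<noteq> 0" by blast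
  obtain l3 M1 M2 M3 where F: "\<And>x. form 3 G x = lf h1 x * lf h2 x * lf l3 x - lf M1 x * lf M2 x * lf M3 x"
    and M: "{pline h1 M1, pline h1 M2, pline h1 M3} = {pline h1 m1, pline h1 m2, pline h1 m3}"
    "pline h2 M1 = pline h2 n1" "pline h2 M2 = pline h2 n2"
    using trihedral_form_disjoint[OF hp_form i g(3) g'(2) v] by blast
  have "\<Union>{pline h1 M1, pline h1 M2, pline h1 M3} = \<Union>{pline h1 m1, pline h1 m2, pline h1 m3}" by (simp only: M)
  then have U: "pline h1 m1 \<union> pline h1 m2 \<union> pline h1 m3 = pline h1 M1 \<union> pline h1 M2 \<union> pline h1 M3" by auto
  show ?thesis
  proof (rule nine_lines[OF ns F])
    fix L :: "nat \<Rightarrow> point set"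
    assume A: "\<And>i. i \<in> {1..9} \<Longrightarrow> line_over UNIV (L i) \<and> L i \<subseteq> zero_locus 3 G" "inj_on L {1..9}"
      "dense_integral (zero_locus 3 G) (\<Union>i\<in>{1..9}. L i)"
      and B: "L 1 = pline h1 M1" "L 2 = pline h1 M2" "L 3 = pline h1 M3" "L 4 = pline h2 M1" "L 5 = pline h2 M2"
    have "L i \<subseteq> (\<Union>i\<in>{1..9}. L i)" if "i \<in> {1, 2, 3, 4, 5}" for i using that by (intro UN_upper) auto
    then have "L 1 \<union> L 2 \<union> L 3 \<union> L 4 \<union> L 5 \<subseteq> (\<Union>i\<in>{1..9}. L i)" by simp
    from dense_integral_mono[OF A(3) this]
    have "dense_integral (zero_locus 3 G) (pline h1 m1 \<union> pline h1 m2 \<union> pline h1 m3 \<union> pline h2 n1 \<union> pline h2 n2)"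
      unfolding U B M .
    moreover have "nine_lines_dense (zero_locus 3 G)" unfolding nine_lines_dense_def using A by blast
    ultimately show ?thesis ..
  qed
qed

text \<open>The two lines outside the first plane lie in the second. What remains to distinguish is
  whether one of the three lines also lies in the second plane and so is the common line.\<close>

lemma dense_integral_config_aux:
  fixes L :: "nat \<Rightarrow> point set"
  assumes ns: "nonsing (form 3 G)" and h: "h1 \<noteq> 0" "h2 \<noteq> 0" "pplane h1 \<noteq> pplane h2"
    and L: "\<And>i. i \<in> {1..5} \<Longrightarrow> line_over UNIV (L i) \<and> L i \<subseteq> zero_locus 3 G" "inj_on L {1..5}"
    and LH: "\<And>i. i \<in> {1..5} \<Longrightarrow> L i \<subseteq> pplane h1 \<or> L i \<subseteq> pplane h2"
    and c: "card {i \<in> {1..5}. L i \<subseteq> pplane h1} = 3"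
  shows "dense_integral (zero_locus 3 G) (\<Union>i\<in>{1..5}. L i) \<and> nine_lines_dense (zero_locus 3 G)"
proof -
  define I where "I = {i \<in> {1..5}. L i \<subseteq> pplane h1}"
  have i: "indep h1 h2"
  proof (rule indepI[OF h(1)])
    fix c show "h2 \<noteq> c *s h1"
    proof
      assume e: "h2 = c *s h1"
      then have "c \<noteq> 0" using h(2) by auto
      then show False using h(3) unfolding e pplane_def by simp
    qed
  qed
  have "card ({1..5} - I) = 2" using c by (subst card_Diff_subset) (auto simp: I_def)
  then obtain j1 j2 where J: "{1..5} - I = {j1, j2}" "j1 \<noteq> j2" by (meson card_2_iff)
  have p1: "\<exists>m. indep h1 m \<and> L i = pline h1 m" if "i \<in> I" for i
    by (rule line_in_plane_ex) (use L(1)[of i] that h(1) in \<open>auto simp: I_def\<close>)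
  have p2: "\<exists>m. indep h2 m \<and> L i = pline h2 m" if "i \<in> {1..5}" "L i \<subseteq> pplane h2" for i
    by (rule line_in_plane_ex[OF _ that(2) h(2)]) (use L(1)[OF that(1)] in simp)
  have j: "j1 \<in> {1..5}" "j2 \<in> {1..5}" "j1 \<notin> I" "j2 \<notin> I" using J(1) by blast+
  then have "L j1 \<subseteq> pplane h2" "L j2 \<subseteq> pplane h2" using LH unfolding I_def by blast+
  then obtain n1 n2 where n: "indep h2 n1" "L j1 = pline h2 n1" "indep h2 n2" "L j2 = pline h2 n2"
    using p2 j by metis
  have ne: "L x \<noteq> L y" if "x \<in> {1..5}" "y \<in> {1..5}" "x \<noteq> y" for x y
    using inj_onD[OF L(2)] that by blast
  have I5: "x \<in> {1..5}" if "x \<in> I" for x using that by (simp add: I_def)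
  have U: "(\<Union>i\<in>{1..5}. L i) = L a \<union> L b \<union> L c \<union> L j1 \<union> L j2" if "I = {a, b, c}" for a b c
  proof -
    have "{1..5} = {a, b, c} \<union> {j1, j2}" using J(1) that I5 by blast
    then show ?thesis by auto
  qed
  show ?thesis
  proof (cases "\<exists>i\<in>I. L i \<subseteq> pplane h2")
    case True
    then obtain i3 where i3: "i3 \<in> I" "L i3 \<subseteq> pplane h2" by blast
    have "card (I - {i3}) = 2" using c i3 unfolding I_def[symmetric] by simp
    then obtain i1 i2 where I': "I - {i3} = {i1, i2}" "i1 \<noteq> i2" by (meson card_2_iff)
    then have I3: "I = {i1, i2, i3}" "i1 \<noteq> i3" "i2 \<noteq> i3" using i3(1) by blast+
    obtain m1 m2 m3 where m: "indep h1 m1" "L i1 = pline h1 m1" "indep h1 m2" "L i2 = pline h1 m2"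
      "indep h1 m3" "L i3 = pline h1 m3" using p1 I3 by (metis insertCI)
    have "lf h2 x = 0" if "lf h1 x = 0" "lf m3 x = 0" for x
    proof (cases "x = 0")
      case False
      then have "proj_point x \<in> L i3" using that m by simp
      then show ?thesis using i3(2) False by (metis proj_point_in_pplane subsetD)
    qed simp
    then have 3: "L i3 = pline h1 h2" using pline_eqI[OF m(5) i] m(6) by simp
    have i5: "i1 \<in> {1..5}" "i2 \<in> {1..5}" "i3 \<in> {1..5}" using I5 I3(1) by auto
    have ji: "j1 \<noteq> i3" "j2 \<noteq> i3" using j i3 by auto
    show ?thesis unfolding U[OF I3(1)] m(2,4) 3 n(2,4)
      using dense_integral_shared[OF ns i m(1,3) n(1,3)] L(1)[OF i5(1)] L(1)[OF i5(2)] L(1)[OF i5(3)] L(1)[OF j(1)] L(1)[OF j(2)]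
        ne[OF i5(1,2) I'(2)] ne[OF i5(1,3) I3(2)] ne[OF i5(2,3) I3(3)] ne[OF j(1,2) J(2)] ne[OF j(1) i5(3) ji(1)] ne[OF j(2) i5(3) ji(2)]
      unfolding m(2,4) 3 n(2,4) by blast
  next
    case False
    obtain i1 i2 i3 where I3: "I = {i1, i2, i3}" "i1 \<noteq> i2" "i1 \<noteq> i3" "i2 \<noteq> i3"
      using c unfolding I_def[symmetric] card_3_iff by blast
    obtain m1 m2 m3 where m: "indep h1 m1" "L i1 = pline h1 m1" "indep h1 m2" "L i2 = pline h1 m2"
      "indep h1 m3" "L i3 = pline h1 m3" using p1 I3 by (metis insertCI)
    have n12: "L x \<noteq> pline h1 h2" if "x \<in> I" for x
    proof
      assume "L x = pline h1 h2"
      then have "L x \<subseteq> pplane h2" unfolding pline_def pplane_def by blast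
      then show False using False that by blast
    qed
    have i5: "i1 \<in> {1..5}" "i2 \<in> {1..5}" "i3 \<in> {1..5}" using I5 I3(1) by auto
    have iI: "i1 \<in> I" "i2 \<in> I" "i3 \<in> I" using I3 by auto
    show ?thesis unfolding U[OF I3(1)] m(2,4,6) n(2,4)
      using dense_integral_disjoint[OF ns i m(1,3,5) n(1,3)] L(1)[OF i5(1)] L(1)[OF i5(2)] L(1)[OF i5(3)] L(1)[OF j(1)] L(1)[OF j(2)]
        ne[OF i5(1,2) I3(2)] ne[OF i5(1,3) I3(3)] ne[OF i5(2,3) I3(4)] ne[OF j(1,2) J(2)]
        n12[OF iI(1)] n12[OF iI(2)] n12[OF iI(3)]
      unfolding m(2,4,6) n(2,4) by blast
  qed
qed

text \<open>Neither plane contains more than three of the five lines, so one of them contains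
  exactly three.\<close>

lemma dense_integral_config:
  fixes L :: "nat \<Rightarrow> point set"
  assumes ns: "nonsing (form 3 G)" and h: "h1 \<noteq> 0" "h2 \<noteq> 0" "pplane h1 \<noteq> pplane h2"
    and L: "\<And>i. i \<in> {1..5} \<Longrightarrow> line_over UNIV (L i) \<and> L i \<subseteq> zero_locus 3 G" "inj_on L {1..5}"
    and LH: "\<And>i. i \<in> {1..5} \<Longrightarrow> L i \<subseteq> pplane h1 \<or> L i \<subseteq> pplane h2"
  shows "dense_integral (zero_locus 3 G) (\<Union>i\<in>{1..5}. L i) \<and> nine_lines_dense (zero_locus 3 G)"
proof -
  define I where "I = (\<lambda>h. {i \<in> {1..5}. L i \<subseteq> pplane h})"
  have sub: "I h \<subseteq> {1..5}" for h by (auto simp: I_def)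
  have le: "card (I h) \<le> 3" if "h \<noteq> 0" for h
    by (rule card_lines_in_plane[OF ns that inj_on_subset[OF L(2) sub]]) (use L(1) in \<open>auto simp: I_def\<close>)
  have "{1..5} = I h1 \<union> I h2" using LH unfolding I_def by blast
  then have "5 \<le> card (I h1) + card (I h2)" using card_Un_le[of "I h1" "I h2"] by (metis card_atLeastAtMost diff_Suc_1 numeral_eq_Suc Suc_eq_plus1 add_diff_cancel_right')
  then have "card (I h1) = 3 \<or> card (I h2) = 3" using le[OF h(1)] le[OF h(2)] by linarith
  then show ?thesis
  proof
    assume "card (I h1) = 3"
    then show ?thesis using dense_integral_config_aux[OF ns h L LH] unfolding I_def by blast
  next
    assume "card (I h2) = 3"
    then show ?thesis using dense_integral_config_aux[OF ns h(2,1) h(3)[symmetric] L] LH unfolding I_def by blast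
  qed
qed

section \<open>Number fields\<close>

lemma qbar_ring_simps:
  "carrier qbar_ring = UNIV" "\<zero>\<^bsub>qbar_ring\<^esub> = 0" "\<one>\<^bsub>qbar_ring\<^esub> = 1"
  "x \<oplus>\<^bsub>qbar_ring\<^esub> y = x + y" "x \<otimes>\<^bsub>qbar_ring\<^esub> y = x * y"
  by (simp_all add: ring_of_type_algebra_def)

lemma field_qbar: "Ring.field qbar_ring"
  by (rule field_from_type_algebra)

lemma qbar_pow: "x [^]\<^bsub>qbar_ring\<^esub> (n :: nat) = x ^ n"
proof -
  interpret field qbar_ring by (rule field_qbar)
  show ?thesis by (induction n) (simp_all add: nat_pow_Suc qbar_ring_simps)
qed

lemma qbar_algebraic: "algebraic (x :: qbar)"
proof -
  obtain p :: "rat poly" where p: "p \<noteq> 0" "poly (map_poly to_ac p) x = 0"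
    by (rule alg_closure_algebraic)
  have "to_ac q \<in> \<rat>" for q :: rat
  proof -
    obtain a b where "quotient_of q = (a, b)" by fastforce
    then have "q = of_int a / of_int b" by (rule quotient_of_div)
    then show ?thesis by (simp add: Rats_divide)
  qed
  then show ?thesis
    using p by (intro algebraicI'[of "map_poly to_ac p"]) (auto simp: coeff_map_poly map_poly_eq_0_iff)
qed

lemma poly_Poly_snoc:
  fixes x :: "'a::comm_ring_1"
  shows "poly (Poly (cs @ [c])) x = poly (Poly cs) x + c * x ^ length cs"
  by (induction cs) (simp_all add: algebra_simps)

text \<open>\<open>ring.eval\<close> takes coefficients from the highest degree down,
  \<open>Poly\<close> from the lowest up.\<close>

lemma eval_rev_coeffs: "ring.eval qbar_ring (rev cs) x = poly (Poly cs) x"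
proof -
  interpret field qbar_ring by (rule field_qbar)
  show ?thesis
    by (induction cs rule: rev_induct)
       (simp_all add: qbar_ring_simps qbar_pow poly_Poly_snoc mult.commute add.commute)
qed

lemma ring_algebraic:
  assumes "subfield K qbar_ring" "\<rat> \<subseteq> K"
  shows "(ring.algebraic qbar_ring over K) x"
proof -
  interpret field qbar_ring by (rule field_qbar)
  obtain p where p: "\<And>i. Polynomial.coeff p i \<in> \<int>" "p \<noteq> 0" "poly p x = 0"
    using Polynomial.algebraicE[OF qbar_algebraic] by blast
  have "set (coeffs p) \<subseteq> K" using p(1) assms(2) Ints_subset_Rats by (auto simp: coeffs_def)
  moreover have "last (coeffs p) \<noteq> 0" using p(2) by (simp add: last_coeffs_eq_coeff_degree)
  ultimately have "polynomial\<^bsub>qbar_ring\<^esub> K (rev (coeffs p))"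
    using p(2) by (simp add: polynomial_def qbar_ring_simps hd_rev)
  then have "rev (coeffs p) \<in> carrier (K[X]\<^bsub>qbar_ring\<^esub>)" using univ_poly_carrier by blast
  moreover have "rev (coeffs p) \<noteq> []" using p(2) by simp
  moreover have "eval (rev (coeffs p)) x = \<zero>\<^bsub>qbar_ring\<^esub>" using p(3) by (simp add: eval_rev_coeffs qbar_ring_simps)
  ultimately show ?thesis by (rule algebraicI)
qed

lemma finite_extension_adjoin:
  assumes "number_field k" "finite E"
  obtains k' where "finite_extension k k'" "E \<subseteq> k'"
proof -
  interpret field qbar_ring by (rule field_qbar)
  have k: "subfield k qbar_ring" "\<rat> \<subseteq> k"
    using assms(1) by (auto simp: number_field_def Defs.finite_extension_def)
  obtain xs where xs: "set xs = E" using assms(2) finite_list by blast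
  define k' where "k' = ring.finite_extension qbar_ring k xs"
  have c: "set xs \<subseteq> carrier qbar_ring" by (simp add: qbar_ring_simps)
  have a: "(algebraic over k) x" for x by (rule ring_algebraic[OF k])
  have "subfield k' qbar_ring" unfolding k'_def by (rule finite_extension_is_subfield[OF k(1) c a])
  moreover have "ring.finite_dimension qbar_ring k k'"
    unfolding k'_def by (rule finite_extension_finite_dimension(1)[OF k(1) c a])
  moreover have "k \<subseteq> k'" unfolding k'_def using finite_extension_incl[OF _ c, of k] by (simp add: qbar_ring_simps)
  moreover have "E \<subseteq> k'" unfolding k'_def xs[symmetric] by (rule finite_extension_mem[OF subfieldE(1)[OF k(1)] c])
  ultimately show ?thesis using that k(1) by (auto simp: Defs.finite_extension_def)
qed

lemma number_field_trans:
  assumes "number_field k" "finite_extension k k'"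
  shows "number_field k'"
proof -
  interpret field qbar_ring by (rule field_qbar)
  have 1: "subfield \<rat> qbar_ring" "subfield k qbar_ring" "\<rat> \<subseteq> k" "finite_dimension \<rat> k"
    using assms(1) by (auto simp: number_field_def Defs.finite_extension_def)
  have 2: "subfield k' qbar_ring" "k \<subseteq> k'" "finite_dimension k k'"
    using assms(2) by (auto simp: Defs.finite_extension_def)
  obtain n m where "dimension n \<rat> k" "dimension m k k'" using 1(4) 2(3) by (auto simp: finite_dimension_def)
  then have "dimension (n * m) \<rat> k'" by (rule telescopic_base[OF 1(1) 1(2)])
  then have "finite_dimension \<rat> k'" by (rule finite_dimensionI)
  then show ?thesis using 1 2 by (auto simp: number_field_def Defs.finite_extension_def)
qed

lemma combine_sum_list: "length Ks = length Us \<Longrightarrow> ring.combine qbar_ring Ks Us = (\<Sum>i<length Us. Ks ! i * Us ! i)"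
proof -
  interpret field qbar_ring by (rule field_qbar)
  show "length Ks = length Us \<Longrightarrow> ?thesis"
  proof (induction Ks Us rule: list_induct2)
    case (Cons k Ks u Us)
    then show ?case by (simp add: qbar_ring_simps sum.lessThan_Suc_shift del: sum.lessThan_Suc)
  qed (simp add: qbar_ring_simps)
qed

text \<open>The bound \<open>n\<close> is the degree of \<open>K\<close> over the rationals. The
  family is indexed by \<open>V\<close>, so \<open>z\<close> may take a value more than
  once.\<close>

lemma number_field_dependent:
  assumes "number_field K"
  obtains n where "\<And>V z. finite V \<Longrightarrow> card V > n \<Longrightarrow> (\<And>v. v \<in> V \<Longrightarrow> z v \<in> K) \<Longrightarrow>
    \<exists>c :: 'v \<Rightarrow> qbar. (\<forall>v\<in>V. c v \<in> \<rat>) \<and> (\<exists>v\<in>V. c v \<noteq> 0) \<and> (\<Sum>v\<in>V. c v * z v) = 0"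
proof -
  interpret field qbar_ring by (rule field_qbar)
  have K: "subfield \<rat> qbar_ring" "subfield K qbar_ring" "\<rat> \<subseteq> K" "finite_dimension \<rat> K"
    using assms by (auto simp: number_field_def Defs.finite_extension_def)
  obtain n where n: "dimension n \<rat> K" using K(4) by (auto simp: finite_dimension_def)
  show ?thesis
  proof (rule that[of n])
    fix V :: "'v set" and z assume V: "finite V" "card V > n" "\<And>v. v \<in> V \<Longrightarrow> z v \<in> K"
    obtain vs where vs: "set vs = V" "distinct vs" using V(1) finite_distinct_list by blast
    have len: "length vs = card V" using vs distinct_card by metis
    define Us where "Us = map z vs"
    have dep: "\<not> independent \<rat> Us"
    proof
      assume "independent \<rat> Us"
      moreover have "set Us \<subseteq> K" using V(3) vs by (auto simp: Us_def)
      ultimately have "length Us \<le> n" using independent_length_le_dimension[OF K(1) n] by blast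
      then show False using V(2) len by (simp add: Us_def)
    qed
    have c: "set Us \<subseteq> carrier qbar_ring" by (simp add: qbar_ring_simps)
    obtain Ks where Ks: "length Ks = length Us" "combine Ks Us = \<zero>\<^bsub>qbar_ring\<^esub>" "set Ks \<subseteq> \<rat>"
      "set Ks \<noteq> {\<zero>\<^bsub>qbar_ring\<^esub>}"
      using dependent_imp_non_trivial_combine[OF K(1) c dep] by blast
    have s: "(\<Sum>i<length vs. Ks ! i * z (vs ! i)) = 0"
      using Ks(2) combine_sum_list[OF Ks(1)] by (simp add: Us_def qbar_ring_simps)
    have lK: "length Ks = length vs" using Ks(1) by (simp add: Us_def)
    have "Ks \<noteq> []" using lK len V(2) by auto
    then have "\<exists>x\<in>set Ks. x \<noteq> 0" using Ks(4) by (cases Ks) (auto simp: qbar_ring_simps)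
    then obtain j where j: "j < length vs" "Ks ! j \<noteq> 0" using lK by (auto simp: in_set_conv_nth)
    define ix where "ix = the_inv_into {..<length vs} ((!) vs)"
    have b: "bij_betw ((!) vs) {..<length vs} V" using vs bij_betw_nth[of vs] by simp
    have ix: "ix (vs ! i) = i" if "i < length vs" for i
      unfolding ix_def using that b by (intro the_inv_into_f_f) (auto simp: bij_betw_def)
    have "(\<Sum>v\<in>V. Ks ! ix v * z v) = (\<Sum>i<length vs. Ks ! ix (vs ! i) * z (vs ! i))"
      by (rule sum.reindex_bij_betw[OF b, symmetric])
    also have "\<dots> = (\<Sum>i<length vs. Ks ! i * z (vs ! i))" using ix by (intro sum.cong) auto
    finally have "(\<Sum>v\<in>V. Ks ! ix v * z v) = 0" using s by simp
    moreover have "Ks ! ix v \<in> \<rat>" if v: "v \<in> V" for v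
    proof -
      obtain i where i: "i < length vs" "v = vs ! i" using v vs(1) by (auto simp: in_set_conv_nth)
      have "Ks ! i \<in> set Ks" using i(1) lK by simp
      then show ?thesis using ix[OF i(1)] i(2) Ks(3) by auto
    qed
    moreover have "Ks ! ix (vs ! j) \<noteq> 0" "vs ! j \<in> V" using j ix vs by auto
    ultimately show "\<exists>c. (\<forall>v\<in>V. c v \<in> \<rat>) \<and> (\<exists>v\<in>V. c v \<noteq> 0) \<and> (\<Sum>v\<in>V. c v * z v) = 0"
      by (intro exI[of _ "\<lambda>v. Ks ! ix v"]) blast
  qed
qed

section \<open>Absolute values on number fields\<close>

text \<open>Exponential growth beats linear growth. This removes bounded or linear factors from an
  estimate that is applied to all powers.\<close>

lemma power_le_linear_imp_le_1:
  fixes r a b :: real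
  assumes "\<And>n. r ^ n \<le> a * real n + b" "r \<ge> 0"
  shows "r \<le> 1"
proof (rule ccontr)
  assume "\<not> r \<le> 1"
  then have r: "norm (1 / r) < 1" by simp
  have "(\<lambda>n. a * (real n * (1 / r) ^ n) + b * (1 / r) ^ n) \<longlonglongrightarrow> a * 0 + b * 0"
    by (intro tendsto_intros powser_times_n_limit_0 LIMSEQ_power_zero r)
  moreover have "1 \<le> a * (real n * (1 / r) ^ n) + b * (1 / r) ^ n" for n
  proof -
    have "r ^ n > 0" using \<open>\<not> r \<le> 1\<close> by simp
    then have "1 \<le> (a * real n + b) / r ^ n" using assms(1)[of n] by simp
    then show ?thesis by (simp add: power_one_over add_divide_distrib)
  qed
  ultimately have "1 \<le> a * 0 + b * 0" by (intro LIMSEQ_le_const) auto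
  then show False by simp
qed

section \<open>Growth of an absolute value on the integers\<close>

locale abs_value =
  fixes K :: "qbar set" and v :: "qbar \<Rightarrow> real"
  assumes K: "subfield K qbar_ring" and av: "absolute_value K v"
begin

lemmas K_closed = subfield_closed[OF K]

lemma Rats_K: "x \<in> \<rat> \<Longrightarrow> x \<in> K"
proof -
  assume "x \<in> \<rat>"
  then obtain q :: rat where x: "x = of_rat q" by (auto simp: Rats_def)
  obtain a b where "quotient_of q = (a, b)" by fastforce
  then have "q = of_int a / of_int b" by (rule quotient_of_div)
  then have "x = of_int a / of_int b" by (simp add: x of_rat_divide)
  moreover have "of_int a \<in> K" for a
    by (cases a rule: int_cases2) (auto intro!: K_closed)
  ultimately show ?thesis by (auto intro!: K_closed)
qed

lemma of_int_K: "of_int a \<in> K"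
  by (rule Rats_K) simp

lemma ge_0: "x \<in> K \<Longrightarrow> 0 \<le> v x"
  and eq_0: "x \<in> K \<Longrightarrow> v x = 0 \<longleftrightarrow> x = 0"
  and mult: "x \<in> K \<Longrightarrow> y \<in> K \<Longrightarrow> v (x * y) = v x * v y"
  and add: "x \<in> K \<Longrightarrow> y \<in> K \<Longrightarrow> v (x + y) \<le> v x + v y"
  using av unfolding absolute_value_def by auto

lemma pos: "x \<in> K \<Longrightarrow> x \<noteq> 0 \<Longrightarrow> 0 < v x"
  using ge_0[of x] eq_0[of x] by linarith

lemma zero: "v 0 = 0"
  using eq_0[of 0] K_closed by simp

lemma one: "v 1 = 1"
  using mult[of 1 1] eq_0[of 1] K_closed by simp

lemma minus: "x \<in> K \<Longrightarrow> v (- x) = v x"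
proof -
  assume x: "x \<in> K"
  have m: "- 1 \<in> K" by (intro K_closed)
  have "v (-1) * v (-1) = 1" using mult[OF m m] one by simp
  then have "v (-1) = 1" using ge_0[OF m] by (metis abs_of_nonneg abs_square_eq_1 power2_eq_square)
  then show ?thesis using mult[OF m x] by simp
qed

lemma power: "x \<in> K \<Longrightarrow> v (x ^ n) = v x ^ n"
  by (induction n) (simp_all add: one mult K_closed)

lemma inverse: "x \<in> K \<Longrightarrow> v (inverse x) = inverse (v x)"
proof (cases "x = 0")
  case False
  assume x: "x \<in> K"
  have "v x * v (inverse x) = 1" using mult[OF x K_closed(7)[OF x]] False one by simp
  then show ?thesis by (metis inverse_unique)
qed (simp add: zero)

lemma divide: "x \<in> K \<Longrightarrow> y \<in> K \<Longrightarrow> v (x / y) = v x / v y"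
  by (simp add: divide_inverse mult inverse K_closed)

lemma sum: "(\<And>i. i \<in> A \<Longrightarrow> f i \<in> K) \<Longrightarrow> sum f A \<in> K \<and> v (sum f A) \<le> (\<Sum>i\<in>A. v (f i))"
proof (induction A rule: infinite_finite_induct)
  case (insert x A)
  then have "f x \<in> K" "sum f A \<in> K" "v (sum f A) \<le> (\<Sum>i\<in>A. v (f i))" by auto
  then show ?case using insert add[of "f x" "sum f A"] by (auto intro: K_closed)
qed (auto simp: zero K_closed)

lemma of_nat_le: "v (of_nat n) \<le> of_nat n"
proof (induction n)
  case (Suc n)
  have "v (of_nat n + 1) \<le> v (of_nat n) + v 1" by (intro add K_closed)
  then show ?case using Suc by (simp add: one add.commute)
qed (simp add: zero)

lemma of_int_nat: "v (of_int a) = v (of_nat (nat \<bar>a\<bar>))"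
proof (cases "a \<ge> 0")
  case False
  then have "of_int a = - (of_nat (nat \<bar>a\<bar>) :: qbar)" by simp
  then show ?thesis using minus K_closed by metis
qed simp

text \<open>The binomial expansion bounds \<open>v (x + y) ^ n\<close> by
  \<open>(n + 1) * M ^ n\<close>, and the linear factor disappears in the limit.\<close>

lemma ultrametric_add:
  assumes "\<And>n. v (of_nat n) \<le> 1" and x: "x \<in> K" and y: "y \<in> K"
  shows "v (x + y) \<le> max (v x) (v y)"
proof (cases "max (v x) (v y) = 0")
  case True
  then have "v x = 0" "v y = 0" using ge_0[OF x] ge_0[OF y] by linarith+
  then show ?thesis using x y eq_0 zero by auto
next
  case False
  define M where "M = max (v x) (v y)"
  have M: "M > 0" "v x \<le> M" "v y \<le> M" using False ge_0[OF x] ge_0[OF y] by (auto simp: M_def)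
  have xy: "x + y \<in> K" using x y by (intro K_closed)
  have "v (x + y) ^ n \<le> (real n + 1) * M ^ n" for n
  proof -
    have "v (x + y) ^ n = v (\<Sum>k\<le>n. of_nat (n choose k) * x ^ k * y ^ (n - k))"
      by (simp only: power[OF xy, symmetric] binomial_ring)
    also have "\<dots> \<le> (\<Sum>k\<le>n. v (of_nat (n choose k) * x ^ k * y ^ (n - k)))"
      using sum[of "{..n}" "\<lambda>k. of_nat (n choose k) * x ^ k * y ^ (n - k)"] x y by (auto intro!: K_closed)
    also have "\<dots> \<le> (\<Sum>k\<le>n. M ^ n)"
    proof (rule sum_mono)
      fix k assume k: "k \<in> {..n}"
      have "v (of_nat (n choose k) * x ^ k * y ^ (n - k)) = v (of_nat (n choose k)) * (v x ^ k * v y ^ (n - k))"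
        using x y by (simp add: mult power K_closed)
      also have "\<dots> \<le> 1 * (M ^ k * M ^ (n - k))"
        using assms(1) M ge_0 x y by (intro mult_mono power_mono) auto
      finally show "v (of_nat (n choose k) * x ^ k * y ^ (n - k)) \<le> M ^ n"
        using k by (simp add: power_add[symmetric])
    qed
    also have "\<dots> = (real n + 1) * M ^ n" by simp
    finally show ?thesis .
  qed
  then have "(v (x + y) / M) ^ n \<le> 1 * real n + 1" for n
    using M by (simp add: power_divide divide_le_eq)
  then have "v (x + y) / M \<le> 1" using power_le_linear_imp_le_1 ge_0[OF xy] M by (metis divide_nonneg_pos)
  then show ?thesis using M by (simp add: M_def)
qed

text \<open>In base \<open>m\<close> the number \<open>N\<close> has at most \<open>L + 1\<close>
  digits, and \<open>v\<close> of each digit is at most \<open>m\<close>.\<close>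

lemma power_bound:
  assumes "m \<ge> 2" "N < m ^ Suc L"
  shows "v (of_nat N) \<le> m * (real L + 1) * max 1 (v (of_nat m)) ^ L"
  using assms(2)
proof (induction L arbitrary: N)
  case 0
  then show ?case using of_nat_le[of N] by simp
next
  case (Suc L)
  define M where "M = max 1 (v (of_nat m))"
  have M: "M \<ge> 1" "v (of_nat m) \<le> M" by (auto simp: M_def)
  have q: "N div m < m ^ Suc L" using Suc.prems assms(1) by (simp add: div_less_iff_less_mult mult.commute)
  have "N mod m \<le> m" using assms(1) by (simp add: less_imp_le)
  have "v (of_nat N) = v (of_nat (N div m) * of_nat m + of_nat (N mod m))"
    by (simp only: of_nat_mult[symmetric] of_nat_add[symmetric] div_mult_mod_eq)
  also have "\<dots> \<le> v (of_nat (N div m) * of_nat m) + v (of_nat (N mod m))"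
    by (intro add K_closed)
  also have "\<dots> = v (of_nat (N div m)) * v (of_nat m) + v (of_nat (N mod m))"
    by (simp add: mult K_closed)
  also have "\<dots> \<le> (m * (real L + 1) * M ^ L) * M + m * M ^ Suc L"
  proof (rule add_mono)
    show "v (of_nat (N div m)) * v (of_nat m) \<le> (m * (real L + 1) * M ^ L) * M"
      using Suc.IH[OF q] M ge_0 K_closed by (intro mult_mono) (auto simp: M_def)
    have "v (of_nat (N mod m)) \<le> m" using of_nat_le[of "N mod m"] \<open>N mod m \<le> m\<close>
      by (meson of_nat_le_iff order_trans)
    also have "real m \<le> m * M ^ Suc L" using M one_le_power[of M "Suc L"] by (simp add: mult_le_cancel_left1)
    finally show "v (of_nat (N mod m)) \<le> m * M ^ Suc L" .
  qed
  also have "\<dots> = m * (real (Suc L) + 1) * M ^ Suc L" by (simp add: algebra_simps)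
  finally show ?case by (simp add: M_def)
qed

text \<open>Ostrowski's argument: \<open>power_bound\<close> is applied to \<open>n ^ k\<close> in
  base \<open>m\<close>, where \<open>L\<close> is the integer part of
  \<open>k * ln n / ln m\<close>; the factor linear in \<open>k\<close> is then removed.\<close>

lemma ostrowski_bound:
  assumes "m \<ge> 2" "n \<ge> 2"
  shows "v (of_nat n) \<le> max 1 (v (of_nat m)) powr (ln n / ln m)"
proof -
  define M where "M = max 1 (v (of_nat m))"
  define t where "t = ln n / ln m"
  have lm: "ln (real m) > 0" "ln (real n) > 0" using assms by auto
  have lam: "t > 0" using lm by (simp add: t_def)
  have M: "M \<ge> 1" by (simp add: M_def)
  have "v (of_nat n) ^ k \<le> m * (t * k + 1) * (M powr t) ^ k" for k
  proof -
    define L where "L = nat \<lfloor>t * k\<rfloor>"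
    have L: "real L \<le> t * k" "t * k < real L + 1" using lam by (auto simp: L_def)
    have "ln (real (n ^ k)) = t * k * ln m" using assms lm by (simp add: ln_realpow t_def)
    also have "\<dots> < (real L + 1) * ln m" using L(2) lm by simp
    also have "\<dots> = ln (real (m ^ Suc L))" using assms by (simp add: ln_realpow algebra_simps ln_mult)
    finally have "real (n ^ k) < real (m ^ Suc L)" using assms by (subst (asm) ln_less_cancel_iff) auto
    then have "n ^ k < m ^ Suc L" by (simp only: of_nat_less_iff)
    from power_bound[OF assms(1) this]
    have "v (of_nat n) ^ k \<le> m * (real L + 1) * M ^ L"
      using power[OF K_closed(9)[of n], of k] by (simp add: M_def)
    also have "M ^ L \<le> (M powr t) ^ k"
    proof -
      have "M ^ L = M powr real L" using M by (simp add: powr_realpow)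
      also have "\<dots> \<le> M powr (t * k)" using M L(1) by (intro powr_mono) auto
      also have "\<dots> = (M powr t) ^ k" using M by (simp add: powr_powr[symmetric] powr_realpow)
      finally show ?thesis .
    qed
    then have "m * (real L + 1) * M ^ L \<le> m * (t * k + 1) * (M powr t) ^ k"
      using L(1) M lam by (intro mult_mono) auto
    finally show ?thesis .
  qed
  then have "(v (of_nat n) / M powr t) ^ k \<le> (m * t) * real k + m" for k
    using M by (simp add: power_divide divide_le_eq algebra_simps)
  then have "v (of_nat n) / M powr t \<le> 1"
    using power_le_linear_imp_le_1 ge_0[OF K_closed(9)] M by (metis divide_nonneg_nonneg powr_ge_zero)
  moreover have "M powr t > 0" using M by simp
  ultimately have "v (of_nat n) \<le> M powr t" by (simp add: pos_divide_le_eq)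
  then show ?thesis unfolding M_def t_def .
qed

text \<open>By \<open>ostrowski_bound\<close> one natural number of value above 1 forces this for
  all \<open>m \<ge> 2\<close>, and an exponent \<open>ln m / ln n\<close> below 1 then gives strict
  growth.\<close>

lemma archimedean_mono:
  assumes "v (of_nat n0) > 1"
  shows "v (of_nat m) \<le> v (of_nat n) \<longleftrightarrow> m \<le> n"
proof -
  have n0: "n0 \<ge> 2" using assms zero one by (cases n0; cases "n0 - 1") auto
  have gt1: "v (of_nat m) > 1" if m: "m \<ge> 2" for m
  proof (rule ccontr)
    assume "\<not> v (of_nat m) > 1"
    then have "max 1 (v (of_nat m)) = 1" by simp
    then show False using ostrowski_bound[OF m n0] assms by simp
  qed
  have less: "v (of_nat m) < v (of_nat n)" if "m < n" for m n
  proof (cases "m \<ge> 2")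
    case True
    then have n: "n \<ge> 2" using that by simp
    have "v (of_nat m) \<le> max 1 (v (of_nat n)) powr (ln m / ln n)" by (rule ostrowski_bound[OF n True])
    also have "max 1 (v (of_nat n)) = v (of_nat n)" using gt1[OF n] by simp
    also have "v (of_nat n) powr (ln m / ln n) < v (of_nat n) powr 1"
      using gt1[OF n] True that n by (intro powr_less_mono) auto
    also have "\<dots> = v (of_nat n)" using gt1[OF n] by simp
    finally show ?thesis .
  next
    case False
    then have "m = 0 \<or> m = 1" by auto
    then show ?thesis
    proof
      assume "m = 0" then show ?thesis using that pos[OF K_closed(9)[of n]] by (simp add: zero)
    next
      assume "m = 1" then show ?thesis using that gt1[of n] by (simp add: one)
    qed
  qed
  show ?thesis using less[of m n] less[of n m] by (metis leD leI le_less nat_less_le)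
qed

text \<open>The right side does not mention \<open>v\<close>: all archimedean absolute values have
  the same unit ball on the rationals.\<close>

lemma archimedean_unit_ball:
  assumes "v (of_nat n0) > 1"
  shows "{c \<in> \<rat>. v c \<le> 1} = {of_int a / of_int b | a b. b \<noteq> 0 \<and> \<bar>a\<bar> \<le> \<bar>b\<bar>}"
proof -
  have *: "v (of_int a / of_int b) \<le> 1 \<longleftrightarrow> \<bar>a\<bar> \<le> \<bar>b\<bar>" if "b \<noteq> 0" for a b
  proof -
    have "v (of_int b) > 0" using that by (intro pos of_int_K) simp
    then have "v (of_int a / of_int b) \<le> 1 \<longleftrightarrow> v (of_int a) \<le> v (of_int b)"
      by (simp add: divide of_int_K divide_le_eq)
    also have "\<dots> \<longleftrightarrow> nat \<bar>a\<bar> \<le> nat \<bar>b\<bar>" unfolding of_int_nat by (rule archimedean_mono[OF assms])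
    also have "\<dots> \<longleftrightarrow> \<bar>a\<bar> \<le> \<bar>b\<bar>" by arith
    finally show ?thesis .
  qed
  have "\<exists>a b. c = of_int a / of_int b \<and> b \<noteq> 0" if "c \<in> \<rat>" for c :: qbar
    using that by (metis Rats_cases' order_less_irrefl)
  then show ?thesis using * by (auto simp: Rats_divide) blast
qed

text \<open>An integer prime to \<open>p\<close> has value 1 by a Bezout relation, since 1 is not a
  sum of two small terms. So the unit ball depends on \<open>p\<close> alone.\<close>

lemma nonarchimedean_unit_ball:
  assumes na: "\<And>n. v (of_nat n) \<le> 1" and p: "prime p" "v (of_nat p) < 1"
  shows "{c \<in> \<rat>. v c \<le> 1} = {of_int a / of_int b | a b. \<not> int p dvd b}"
proof -
  have na': "v (of_int a) \<le> 1" for a unfolding of_int_nat by (rule na)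
  have unit: "v (of_int b) = 1" if "\<not> int p dvd b" for b
  proof -
    have "coprime (int p) b" using that p(1) by (simp add: prime_imp_coprime)
    then obtain x y where "x * int p + y * b = 1" using bezout_int[of "int p" b] by (auto simp: coprime_iff_gcd_eq_1)
    then have "of_int x * of_nat p + of_int y * of_int b = (1 :: qbar)"
      by (metis of_int_1 of_int_add of_int_mult of_int_of_nat_eq)
    then have "1 \<le> max (v (of_int x * of_nat p)) (v (of_int y * of_int b))"
      using ultrametric_add[OF na, of "of_int x * of_nat p" "of_int y * of_int b"] one by (simp add: of_int_K K_closed)
    moreover have "v (of_int x * of_nat p) < 1"
      using na'[of x] p(2) ge_0[OF of_int_K[of x]] ge_0[OF K_closed(9)[of p]]
      by (simp add: mult of_int_K K_closed) (metis mult_left_le_one_le order_le_less_trans)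
    moreover have "v (of_int y * of_int b) \<le> v (of_int b)"
      using na'[of y] ge_0[OF of_int_K[of y]] ge_0[OF of_int_K[of b]] by (simp add: mult of_int_K mult_left_le_one_le)
    ultimately show ?thesis using na'[of b] by linarith
  qed
  have small: "v (of_int b) < 1" if pb: "int p dvd b" for b
  proof -
    obtain k where "b = int p * k" using pb by blast
    then have "v (of_int b) = v (of_nat p) * v (of_int k)" by (simp add: mult of_int_K K_closed)
    also have "\<dots> \<le> v (of_nat p)" using na'[of k] ge_0[OF K_closed(9)[of p]] by (rule mult_left_le)
    finally show ?thesis using p(2) by simp
  qed
  show ?thesis
  proof (intro equalityI subsetI)
    fix c assume c: "c \<in> {c \<in> \<rat>. v c \<le> 1}"
    then obtain a b where ab: "b > 0" "coprime a b" "c = of_int a / of_int b" using Rats_cases' by blast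
    have "\<not> int p dvd b"
    proof
      assume pb: "int p dvd b"
      then have "\<not> int p dvd a" using ab(2) p(1) by (metis coprime_common_divisor not_prime_unit prime_nat_int_transfer)
      then have "v c = 1 / v (of_int b)" using unit by (simp add: ab(3) divide of_int_K)
      moreover have "v (of_int b) > 0" using ab(1) by (intro pos of_int_K) simp
      ultimately show False using small[OF pb] c by (simp add: divide_le_eq)
    qed
    then show "c \<in> {of_int a / of_int b | a b. \<not> int p dvd b}" using ab(3) by blast
  next
    fix c :: qbar assume "c \<in> {of_int a / of_int b | a b. \<not> int p dvd b}"
    then obtain a b where "c = of_int a / of_int b" "\<not> int p dvd b" by blast
    then show "c \<in> {c \<in> \<rat>. v c \<le> 1}" using unit na'[of a] by (simp add: divide of_int_K Rats_divide)
  qed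
qed

end

section \<open>Primes below a nonarchimedean place\<close>

context abs_value
begin

lemma nonarchimedean_of_nat:
  assumes "\<And>x y. x \<in> K \<Longrightarrow> y \<in> K \<Longrightarrow> v (x + y) \<le> max (v x) (v y)"
  shows "v (of_nat n) \<le> 1"
proof (induction n)
  case (Suc n)
  have "v (of_nat n + 1) \<le> max (v (of_nat n)) (v 1)" by (intro assms K_closed)
  then show ?case using Suc by (simp add: one add.commute)
qed (simp add: zero)

lemma nonarchimedean_sum_less:
  assumes na: "\<And>x y. x \<in> K \<Longrightarrow> y \<in> K \<Longrightarrow> v (x + y) \<le> max (v x) (v y)" and "r > 0"
  shows "(\<And>i. i \<in> A \<Longrightarrow> f i \<in> K \<and> v (f i) < r) \<Longrightarrow> v (sum f A) < r"
proof (induction A rule: infinite_finite_induct)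
  case (insert x A)
  then have "f x \<in> K" "sum f A \<in> K" using sum[of A f] by auto
  then show ?case using insert na[of "f x" "sum f A"] by fastforce
qed (use assms(2) zero in auto)

lemma prime_of_small_integer:
  assumes na: "\<And>n. v (of_nat n) \<le> 1"
  shows "M \<noteq> 0 \<Longrightarrow> v (of_nat M) < 1 \<Longrightarrow> \<exists>p. prime p \<and> p dvd M \<and> v (of_nat p) < 1"
proof (induction M rule: less_induct)
  case (less M)
  have "M \<noteq> 1" using less.prems one by auto
  then obtain p where p: "prime p" "p dvd M" using prime_factor_nat by blast
  then obtain k where k: "M = p * k" by blast
  show ?case
  proof (cases "v (of_nat p) < 1")
    case False
    then have "v (of_nat p) = 1" using na[of p] by simp
    then have "v (of_nat k) < 1" using less.prems(2) by (simp add: k mult K_closed)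
    moreover have "k < M" "k \<noteq> 0" using less.prems(1) prime_gt_1_nat[OF p(1)] by (auto simp: k)
    ultimately obtain q where "prime q" "q dvd k" "v (of_nat q) < 1" using less.IH by blast
    then show ?thesis using k by auto
  qed (use p in blast)
qed

text \<open>If \<open>v a > 1\<close>, the top term of the equation of \<open>a\<close> would
  dominate unless its coefficient is small; if \<open>v a < 1\<close>, the same holds for the
  constant term. A small integer has a small prime factor.\<close>

lemma nonarchimedean_prime:
  assumes na: "\<And>x y. x \<in> K \<Longrightarrow> y \<in> K \<Longrightarrow> v (x + y) \<le> max (v x) (v y)"
    and a: "a \<in> K" "a \<noteq> 0" "v a \<noteq> 1"
    and P: "P \<noteq> 0" "Polynomial.coeff P 0 \<noteq> 0" "poly (map_poly of_int P) a = 0"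
  shows "\<exists>p. prime p \<and> p dvd nat \<bar>Polynomial.lead_coeff P * Polynomial.coeff P 0\<bar> \<and> v (of_nat p) < 1"
proof -
  note nat1 = nonarchimedean_of_nat[OF na]
  have int1: "v (of_int c) \<le> 1" for c unfolding of_int_nat by (rule nat1)
  define n where "n = Polynomial.degree P"
  define c where "c = (\<lambda>i. of_int (Polynomial.coeff P i) :: qbar)"
  have cK: "c i \<in> K" for i by (simp add: c_def of_int_K)
  have c1: "v (c i) \<le> 1" for i unfolding c_def by (rule int1)
  have va: "v a > 0" using pos a by simp
  have "Polynomial.degree (map_poly of_int P :: qbar poly) = n"
    unfolding n_def by (rule degree_map_poly) simp
  then have s: "(\<Sum>i\<le>n. c i * a ^ i) = 0"
    using P(3) by (simp add: poly_altdef coeff_map_poly c_def)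
  have trm: "c i * a ^ i \<in> K" "v (c i * a ^ i) \<le> v a ^ i" for i
  proof -
    show "c i * a ^ i \<in> K" using a cK by (intro K_closed)
    have "v (c i * a ^ i) = v (c i) * v a ^ i" using a cK by (simp add: mult power K_closed)
    also have "\<dots> \<le> 1 * v a ^ i" using c1 va by (intro mult_right_mono) auto
    finally show "v (c i * a ^ i) \<le> v a ^ i" by simp
  qed
  have n0: "n > 0"
  proof (rule ccontr)
    assume "\<not> n > 0"
    then have "c 0 = 0" using s by simp
    then show False using P(2) by (simp add: c_def)
  qed
  have "v (c n) < 1 \<or> v (c 0) < 1"
  proof (cases "v a > 1")
    case True
    have "(\<Sum>i\<le>n. c i * a ^ i) = (\<Sum>i<n. c i * a ^ i) + c n * a ^ n"
      by (simp add: lessThan_Suc_atMost[symmetric])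
    then have "c n * a ^ n = - (\<Sum>i<n. c i * a ^ i)" using s by (simp add: eq_neg_iff_add_eq_0 add.commute)
    then have "v (c n) * v a ^ n = v (\<Sum>i<n. c i * a ^ i)"
      using minus[of "\<Sum>i<n. c i * a ^ i"] sum[of "{..<n}" "\<lambda>i. c i * a ^ i"] trm cK a
      by (metis mult power K_closed(11))
    also have "\<dots> < v a ^ n"
    proof (rule nonarchimedean_sum_less[OF na])
      show "c i * a ^ i \<in> K \<and> v (c i * a ^ i) < v a ^ n" if "i \<in> {..<n}" for i
        using trm[of i] that True power_strict_increasing[of i n "v a"] by (auto intro: le_less_trans)
    qed (use va in auto)
    finally show ?thesis using va by simp
  next
    case False
    then have va1: "v a < 1" using a(3) by simp
    have "(\<Sum>i\<le>n. c i * a ^ i) = c 0 + (\<Sum>i\<in>{1..n}. c i * a ^ i)"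
      by (simp add: atMost_atLeast0 sum.atLeast_Suc_atMost)
    then have "c 0 = - (\<Sum>i\<in>{1..n}. c i * a ^ i)" using s by (simp add: eq_neg_iff_add_eq_0)
    then have "v (c 0) = v (\<Sum>i\<in>{1..n}. c i * a ^ i)"
      using minus sum[of "{1..n}" "\<lambda>i. c i * a ^ i"] trm by metis
    also have "\<dots> < 1"
    proof (rule nonarchimedean_sum_less[OF na])
      show "c i * a ^ i \<in> K \<and> v (c i * a ^ i) < 1" if "i \<in> {1..n}" for i
        using trm[of i] that va va1 power_less_one_iff[of "v a" i] by (auto intro: le_less_trans)
    qed auto
    finally show ?thesis by simp
  qed
  then have "v (c n * c 0) < 1"
    using c1 ge_0[OF cK] by (simp add: mult cK) (metis mult.commute mult_left_le order_le_less_trans)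
  then have "v (of_nat (nat \<bar>Polynomial.lead_coeff P * Polynomial.coeff P 0\<bar>)) < 1"
    unfolding of_int_nat[symmetric] by (simp add: c_def n_def)
  moreover have "nat \<bar>Polynomial.lead_coeff P * Polynomial.coeff P 0\<bar> \<noteq> 0" using P by simp
  ultimately show ?thesis by (intro prime_of_small_integer[OF nat1])
qed

end

section \<open>Equivalence of absolute values and weak approximation\<close>

lemma powr_le_1_iff: "0 \<le> x \<Longrightarrow> 0 < s \<Longrightarrow> x powr s \<le> 1 \<longleftrightarrow> x \<le> (1 :: real)"
  using gr_one_powr[of x s] powr_mono2[of s x 1] by (cases "x \<le> 1") (simp_all add: not_le)

lemma abs_value_nontrivial: "subfield K qbar_ring \<Longrightarrow> nontrivial_absolute_value K v \<Longrightarrow> abs_value K v"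
  by (rule abs_value.intro) (simp_all add: nontrivial_absolute_value_def)

lemma equiv_absolute_value:
  assumes K: "subfield K qbar_ring"
  shows "equiv {v. nontrivial_absolute_value K v} (absolute_value_equiv K)"
proof (rule equivI)
  show "absolute_value_equiv K \<subseteq> {v. nontrivial_absolute_value K v} \<times> {v. nontrivial_absolute_value K v}"
    by (auto simp: absolute_value_equiv_def)
  show "refl_on {v. nontrivial_absolute_value K v} (absolute_value_equiv K)"
  proof (rule refl_onI)
    fix v assume "v \<in> {v. nontrivial_absolute_value K v}"
    then have v: "nontrivial_absolute_value K v" by simp
    interpret abs_value K v using abs_value_nontrivial[OF K v] .
    have "\<forall>x\<in>K. v x = v x powr 1" using ge_0 by simp
    then show "(v, v) \<in> absolute_value_equiv K"
      using v unfolding absolute_value_equiv_def by (auto intro: exI[of _ 1])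
  qed
  show "sym (absolute_value_equiv K)"
  proof (rule symI)
    fix u v assume "(u, v) \<in> absolute_value_equiv K"
    then obtain s where uv: "nontrivial_absolute_value K u" "nontrivial_absolute_value K v" "s > 0"
      "\<forall>x\<in>K. v x = u x powr s" by (auto simp: absolute_value_equiv_def)
    interpret abs_value K u using abs_value_nontrivial[OF K uv(1)] .
    have "\<forall>x\<in>K. u x = v x powr (1 / s)" using uv(3,4) ge_0 by (simp add: powr_powr)
    then show "(v, u) \<in> absolute_value_equiv K"
      using uv unfolding absolute_value_equiv_def by (auto intro!: exI[of _ "1 / s"])
  qed
  show "trans (absolute_value_equiv K)"
  proof (rule transI)
    fix u v w assume "(u, v) \<in> absolute_value_equiv K" "(v, w) \<in> absolute_value_equiv K"
    then obtain s t where *: "nontrivial_absolute_value K u" "nontrivial_absolute_value K w" "s > 0" "t > 0"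
      "\<forall>x\<in>K. v x = u x powr s" "\<forall>x\<in>K. w x = v x powr t" by (auto simp: absolute_value_equiv_def)
    then have "s * t > 0" "\<forall>x\<in>K. w x = u x powr (s * t)" by (simp_all add: powr_powr)
    then show "(u, w) \<in> absolute_value_equiv K"
      using * unfolding absolute_value_equiv_def by blast
  qed
qed

lemma nontrivial_gt_1:
  assumes "subfield K qbar_ring" "nontrivial_absolute_value K v"
  obtains y where "y \<in> K" "v y > 1"
proof -
  interpret abs_value K v using abs_value_nontrivial[OF assms] .
  obtain x where x: "x \<in> K" "x \<noteq> 0" "v x \<noteq> 1"
    using assms(2) by (auto simp: nontrivial_absolute_value_def)
  show ?thesis
  proof (cases "v x > 1")
    case True then show ?thesis using that x by blast
  next
    case False
    then have "v x < 1" using x by simp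
    then have "v (inverse x) > 1" using x pos by (simp add: inverse one_less_inverse)
    then show ?thesis using that x K_closed(7) by blast
  qed
qed

text \<open>Comparing \<open>x ^ k\<close> with the \<open>m\<close>-th power of a fixed
  \<open>y\<close> shows that no rational number \<open>m / k\<close> separates the two ratios of
  logarithms, so \<open>ln (v x)\<close> is a fixed multiple of \<open>ln (u x)\<close>.\<close>

lemma absolute_value_equivI:
  assumes K: "subfield K qbar_ring" and u: "nontrivial_absolute_value K u" and v: "nontrivial_absolute_value K v"
    and uv: "\<And>x. x \<in> K \<Longrightarrow> u x < 1 \<Longrightarrow> v x < 1"
  shows "(u, v) \<in> absolute_value_equiv K"
proof -
  interpret u: abs_value K u using abs_value_nontrivial[OF K u] .
  interpret v: abs_value K v using abs_value_nontrivial[OF K v] .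
  have less: "u x < u y \<Longrightarrow> v x < v y" if "x \<in> K" "y \<in> K" "y \<noteq> 0" for x y
    using uv[of "x / y"] u.pos[OF that(2,3)] v.pos[OF that(2,3)] that
    by (simp add: u.divide v.divide u.K_closed)
  obtain y where y: "y \<in> K" "u y > 1" using nontrivial_gt_1[OF K u] by blast
  have y0: "y \<noteq> 0" using y(2) u.zero by auto
  have vy: "v y > 1" using less[of 1 y] y y0 u.K_closed u.one v.one by auto
  define s where "s = ln (v y) / ln (u y)"
  have s: "s > 0" using y vy by (simp add: s_def)
  have key: "ln (v x) / ln (v y) \<le> ln (u x) / ln (u y)" if x: "x \<in> K" "x \<noteq> 0" for x
  proof (rule ccontr)
    assume "\<not> ?thesis"
    then obtain r where r: "r \<in> \<rat>" "ln (u x) / ln (u y) < r" "r < ln (v x) / ln (v y)"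
      using Rats_dense_in_real by (metis not_le)
    then obtain m n where mn: "n > 0" "r = of_int m / of_int n" using Rats_cases' by metis
    define k where "k = nat n"
    have k: "real k = of_int n" "k > 0" using mn(1) by (simp_all add: k_def)
    have rk: "m = r * k" using mn k by simp
    have px: "u x > 0" "v x > 0" using x u.pos v.pos by auto
    have pK: "x ^ k \<in> K" "x ^ k \<noteq> 0" using x u.K_closed by auto
    define z where "z = (if m \<ge> 0 then y ^ nat m else inverse (y ^ nat (- m)))"
    have zK: "z \<in> K" "z \<noteq> 0" using y y0 by (auto simp: z_def intro!: u.K_closed)
    have lz: "ln (u z) = m * ln (u y)" "ln (v z) = m * ln (v y)"
      using y vy by (auto simp: z_def u.power v.power u.inverse v.inverse u.K_closed ln_realpow ln_inverse)
    have "ln (u x) < r * ln (u y)" using r(2) y by (simp add: pos_divide_less_eq)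
    then have "k * ln (u x) < k * (r * ln (u y))" using k(2) by (simp only: mult_less_cancel_left_pos of_nat_0_less_iff)
    then have "k * ln (u x) < m * ln (u y)" by (simp add: rk mult_ac)
    then have "ln (u (x ^ k)) < ln (u z)" using px by (simp add: u.power x lz ln_realpow)
    then have "u (x ^ k) < u z" using u.pos[OF pK] u.pos[OF zK] by simp
    then have "v (x ^ k) < v z" by (rule less[OF pK(1) zK])
    then have "ln (v (x ^ k)) < ln (v z)" using v.pos[OF pK] v.pos[OF zK] by simp
    then have "k * ln (v x) < m * ln (v y)" using px by (simp add: v.power x lz ln_realpow)
    then have "ln (v x) / ln (v y) < r"
    proof -
      have "real k * ln (v x) < real k * (r * ln (v y))"
        using \<open>k * ln (v x) < m * ln (v y)\<close> by (simp add: rk mult_ac)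
      then have "ln (v x) < r * ln (v y)" using k(2) by (simp only: mult_less_cancel_left_pos of_nat_0_less_iff)
      then show ?thesis using vy by (simp add: pos_divide_less_eq)
    qed
    then show False using r(3) by simp
  qed
  have "v x = u x powr s" if x: "x \<in> K" for x
  proof (cases "x = 0")
    case True then show ?thesis by (simp add: u.zero v.zero)
  next
    case False
    have px: "u x > 0" "v x > 0" using x False u.pos v.pos by auto
    \<comment> \<open>Applied to the inverse, \<open>key\<close> gives the opposite
      inequality.\<close>
    have "ln (v (inverse x)) / ln (v y) \<le> ln (u (inverse x)) / ln (u y)"
      using x False by (intro key u.K_closed) auto
    then have "- (ln (v x) / ln (v y)) \<le> - (ln (u x) / ln (u y))"
      using px by (simp add: u.inverse v.inverse x ln_inverse)
    then have "ln (v x) / ln (v y) = ln (u x) / ln (u y)" using key[OF x False] by simp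
    then have "ln (v x) = s * ln (u x)" using y vy by (simp add: s_def field_simps)
    then show ?thesis using px by (simp add: powr_def) (metis exp_ln)
  qed
  then show ?thesis using u v s unfolding absolute_value_equiv_def by blast
qed

lemma ratio_plus_1: "r > 1 \<Longrightarrow> r / (1 + r) = inverse (inverse r + 1)" for r :: real
  by (simp add: divide_simps add.commute)

lemma ratio_minus_1: "r > 1 \<Longrightarrow> r / (r - 1) = inverse (1 - inverse r)" for r :: real
  by (simp add: divide_simps)

text \<open>The quotient \<open>y = b / a\<close> separates \<open>v\<close> from the new
  \<open>u\<close>, and \<open>z\<close> separates it from \<open>W\<close>. If
  \<open>u z \<le> 1\<close>, a product \<open>z ^ n * y\<close> does both. If
  \<open>u z > 1\<close>, the power is replaced by \<open>z ^ n / (1 + z ^ n)\<close>, which tends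
  to 1 at \<open>v\<close> and \<open>u\<close> and to 0 on \<open>W\<close>.\<close>

lemma separating_element:
  assumes K: "subfield K qbar_ring" and v: "nontrivial_absolute_value K v" and "finite W"
    and "\<And>u. u \<in> W \<Longrightarrow> nontrivial_absolute_value K u \<and> (u, v) \<notin> absolute_value_equiv K"
  shows "\<exists>z\<in>K. v z > 1 \<and> (\<forall>u\<in>W. u z < 1)"
  using assms(3,4)
proof (induction W rule: finite_induct)
  case empty
  then show ?case using nontrivial_gt_1[OF K v] by auto
next
  case (insert u W)
  interpret v: abs_value K v using abs_value_nontrivial[OF K v] .
  have u: "nontrivial_absolute_value K u" "(u, v) \<notin> absolute_value_equiv K" using insert.prems by auto
  interpret u: abs_value K u using abs_value_nontrivial[OF K u(1)] .
  have u': "(v, u) \<notin> absolute_value_equiv K"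
    using u(2) equiv_absolute_value[OF K] by (metis equivE symE)
  obtain z where z: "z \<in> K" "v z > 1" "\<And>w. w \<in> W \<Longrightarrow> w z < 1" using insert by auto
  obtain a where a: "a \<in> K" "v a < 1" "u a \<ge> 1" using absolute_value_equivI[OF K v u(1)] u' by (metis not_le)
  obtain b where b: "b \<in> K" "u b < 1" "v b \<ge> 1" using absolute_value_equivI[OF K u(1) v] u(2) by (metis not_le)
  have a0: "a \<noteq> 0" using a(3) u.zero by auto
  define y where "y = b / a"
  have y: "y \<in> K" "v y > 1" "u y < 1"
    using a b v.pos[OF a(1) a0] u.pos[OF a(1) a0] by (auto simp: y_def u.divide v.divide intro: u.K_closed)
  have W: "abs_value K w" if "w \<in> W" for w using insert.prems[of w] that abs_value_nontrivial[OF K] by auto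
  have lim0: "(\<lambda>n. w z ^ n) \<longlonglongrightarrow> 0" if "w \<in> W" for w
  proof (rule LIMSEQ_power_zero)
    show "norm (w z) < 1" using z(3)[OF that] abs_value.ge_0[OF W[OF that] z(1)] by simp
  qed
  show ?case
  proof (cases "u z \<le> 1")
    case True
    have "\<forall>\<^sub>F n in sequentially. w z ^ n * w y < 1" if "w \<in> W" for w
    proof -
      have "(\<lambda>n. w z ^ n * w y) \<longlonglongrightarrow> 0 * w y" by (intro tendsto_intros lim0 that)
      then show ?thesis by (rule order_tendstoD) simp
    qed
    then have "\<forall>\<^sub>F n in sequentially. \<forall>w\<in>W. w z ^ n * w y < 1"
      using insert.hyps(1) by (simp add: eventually_ball_finite)
    then obtain n where n: "\<And>w. w \<in> W \<Longrightarrow> w z ^ n * w y < 1" by (auto simp: eventually_sequentially)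
    have zn: "z ^ n \<in> K" "z ^ n * y \<in> K" using z y by (auto intro: u.K_closed)
    have "w (z ^ n * y) < 1" if "w \<in> W" for w
      using n[OF that] by (simp add: abs_value.mult[OF W[OF that] zn(1) y(1)] abs_value.power[OF W[OF that] z(1)])
    moreover have "v z ^ n * v y > 1"
      using y(2) z(2) one_le_power[of "v z" n] by (metis less_1_mult less_eq_real_def mult_1)
    moreover have "u z ^ n * u y < 1"
      using True y(3) u.ge_0[OF y(1)] u.ge_0[OF z(1)] power_le_one[of "u z" n]
      by (meson le_less_trans mult_left_le_one_le zero_le_power)
    ultimately show ?thesis using zn y z by (intro bexI[of _ "z ^ n * y"]) (auto simp: v.mult u.mult v.power u.power)
  next
    case False
    then have uz: "u z > 1" by simp
    have inv0: "(\<lambda>n. inverse (x ^ n)) \<longlonglongrightarrow> 0" if "x > 1" for x :: real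
      using LIMSEQ_inverse_realpow_zero[OF that] .
    \<comment> \<open>By the triangle inequality \<open>x / (1 + x)\<close> has value at least
      \<open>r / (1 + r)\<close> at \<open>v\<close> and at most \<open>r / (r - 1)\<close> at
      \<open>u\<close>, with \<open>r\<close> the value of \<open>x\<close>. Written with inverses,
      these bounds have evident limits.\<close>
    have 1: "\<forall>\<^sub>F n in sequentially. inverse (inverse (v z ^ n) + 1) * v y > 1"
    proof -
      have "(\<lambda>n. inverse (inverse (v z ^ n) + 1) * v y) \<longlonglongrightarrow> inverse (0 + 1) * v y"
        by (intro tendsto_intros inv0 z(2)) simp
      then show ?thesis by (rule order_tendstoD) (use y in simp)
    qed
    have 2: "\<forall>\<^sub>F n in sequentially. inverse (1 - inverse (u z ^ n)) * u y < 1"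
    proof -
      have "(\<lambda>n. inverse (1 - inverse (u z ^ n)) * u y) \<longlonglongrightarrow> inverse (1 - 0) * u y"
        by (intro tendsto_intros inv0 uz) simp
      then show ?thesis by (rule order_tendstoD) (use y in simp)
    qed
    have 3: "\<forall>\<^sub>F n in sequentially. w z ^ n / (1 - w z ^ n) * w y < 1" if "w \<in> W" for w
    proof -
      have "(\<lambda>n. w z ^ n / (1 - w z ^ n) * w y) \<longlonglongrightarrow> 0 / (1 - 0) * w y"
        by (intro tendsto_intros lim0 that) simp
      then show ?thesis by (rule order_tendstoD) simp
    qed
    then have "\<forall>\<^sub>F n in sequentially. \<forall>w\<in>W. w z ^ n / (1 - w z ^ n) * w y < 1"
      using insert.hyps(1) by (simp add: eventually_ball_finite)
    with 1 2 eventually_gt_at_top[of 0] have "\<forall>\<^sub>F n in sequentially. inverse (inverse (v z ^ n) + 1) * v y > 1 \<and>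
        inverse (1 - inverse (u z ^ n)) * u y < 1 \<and> 0 < n \<and> (\<forall>w\<in>W. w z ^ n / (1 - w z ^ n) * w y < 1)"
      by (intro eventually_conj)
    then obtain n where n: "inverse (inverse (v z ^ n) + 1) * v y > 1" "inverse (1 - inverse (u z ^ n)) * u y < 1" "0 < n"
      "\<And>w. w \<in> W \<Longrightarrow> w z ^ n / (1 - w z ^ n) * w y < 1" by (auto simp: eventually_sequentially)
    define x where "x = z ^ n"
    have xK: "x \<in> K" "1 + x \<in> K" using z by (auto simp: x_def intro: u.K_closed)
    have vx: "v x > 1" "u x > 1" using z uz n(3) by (simp_all add: x_def v.power u.power)
    have x1: "1 + x \<noteq> 0"
    proof
      assume "1 + x = 0"
      then have "x = - 1" by (simp add: add_eq_0_iff)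
      then have "v x = 1" using v.minus[of 1] v.one u.K_closed by simp
      then show False using vx by simp
    qed
    define t where "t = x / (1 + x) * y"
    have tK: "t \<in> K" unfolding t_def using xK y by (intro u.K_closed)
    have vt: "w t = w x / w (1 + x) * w y" if "abs_value K w" for w
      using that xK y unfolding t_def by (simp add: abs_value.mult abs_value.divide u.K_closed)
    have "v t > 1"
    proof -
      have "v (1 + x) \<le> 1 + v x" using v.add[of 1 x] v.one xK u.K_closed by simp
      then have "v x / (1 + v x) \<le> v x / v (1 + x)" using v.pos[OF xK(2) x1] vx by (intro divide_left_mono) auto
      then have "v x / (1 + v x) * v y \<le> v t" unfolding vt[OF v.abs_value_axioms] using y by (intro mult_right_mono) auto
      moreover have "v x / (1 + v x) = inverse (inverse (v z ^ n) + 1)"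
        using ratio_plus_1[OF vx(1)] by (simp add: x_def v.power z)
      ultimately show ?thesis using n(1) by simp
    qed
    moreover have "u t < 1"
    proof -
      have "u x \<le> u (1 + x) + 1" using u.add[of "1 + x" "- 1"] u.minus[of 1] u.one xK u.K_closed by simp
      then have "u x / u (1 + x) \<le> u x / (u x - 1)" using u.pos[OF xK(2) x1] vx by (intro divide_left_mono) auto
      then have "u t \<le> u x / (u x - 1) * u y" unfolding vt[OF u.abs_value_axioms] using u.ge_0[OF y(1)] by (intro mult_right_mono) auto
      moreover have "u x / (u x - 1) = inverse (1 - inverse (u z ^ n))"
        using ratio_minus_1[OF vx(2)] by (simp add: x_def u.power z)
      ultimately show ?thesis using n(2) by simp
    qed
    moreover have "w t < 1" if "w \<in> W" for w
    proof -
      interpret w: abs_value K w by (rule W[OF that])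
      have wx: "w x < 1" "w x \<ge> 0" using z(3)[OF that] w.ge_0[OF z(1)] n(3) w.ge_0[OF xK(1)]
        by (auto simp: x_def w.power z power_less_one_iff)
      have "1 \<le> w (1 + x) + w x" using w.add[of "1 + x" "- x"] w.minus[OF xK(1)] w.one xK u.K_closed by simp
      then have "w x / w (1 + x) \<le> w x / (1 - w x)" using w.pos[OF xK(2) x1] wx by (intro divide_left_mono) auto
      then have "w t \<le> w x / (1 - w x) * w y" unfolding vt[OF w.abs_value_axioms] using w.ge_0[OF y(1)] by (intro mult_right_mono) auto
      also have "\<dots> < 1" using n(4)[OF that] by (simp add: x_def w.power z)
      finally show ?thesis .
    qed
    ultimately show ?thesis using tK by blast
  qed
qed

text \<open>Stands for the place induced on the rationals: unlike the restriction of
  \<open>v\<close>, it stays the same when \<open>v\<close> is replaced by an equivalent absolute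
  value.\<close>

definition unit_ball :: "(qbar \<Rightarrow> real) \<Rightarrow> qbar set" where
  "unit_ball v = {c \<in> \<rat>. v c \<le> 1}"

text \<open>Inequivalent absolute values that agree on the rationals up to order are bounded in number by
  the degree: high powers of elements \<open>z v\<close> separating \<open>v\<close> from the others are linearly independent.\<close>

lemma card_same_unit_ball:
  assumes "number_field K"
  obtains n where "\<And>W. finite W \<Longrightarrow> (\<And>v. v \<in> W \<Longrightarrow> nontrivial_absolute_value K v) \<Longrightarrow>
    (\<And>u v. u \<in> W \<Longrightarrow> v \<in> W \<Longrightarrow> u \<noteq> v \<Longrightarrow> (u, v) \<notin> absolute_value_equiv K) \<Longrightarrow>
    (\<And>u v. u \<in> W \<Longrightarrow> v \<in> W \<Longrightarrow> unit_ball u = unit_ball v) \<Longrightarrow> card W \<le> n"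
proof (rule number_field_dependent[OF assms])
  fix n
  assume dep: "\<And>V z. finite V \<Longrightarrow> card V > n \<Longrightarrow> (\<And>v. v \<in> V \<Longrightarrow> z v \<in> K) \<Longrightarrow>
    \<exists>c :: (qbar \<Rightarrow> real) \<Rightarrow> qbar. (\<forall>v\<in>V. c v \<in> \<rat>) \<and> (\<exists>v\<in>V. c v \<noteq> 0) \<and> (\<Sum>v\<in>V. c v * z v) = 0"
  have K: "subfield K qbar_ring"
    using assms by (auto simp: number_field_def Defs.finite_extension_def)
  show ?thesis
  proof (rule that[of n], rule ccontr)
    fix W assume W: "finite W" "\<And>v. v \<in> W \<Longrightarrow> nontrivial_absolute_value K v"
      "\<And>u v. u \<in> W \<Longrightarrow> v \<in> W \<Longrightarrow> u \<noteq> v \<Longrightarrow> (u, v) \<notin> absolute_value_equiv K"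
      "\<And>u v. u \<in> W \<Longrightarrow> v \<in> W \<Longrightarrow> unit_ball u = unit_ball v" and "\<not> card W \<le> n"
    have av: "abs_value K v" if "v \<in> W" for v using abs_value_nontrivial[OF K W(2)[OF that]] .
    have "\<exists>z\<in>K. v z > 1 \<and> (\<forall>u\<in>W - {v}. u z < 1)" if "v \<in> W" for v
      by (rule separating_element[OF K W(2)[OF that]]) (use W that in auto)
    then obtain z where z: "\<And>v. v \<in> W \<Longrightarrow> z v \<in> K" "\<And>v. v \<in> W \<Longrightarrow> v (z v) > 1"
      "\<And>u v. v \<in> W \<Longrightarrow> u \<in> W \<Longrightarrow> u \<noteq> v \<Longrightarrow> u (z v) < 1" by (metis Diff_iff singletonD)
    have "\<forall>\<^sub>F N in sequentially. v (z v) ^ N > real (card W)" if vW: "v \<in> W" for v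
    proof -
      obtain N where N: "real (card W) < v (z v) ^ N" using real_arch_pow[OF z(2)[OF vW]] by blast
      have "real (card W) < v (z v) ^ m" if "m \<ge> N" for m
        using N power_increasing[OF that, of "v (z v)"] z(2)[OF vW] by linarith
      then show ?thesis by (auto simp: eventually_sequentially)
    qed
    then have "\<forall>\<^sub>F N in sequentially. \<forall>v\<in>W. v (z v) ^ N > real (card W)"
      using W(1) by (simp add: eventually_ball_finite)
    then obtain N where N: "\<And>v. v \<in> W \<Longrightarrow> v (z v) ^ N > real (card W)" by (auto simp: eventually_sequentially)
    have "\<exists>c. (\<forall>v\<in>W. c v \<in> \<rat>) \<and> (\<exists>v\<in>W. c v \<noteq> 0) \<and> (\<Sum>v\<in>W. c v * z v ^ N) = 0"
      by (rule dep[OF W(1)]) (use \<open>\<not> card W \<le> n\<close> z(1) subfield_closed(11)[OF K] in auto)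
    then obtain c where c: "\<And>v. v \<in> W \<Longrightarrow> c v \<in> \<rat>" "\<exists>v\<in>W. c v \<noteq> 0" "(\<Sum>v\<in>W. c v * z v ^ N) = 0" by blast
    obtain u0 where u0: "u0 \<in> W" "c u0 \<noteq> 0" using c(2) by blast
    interpret u0: abs_value K u0 by (rule av[OF u0(1)])
    \<comment> \<open>A coefficient of maximal value at \<open>u0\<close>. Ratios of coefficients
      are rational and all unit balls agree, so it is maximal at \<open>v\<close> itself as
      well.\<close>
    obtain v where v: "v \<in> W" "\<And>u. u \<in> W \<Longrightarrow> u0 (c u) \<le> u0 (c v)"
    proof -
      have "Max ((\<lambda>u. u0 (c u)) ` W) \<in> (\<lambda>u. u0 (c u)) ` W" using W(1) u0 by (intro Max_in) auto
      then obtain v where "v \<in> W" "u0 (c v) = Max ((\<lambda>u. u0 (c u)) ` W)" by auto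
      then show ?thesis using that W(1) by simp
    qed
    have cK: "c u \<in> K" if "u \<in> W" for u using c(1)[OF that] u0.Rats_K by blast
    have "u0 (c v) > 0" using v(2)[OF u0(1)] u0.pos[OF cK[OF u0(1)] u0(2)] by linarith
    then have cv0: "c v \<noteq> 0" using u0.zero by auto
    interpret v: abs_value K v by (rule av[OF v(1)])
    have vc: "v (c u) \<le> v (c v)" if u: "u \<in> W" for u
    proof -
      have "c u / c v \<in> unit_ball u0"
        using c(1)[OF u] c(1)[OF v(1)] v(2)[OF u] u0.pos[OF cK[OF v(1)] cv0]
        by (simp add: unit_ball_def Rats_divide u0.divide cK u v(1))
      then have "c u / c v \<in> unit_ball v" using W(4)[OF u0(1) v(1)] by simp
      then show ?thesis using v.pos[OF cK[OF v(1)] cv0]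
        by (simp add: unit_ball_def v.divide cK u v(1) divide_le_eq)
    qed
    have zK: "c u * z u ^ N \<in> K" if "u \<in> W" for u using cK z(1) that by (intro v.K_closed) auto
    have "(\<Sum>u\<in>W. c u * z u ^ N) = c v * z v ^ N + (\<Sum>u\<in>W - {v}. c u * z u ^ N)"
      by (rule sum.remove[OF W(1) v(1)])
    then have "c v * z v ^ N = - (\<Sum>u\<in>W - {v}. c u * z u ^ N)" using c(3) by (simp add: eq_neg_iff_add_eq_0)
    then have "v (c v * z v ^ N) = v (\<Sum>u\<in>W - {v}. c u * z u ^ N)"
      using v.minus v.sum[of "W - {v}" "\<lambda>u. c u * z u ^ N"] zK by (metis DiffD1)
    also have "\<dots> \<le> (\<Sum>u\<in>W - {v}. v (c u * z u ^ N))"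
      using v.sum[of "W - {v}" "\<lambda>u. c u * z u ^ N"] zK by auto
    \<comment> \<open>The other elements have powers of value at most 1 at \<open>v\<close>, so
      their terms cannot cancel the term of \<open>v\<close>, which is larger by a factor above
      \<open>card W\<close>.\<close>
    also have "\<dots> \<le> (\<Sum>u\<in>W - {v}. v (c v))"
    proof (rule sum_mono)
      fix u assume u: "u \<in> W - {v}"
      have "v (c u * z u ^ N) = v (c u) * v (z u) ^ N" using u cK z(1) by (simp add: v.mult v.power v.K_closed)
      also have "\<dots> \<le> v (c u) * 1"
        using u z v.ge_0 cK v(1) by (intro mult_left_mono power_le_one) (auto intro: less_imp_le)
      finally show "v (c u * z u ^ N) \<le> v (c v)" using vc u by force
    qed
    also have "\<dots> \<le> card W * v (c v)"
      using v.ge_0[OF cK[OF v(1)]] card_Diff1_le[of W v] by (simp add: mult_right_mono)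
    finally have "v (c v) * v (z v) ^ N \<le> v (c v) * card W"
      using cK z(1) v(1) by (simp add: v.mult v.power v.K_closed mult.commute)
    then have "v (z v) ^ N \<le> card W" using v.pos[OF cK[OF v(1)] cv0] by simp
    then show False using N[OF v(1)] by simp
  qed
qed

section \<open>Finiteness of the set of bad places\<close>

definition place_rep :: "(qbar \<Rightarrow> real) set \<Rightarrow> qbar \<Rightarrow> real" where
  "place_rep \<nu> = (SOME v. v \<in> \<nu>)"

lemma place_rep_in: "subfield K qbar_ring \<Longrightarrow> \<nu> \<in> places K \<Longrightarrow> place_rep \<nu> \<in> \<nu>"
  unfolding place_rep_def places_def
  using in_quotient_imp_non_empty[OF equiv_absolute_value] by (metis some_in_eq)

lemma place_nontrivial: "subfield K qbar_ring \<Longrightarrow> \<nu> \<in> places K \<Longrightarrow> v \<in> \<nu> \<Longrightarrow> nontrivial_absolute_value K v"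
  unfolding places_def using in_quotient_imp_subset[OF equiv_absolute_value] by blast

lemma place_equiv:
  "subfield K qbar_ring \<Longrightarrow> \<nu> \<in> places K \<Longrightarrow> u \<in> \<nu> \<Longrightarrow> v \<in> \<nu> \<Longrightarrow> (u, v) \<in> absolute_value_equiv K"
  unfolding places_def using in_quotient_imp_in_rel[OF equiv_absolute_value] by blast

lemma unit_ball_equiv:
  assumes K: "subfield K qbar_ring" and uv: "(u, v) \<in> absolute_value_equiv K"
  shows "unit_ball v = unit_ball u"
proof -
  obtain s where s: "nontrivial_absolute_value K u" "s > 0" "\<And>x. x \<in> K \<Longrightarrow> v x = u x powr s"
    using uv by (auto simp: absolute_value_equiv_def)
  interpret abs_value K u by (rule abs_value_nontrivial[OF K s(1)])
  have "v x \<le> 1 \<longleftrightarrow> u x \<le> 1" if "x \<in> \<rat>" for x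
    using s(3)[OF Rats_K[OF that]] powr_le_1_iff[OF ge_0[OF Rats_K[OF that]] s(2)] by simp
  then show ?thesis unfolding unit_ball_def by blast
qed

text \<open>Representatives of different places are inequivalent, so
  \<open>card_same_unit_ball\<close> bounds the size of every finite subset by the same
  number.\<close>

lemma finite_places_unit_ball:
  assumes "number_field K"
  shows "finite {\<nu> \<in> places K. unit_ball (place_rep \<nu>) = U}"
proof (rule card_same_unit_ball[OF assms])
  fix n
  assume n: "\<And>W. finite W \<Longrightarrow> (\<And>v. v \<in> W \<Longrightarrow> nontrivial_absolute_value K v) \<Longrightarrow>
    (\<And>u v. u \<in> W \<Longrightarrow> v \<in> W \<Longrightarrow> u \<noteq> v \<Longrightarrow> (u, v) \<notin> absolute_value_equiv K) \<Longrightarrow>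
    (\<And>u v. u \<in> W \<Longrightarrow> v \<in> W \<Longrightarrow> unit_ball u = unit_ball v) \<Longrightarrow> card W \<le> n"
  have K: "subfield K qbar_ring"
    using assms by (auto simp: number_field_def Defs.finite_extension_def)
  have eq: "\<mu> = \<nu>" if h: "\<mu> \<in> places K" "\<nu> \<in> places K" "(place_rep \<mu>, place_rep \<nu>) \<in> absolute_value_equiv K" for \<mu> \<nu>
    using quotient_eqI[OF equiv_absolute_value[OF K]] place_rep_in[OF K h(1)] place_rep_in[OF K h(2)] h
    unfolding places_def by blast
  have "card G \<le> n" if G: "G \<subseteq> {\<nu> \<in> places K. unit_ball (place_rep \<nu>) = U}" "finite G" for G
  proof -
    have pl: "\<nu> \<in> places K" if "\<nu> \<in> G" for \<nu> using G(1) that by blast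
    have "inj_on place_rep G"
    proof (rule inj_onI)
      fix \<mu> \<nu> assume h: "\<mu> \<in> G" "\<nu> \<in> G" "place_rep \<mu> = place_rep \<nu>"
      have "(place_rep \<mu>, place_rep \<mu>) \<in> absolute_value_equiv K"
        by (intro place_equiv[OF K pl[OF h(1)]] place_rep_in[OF K pl[OF h(1)]])
      then show "\<mu> = \<nu>" using eq[OF pl[OF h(1)] pl[OF h(2)]] h(3) by simp
    qed
    then have "card G = card (place_rep ` G)" by (simp add: card_image)
    also have "\<dots> \<le> n"
    proof (rule n)
      show "finite (place_rep ` G)" using G(2) by simp
      show "nontrivial_absolute_value K v" if "v \<in> place_rep ` G" for v
        using that place_nontrivial[OF K] place_rep_in[OF K] pl by blast
      show "(u, v) \<notin> absolute_value_equiv K" if h: "u \<in> place_rep ` G" "v \<in> place_rep ` G" "u \<noteq> v" for u v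
        using h eq pl by blast
      show "unit_ball u = unit_ball v" if h: "u \<in> place_rep ` G" "v \<in> place_rep ` G" for u v
        using h G(1) by auto
    qed
    finally show ?thesis .
  qed
  then show ?thesis using finite_if_finite_subsets_card_bdd by blast
qed

lemma archimedean_place_unit_ball:
  assumes K: "subfield K qbar_ring" and nu: "\<nu> \<in> archimedean_places K"
  shows "unit_ball (place_rep \<nu>) = {of_int a / of_int b | a b. b \<noteq> 0 \<and> \<bar>a\<bar> \<le> \<bar>b\<bar>}"
proof -
  obtain v x y where v: "\<nu> \<in> places K" "v \<in> \<nu>" "x \<in> K" "y \<in> K" "v (x + y) > max (v x) (v y)"
    using nu by (auto simp: archimedean_places_def)
  interpret abs_value K v by (rule abs_value_nontrivial[OF K place_nontrivial[OF K v(1,2)]])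
  obtain n where "v (of_nat n) > 1" using ultrametric_add[OF _ v(3,4)] v(5) by (meson leD not_le)
  then have "unit_ball v = {of_int a / of_int b | a b. b \<noteq> 0 \<and> \<bar>a\<bar> \<le> \<bar>b\<bar>}"
    unfolding unit_ball_def by (rule archimedean_unit_ball)
  then show ?thesis
    using unit_ball_equiv[OF K place_equiv[OF K v(1,2) place_rep_in[OF K v(1)]]] by simp
qed

lemma nonarchimedean_place_add:
  "\<nu> \<in> places K \<Longrightarrow> \<nu> \<notin> archimedean_places K \<Longrightarrow> v \<in> \<nu> \<Longrightarrow> x \<in> K \<Longrightarrow> y \<in> K \<Longrightarrow> v (x + y) \<le> max (v x) (v y)"
  unfolding archimedean_places_def by (auto simp: not_less le_max_iff_disj)

text \<open>A nonarchimedean place at which \<open>a\<close> is not a unit lies over a prime that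
  divides the product of the leading and constant coefficients of an integer equation for
  \<open>a\<close>. So only finitely many unit balls occur.\<close>

lemma finite_bad_places:
  assumes nf: "number_field K" and E: "finite E" "E \<subseteq> K"
  shows "finite (archimedean_places K \<union> {\<nu> \<in> places K. \<exists>a\<in>E. a \<noteq> 0 \<and> (\<exists>v\<in>\<nu>. v a \<noteq> 1)})"
proof -
  have K: "subfield K qbar_ring"
    using nf by (auto simp: number_field_def Defs.finite_extension_def)
  have "\<exists>P. P \<noteq> 0 \<and> Polynomial.coeff P 0 \<noteq> 0 \<and> poly (map_poly of_int P) a = 0" if "a \<noteq> 0" for a :: qbar
    using algebraicE'_nonzero[OF qbar_algebraic that] by metis
  then obtain P where P: "\<And>a :: qbar. a \<noteq> 0 \<Longrightarrow> P a \<noteq> 0" "\<And>a. a \<noteq> 0 \<Longrightarrow> Polynomial.coeff (P a) 0 \<noteq> 0"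
    "\<And>a. a \<noteq> 0 \<Longrightarrow> poly (map_poly of_int (P a)) a = 0" by metis
  define N where "N = (\<lambda>a. nat \<bar>Polynomial.lead_coeff (P a) * Polynomial.coeff (P a) 0\<bar>)"
  define U where "U = (\<lambda>p. {of_int a / of_int b :: qbar | a b. \<not> int p dvd b})"
  define R where "R = (\<lambda>V. {\<nu> \<in> places K. unit_ball (place_rep \<nu>) = V})"
  have "\<nu> \<in> R {of_int a / of_int b | a b. b \<noteq> 0 \<and> \<bar>a\<bar> \<le> \<bar>b\<bar>}" if "\<nu> \<in> archimedean_places K" for \<nu>
    using archimedean_place_unit_ball[OF K that] that by (simp add: R_def archimedean_places_def)
  moreover have "\<nu> \<in> (\<Union>a\<in>E - {0}. \<Union>p\<in>{p. p dvd N a}. R (U p))"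
    if nu: "\<nu> \<in> places K" "\<nu> \<notin> archimedean_places K" and a: "a \<in> E" "a \<noteq> 0" and v: "v \<in> \<nu>" "v a \<noteq> 1" for \<nu> a v
  proof -
    interpret abs_value K v by (rule abs_value_nontrivial[OF K place_nontrivial[OF K nu(1) v(1)]])
    note na = nonarchimedean_place_add[OF nu v(1)]
    have aK: "a \<in> K" using a E by blast
    obtain p where p: "prime p" "p dvd N a" "v (of_nat p) < 1"
      using nonarchimedean_prime[OF na aK a(2) v(2) P(1)[OF a(2)] P(2)[OF a(2)] P(3)[OF a(2)]]
      unfolding N_def by blast
    have "unit_ball v = U p"
      unfolding unit_ball_def U_def by (rule nonarchimedean_unit_ball[OF nonarchimedean_of_nat[OF na] p(1,3)])
    then have "\<nu> \<in> R (U p)" 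
      using unit_ball_equiv[OF K place_equiv[OF K nu(1) v(1) place_rep_in[OF K nu(1)]]] nu(1) by (simp add: R_def)
    then show ?thesis using a p(2) by blast
  qed
  ultimately have "archimedean_places K \<union> {\<nu> \<in> places K. \<exists>a\<in>E. a \<noteq> 0 \<and> (\<exists>v\<in>\<nu>. v a \<noteq> 1)} \<subseteq>
      R {of_int a / of_int b | a b. b \<noteq> 0 \<and> \<bar>a\<bar> \<le> \<bar>b\<bar>} \<union> (\<Union>a\<in>E - {0}. \<Union>p\<in>{p. p dvd N a}. R (U p))"
    by blast
  moreover have "finite \<dots>"
  proof -
    have "finite (R V)" for V unfolding R_def by (rule finite_places_unit_ball[OF nf])
    moreover have "finite {p. p dvd N a}" if "a \<in> E - {0}" for a
      using P(1,2)[of a] that by (intro finite_divisors_nat) (simp add: N_def)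
    ultimately show ?thesis using E(1) by (intro finite_UnI finite_UN_I finite_Diff) auto
  qed
  ultimately show ?thesis by (rule finite_subset)
qed

text \<open>Whether an absolute value is ultrametric is decided on the natural numbers. These lie in
  \<open>K\<close>, so the property passes from \<open>K\<close> to the whole algebraic
  closure.\<close>

lemma ultrametric_extension:
  assumes K: "subfield K qbar_ring" and "\<nu> \<in> places K" "\<nu> \<notin> archimedean_places K" and w: "extends_place \<nu> w"
  shows "ultrametric w"
proof -
  interpret Q: field qbar_ring by (rule field_qbar)
  have "subfield (carrier qbar_ring) qbar_ring" by (rule Q.carrier_is_subfield)
  then have "subfield UNIV qbar_ring" by (simp add: ring_of_type_algebra_def)
  then interpret u: abs_value UNIV w using w by (intro abs_value.intro) (simp_all add: extends_place_def)
  have w': "w \<in> \<nu>" using w by (simp add: extends_place_def)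
  interpret abs_value K w by (rule abs_value_nontrivial[OF K place_nontrivial[OF K assms(2) w']])
  have "w (of_nat n) \<le> 1" for n
    by (rule nonarchimedean_of_nat[OF nonarchimedean_place_add[OF assms(2,3) w']])
  then show ?thesis unfolding ultrametric_def using u.ultrametric_add u.av by blast
qed

lemma S_integral_pointsI:
  assumes K: "subfield K qbar_ring" "E \<subseteq> K"
    and S: "archimedean_places K \<subseteq> S" "{\<nu> \<in> places K. \<exists>a\<in>E. a \<noteq> 0 \<and> (\<exists>v\<in>\<nu>. v a \<noteq> 1)} \<subseteq> S"
    and A: "A \<subseteq> Xt" "A \<subseteq> rational_points K"
      "\<forall>w. ultrametric w \<longrightarrow> (\<forall>a\<in>E. a \<noteq> 0 \<longrightarrow> w a = 1) \<longrightarrow> (\<forall>P\<in>A. reduction w P \<notin> reduction w ` D)"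
  shows "A \<subseteq> S_integral_points K S Xt D"
proof
  fix P assume P: "P \<in> A"
  have red: "reduction w P \<notin> reduction w ` D" if "ultrametric w" "\<forall>a\<in>E. a \<noteq> 0 \<longrightarrow> w a = 1" for w
    using A(3) that P by blast
  have "P \<notin> D" using red[OF ultrametric_trivial] by auto
  moreover have "reduction w P \<notin> reduction w ` D" if h: "\<nu> \<in> places K - S" "extends_place \<nu> w" for \<nu> w
  proof (rule red)
    show "ultrametric w" using ultrametric_extension[OF K(1) _ _ h(2)] h(1) S(1) by blast
    show "\<forall>a\<in>E. a \<noteq> 0 \<longrightarrow> w a = 1" using h S(2) unfolding extends_place_def by blast
  qed
  ultimately show "P \<in> S_integral_points K S Xt D"
    using A(1,2) P unfolding S_integral_points_def by blast
qed

lemma zariski_closure_mono: "A \<subseteq> B \<Longrightarrow> zariski_closure A \<subseteq> zariski_closure B"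
  unfolding zariski_closure_def by blast

lemma dense_integralE:
  assumes "dense_integral Xt D"
  obtains E A where "finite E" "A \<subseteq> Xt" "\<forall>K. subfield K qbar_ring \<longrightarrow> E \<subseteq> K \<longrightarrow> A \<subseteq> rational_points K"
    "\<forall>w. ultrametric w \<longrightarrow> (\<forall>a\<in>E. a \<noteq> 0 \<longrightarrow> w a = 1) \<longrightarrow> (\<forall>P\<in>A. reduction w P \<notin> reduction w ` D)"
    "Xt \<subseteq> zariski_closure A"
  using assms[unfolded dense_integral_def] by (elim exE conjE) (rule that, assumption+)

lemma nine_lines_denseE:
  assumes "nine_lines_dense Xt"
  obtains L where "\<forall>i\<in>{1..9::nat}. line_over UNIV (L i) \<and> L i \<subseteq> Xt" "inj_on L {1..9}"
    "dense_integral Xt (\<Union>i\<in>{1..9}. L i)"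
  using assms[unfolded nine_lines_dense_def] by (elim exE conjE) (rule that, assumption+)

lemma lines_over_finite:
  assumes "finite I" "\<And>i. i \<in> I \<Longrightarrow> line_over UNIV (L i)"
  obtains E where "finite E" "\<forall>K. E \<subseteq> K \<longrightarrow> (\<forall>i\<in>I. line_over K (L i))"
proof -
  have "\<exists>B. finite B \<and> (\<forall>K. B \<subseteq> K \<longrightarrow> line_over K M)" if "line_over UNIV M" for M
    by (rule line_over_finite[OF that]) blast
  then have "\<forall>i\<in>I. \<exists>B. finite B \<and> (\<forall>K. B \<subseteq> K \<longrightarrow> line_over K (L i))" using assms(2) by blast
  from bchoice[OF this] obtain B where B: "\<forall>i\<in>I. finite (B i) \<and> (\<forall>K. B i \<subseteq> K \<longrightarrow> line_over K (L i))" ..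
  show ?thesis
  proof (rule that)
    show "finite (\<Union>i\<in>I. B i)" using B assms(1) by blast
    show "\<forall>K. (\<Union>i\<in>I. B i) \<subseteq> K \<longrightarrow> (\<forall>i\<in>I. line_over K (L i))" using B by blast
  qed
qed


theorem theorem8:
  fixes k :: "qbar set" and F :: "(4 \<Rightarrow> nat) \<Rightarrow> qbar"
    and Xt H1 H2 :: "point set" and L :: "nat \<Rightarrow> point set"
  assumes "number_field k"
    and "\<forall>e\<in>exponents 3. F e \<in> k"
    and "smooth_form 3 F"
    and "Xt = zero_locus 3 F"
    and "\<forall>i\<in>{1..5}. line_over UNIV (L i) \<and> L i \<subseteq> Xt"
    and "inj_on L {1..5}"
    and "plane_over UNIV H1" and "plane_over UNIV H2" and "H1 \<noteq> H2"
    and "\<forall>i\<in>{1..5}. L i \<subseteq> Xt \<inter> H1 \<or> L i \<subseteq> Xt \<inter> H2"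
  shows "\<exists>k' S. finite_extension k k' \<and>
           S \<subseteq> places k' \<and> finite S \<and> archimedean_places k' \<subseteq> S \<and>
           (\<forall>i\<in>{1..5}. line_over k' (L i)) \<and>
           zariski_dense (S_integral_points k' S Xt (\<Union>i\<in>{1..5}. L i)) (Xt - (\<Union>i\<in>{1..5}. L i)) \<and>
           (\<exists>L'. (\<forall>i\<in>{1..9::nat}. line_over k' (L' i) \<and> L' i \<subseteq> Xt) \<and> inj_on L' {1..9} \<and>
              (\<exists>A. A \<subseteq> S_integral_points k' S Xt (\<Union>i\<in>{1..9}. L' i) \<and>
                   zariski_dense A (Xt - (\<Union>i\<in>{1..9}. L' i))))"
proof -
  obtain h1 where h1: "h1 \<noteq> 0" "H1 = pplane h1" using plane_over_pplane[OF assms(7)] by blast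
  obtain h2 where h2: "h2 \<noteq> 0" "H2 = pplane h2" using plane_over_pplane[OF assms(8)] by blast
  define D where "D = (\<Union>i\<in>{1..5}. L i)"
  have "dense_integral Xt D \<and> nine_lines_dense Xt"
    unfolding assms(4) D_def
    by (rule dense_integral_config[OF smooth_form_nonsing[OF assms(3)] h1(1) h2(1)])
      (use assms(4-6,9,10) h1(2) h2(2) in auto)
  then have D: "dense_integral Xt D" and nine: "nine_lines_dense Xt" by (rule conjunct1, rule conjunct2)
  obtain L' where L': "\<forall>i\<in>{1..9::nat}. line_over UNIV (L' i) \<and> L' i \<subseteq> Xt" "inj_on L' {1..9}"
    and D9: "dense_integral Xt (\<Union>i\<in>{1..9}. L' i)"
    by (rule nine_lines_denseE[OF nine])
  define D' where "D' = (\<Union>i\<in>{1..9}. L' i)"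
  have D': "dense_integral Xt D'" unfolding D'_def by (rule D9)
  obtain E A where E: "finite E"
    and A: "A \<subseteq> Xt" "\<forall>K. subfield K qbar_ring \<longrightarrow> E \<subseteq> K \<longrightarrow> A \<subseteq> rational_points K"
      "\<forall>w. ultrametric w \<longrightarrow> (\<forall>a\<in>E. a \<noteq> 0 \<longrightarrow> w a = 1) \<longrightarrow> (\<forall>P\<in>A. reduction w P \<notin> reduction w ` D)"
      "Xt \<subseteq> zariski_closure A"
    by (rule dense_integralE[OF D])
  obtain E' A' where E': "finite E'"
    and A': "A' \<subseteq> Xt" "\<forall>K. subfield K qbar_ring \<longrightarrow> E' \<subseteq> K \<longrightarrow> A' \<subseteq> rational_points K"
      "\<forall>w. ultrametric w \<longrightarrow> (\<forall>a\<in>E'. a \<noteq> 0 \<longrightarrow> w a = 1) \<longrightarrow> (\<forall>P\<in>A'. reduction w P \<notin> reduction w ` D')"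
      "Xt \<subseteq> zariski_closure A'"
    by (rule dense_integralE[OF D'])
  obtain B where B: "finite B" "\<forall>K. B \<subseteq> K \<longrightarrow> (\<forall>i\<in>{1..5}. line_over K (L i))"
    by (rule lines_over_finite[of "{1..5}" L]) (use assms(5) in blast)+
  obtain B' where B': "finite B'" "\<forall>K. B' \<subseteq> K \<longrightarrow> (\<forall>i\<in>{1..9}. line_over K (L' i))"
    by (rule lines_over_finite[of "{1..9}" L']) (use L'(1) in blast)+
  \<comment> \<open>One field and one set \<open>S\<close> serve both point sets. The constants
    \<open>B\<close> and \<open>B'\<close> are adjoined so that the five and the nine lines are
    defined over \<open>k'\<close>.\<close>
  have "finite ((E \<union> E') \<union> (B \<union> B'))" using E E' B(1) B'(1) by simp
  then obtain k' where k': "finite_extension k k'" and sub: "(E \<union> E') \<union> (B \<union> B') \<subseteq> k'"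
    by (rule finite_extension_adjoin[OF assms(1)])
  have k'_sub: "E \<union> E' \<subseteq> k'" "E \<subseteq> k'" "E' \<subseteq> k'" "B \<subseteq> k'" "B' \<subseteq> k'" using sub by simp_all
  have K: "subfield k' qbar_ring" using k' by (simp add: Defs.finite_extension_def)
  define S where "S = archimedean_places k' \<union> {\<nu> \<in> places k'. \<exists>a\<in>E \<union> E'. a \<noteq> 0 \<and> (\<exists>v\<in>\<nu>. v a \<noteq> 1)}"
  have S: "finite S" unfolding S_def
    by (rule finite_bad_places[OF number_field_trans[OF assms(1) k'] _ k'_sub(1)]) (simp add: E E')
  have S': "S \<subseteq> places k'" "archimedean_places k' \<subseteq> S" unfolding S_def archimedean_places_def by auto
  have bad: "{\<nu> \<in> places k'. \<exists>a\<in>E. a \<noteq> 0 \<and> (\<exists>v\<in>\<nu>. v a \<noteq> 1)} \<subseteq> S"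
    "{\<nu> \<in> places k'. \<exists>a\<in>E'. a \<noteq> 0 \<and> (\<exists>v\<in>\<nu>. v a \<noteq> 1)} \<subseteq> S" unfolding S_def by auto
  have I: "A \<subseteq> S_integral_points k' S Xt D"
    by (rule S_integral_pointsI[OF K k'_sub(2) S'(2) bad(1) A(1) A(2)[rule_format, OF K k'_sub(2)] A(3)])
  have I': "A' \<subseteq> S_integral_points k' S Xt D'"
    by (rule S_integral_pointsI[OF K k'_sub(3) S'(2) bad(2) A'(1) A'(2)[rule_format, OF K k'_sub(3)] A'(3)])
  have sip: "S_integral_points k' S Xt M \<subseteq> Xt - M" for M unfolding S_integral_points_def by blast
  \<comment> \<open>The explicit set \<open>A\<close> already has the surface in its closure, and a
    larger set has a larger closure.\<close>
  have dense: "zariski_dense (S_integral_points k' S Xt D) (Xt - D)"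
    unfolding zariski_dense_def using sip order_trans[OF A(4) zariski_closure_mono[OF I]] by simp blast
  have dense': "zariski_dense A' (Xt - D')"
    unfolding zariski_dense_def using order_trans[OF I' sip] A'(4) by simp blast
  have lines: "\<forall>i\<in>{1..5}. line_over k' (L i)" using B(2) k'_sub(4) by blast
  have lines': "\<forall>i\<in>{1..9}. line_over k' (L' i) \<and> L' i \<subseteq> Xt"
  proof (intro ballI conjI)
    fix i :: nat assume i: "i \<in> {1..9}"
    show "line_over k' (L' i)" by (rule B'(2)[rule_format, OF k'_sub(5) i])
    show "L' i \<subseteq> Xt" using bspec[OF L'(1) i] by (rule conjunct2)
  qed
  show ?thesis
    by (intro exI[of _ k'] exI[of _ S] exI[of _ L'] exI[of _ A'] conjI, fold D_def D'_def)
      (rule k' S S' lines dense lines' L'(2) I' dense')+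
qed

end
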